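(* The category of simplicial sets satisfies the fibration extension property: for every $\kappa$-small Kan fibration $q\colon D\to A$ and every trivial cofibration of simplicial sets $j\colon A\to B$, there exist a $\kappa$-small Kan fibration $p\colon E\to B$ and a map $D\to E$ such that the resulting square from $q$ to $p$ over $j$ is a pullback square.
   Context: The category of simplicial sets is equipped with the Kan--Quillen model structure: cofibrations are the monomorphisms, weak equivalences are the weak homotopy equivalences, fibrations are the Kan fibrations (maps with the right lifting property against all horn inclusions $\Lambda^n_k\to\Delta^n$, $n\ge1$, $0\le k\le n$); trivial cofibrations are the monomorphisms that are weak homotopy equivalences. Fix a regular cardinal $\kappa$ larger than the cardinality of the set of morphisms of the simplex category. A map $f\colon E\to B$ of simplicial sets is $\kappa$-small if for all $n$ and all $b\in B_n$ the fiber of $E_n\to B_n$ over $b$ has cardinality $<\kappa$. *)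

theory Defs
  imports Main "HOL-Library.FuncSet"
begin

unbundle cardinal_syntax

section \<open>The simplex category\<close>

text \<open>
  Monotone maps \<open>[m] \<rightarrow> [n]\<close> are extensional functions on \<open>{..m}\<close>, so that equality of
  morphisms with given source and target is equality of functions.  The function alone does not
  determine its source and target, hence the triples in \<open>simplex_morphisms\<close>.
\<close>

definition simplex_hom :: "nat \<Rightarrow> nat \<Rightarrow> (nat \<Rightarrow> nat) set" where
  "simplex_hom m n = {\<alpha> \<in> {..m} \<rightarrow>\<^sub>E {..n}. mono_on {..m} \<alpha>}"

definition simplex_morphisms :: "(nat \<times> nat \<times> (nat \<Rightarrow> nat)) set" where
  "simplex_morphisms = {(m, n, \<alpha>). \<alpha> \<in> simplex_hom m n}"


section \<open>Simplicial sets and their maps\<close>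

text \<open>
  \<open>act X m n \<alpha>\<close> is the action \<open>X\<^sub>n \<rightarrow> X\<^sub>m\<close> of \<open>\<alpha> : [m] \<rightarrow> [n]\<close>; its values outside
  \<open>cells X n\<close> are irrelevant.
\<close>

record 'a sset =
  cells :: "nat \<Rightarrow> 'a set"
  act :: "nat \<Rightarrow> nat \<Rightarrow> (nat \<Rightarrow> nat) \<Rightarrow> 'a \<Rightarrow> 'a"

definition simplicial_set :: "'a sset \<Rightarrow> bool" where
  "simplicial_set X \<longleftrightarrow>
     (\<forall>m n. \<forall>\<alpha> \<in> simplex_hom m n. \<forall>x \<in> cells X n. act X m n \<alpha> x \<in> cells X m) \<and>
     (\<forall>n. \<forall>x \<in> cells X n. act X n n (\<lambda>i\<in>{..n}. i) x = x) \<and>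
     (\<forall>l m n. \<forall>\<alpha> \<in> simplex_hom l m. \<forall>\<beta> \<in> simplex_hom m n. \<forall>x \<in> cells X n.
        act X l m \<alpha> (act X m n \<beta> x) = act X l n (compose {..l} \<beta> \<alpha>) x)"

definition smaps :: "'a sset \<Rightarrow> 'b sset \<Rightarrow> (nat \<Rightarrow> 'a \<Rightarrow> 'b) set" where
  "smaps X Y = {f. (\<forall>n. f n \<in> cells X n \<rightarrow>\<^sub>E cells Y n) \<and>
     (\<forall>m n. \<forall>\<alpha> \<in> simplex_hom m n. \<forall>x \<in> cells X n.
        f m (act X m n \<alpha> x) = act Y m n \<alpha> (f n x))}"

definition sid :: "'a sset \<Rightarrow> nat \<Rightarrow> 'a \<Rightarrow> 'a" where
  "sid X = (\<lambda>n. \<lambda>x\<in>cells X n. x)"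

definition smap_comp :: "'a sset \<Rightarrow> (nat \<Rightarrow> 'b \<Rightarrow> 'c) \<Rightarrow> (nat \<Rightarrow> 'a \<Rightarrow> 'b) \<Rightarrow> nat \<Rightarrow> 'a \<Rightarrow> 'c" where
  "smap_comp X g f = (\<lambda>n. compose (cells X n) (g n) (f n))"

definition siso :: "'a sset \<Rightarrow> 'b sset \<Rightarrow> (nat \<Rightarrow> 'a \<Rightarrow> 'b) \<Rightarrow> bool" where
  "siso X Y f \<longleftrightarrow> f \<in> smaps X Y \<and>
     (\<exists>g \<in> smaps Y X. smap_comp X g f = sid X \<and> smap_comp Y f g = sid Y)"

definition smono :: "'a sset \<Rightarrow> 'b sset \<Rightarrow> (nat \<Rightarrow> 'a \<Rightarrow> 'b) \<Rightarrow> bool" where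
  "smono X Y f \<longleftrightarrow> f \<in> smaps X Y \<and> (\<forall>n. inj_on (f n) (cells X n))"


section \<open>Simplices, horns, products and fibre products\<close>

definition simplex :: "nat \<Rightarrow> (nat \<Rightarrow> nat) sset" where
  "simplex k = \<lparr>cells = (\<lambda>m. simplex_hom m k), act = (\<lambda>m n \<alpha> x. compose {..m} x \<alpha>)\<rparr>"

text \<open>
  A simplex \<open>x : [m] \<rightarrow> [n]\<close> of \<open>\<Delta>\<^sup>n\<close> lies in \<open>\<Lambda>\<^sup>n\<^sub>k\<close> iff it factors through a face
  \<open>[n] - {i}\<close> with \<open>i \<noteq> k\<close>.
\<close>

definition horn :: "nat \<Rightarrow> nat \<Rightarrow> (nat \<Rightarrow> nat) sset" where
  "horn n k = \<lparr>cells = (\<lambda>m. {x \<in> simplex_hom m n. \<exists>i\<in>{..n} - {k}. i \<notin> x ` {..m}}),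
               act = act (simplex n)\<rparr>"

definition sprod :: "'a sset \<Rightarrow> 'b sset \<Rightarrow> ('a \<times> 'b) sset" where
  "sprod X Y = \<lparr>cells = (\<lambda>n. cells X n \<times> cells Y n),
                act = (\<lambda>m n \<alpha>. map_prod (act X m n \<alpha>) (act Y m n \<alpha>))\<rparr>"

definition fibre_product ::
    "'a sset \<Rightarrow> 'e sset \<Rightarrow> (nat \<Rightarrow> 'a \<Rightarrow> 'b) \<Rightarrow> (nat \<Rightarrow> 'e \<Rightarrow> 'b) \<Rightarrow> ('a \<times> 'e) sset" where
  "fibre_product A E j p =
     \<lparr>cells = (\<lambda>n. {(a, e) \<in> cells A n \<times> cells E n. j n a = p n e}),
      act = act (sprod A E)\<rparr>"

definition spair ::
    "'d sset \<Rightarrow> (nat \<Rightarrow> 'd \<Rightarrow> 'a) \<Rightarrow> (nat \<Rightarrow> 'd \<Rightarrow> 'e) \<Rightarrow> nat \<Rightarrow> 'd \<Rightarrow> 'a \<times> 'e" where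
  "spair D q r = (\<lambda>n. \<lambda>x\<in>cells D n. (q n x, r n x))"

text \<open>
  The square with top \<open>r : D \<rightarrow> E\<close>, left \<open>q : D \<rightarrow> A\<close>, right \<open>p : E \<rightarrow> B\<close> and bottom
  \<open>j : A \<rightarrow> B\<close> is a pullback: it commutes and the comparison map \<open>D \<rightarrow> A \<times>\<^sub>B E\<close> is an
  isomorphism.  The universal property, with test objects over an arbitrary type, is
  \<open>pullback_square_universal\<close> below.
\<close>

definition pullback_square ::
    "'d sset \<Rightarrow> 'e sset \<Rightarrow> 'a sset \<Rightarrow> 'b sset \<Rightarrow> (nat \<Rightarrow> 'd \<Rightarrow> 'e) \<Rightarrow> (nat \<Rightarrow> 'd \<Rightarrow> 'a) \<Rightarrow>
     (nat \<Rightarrow> 'e \<Rightarrow> 'b) \<Rightarrow> (nat \<Rightarrow> 'a \<Rightarrow> 'b) \<Rightarrow> bool" where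
  "pullback_square D E A B r q p j \<longleftrightarrow>
     r \<in> smaps D E \<and> q \<in> smaps D A \<and> p \<in> smaps E B \<and> j \<in> smaps A B \<and>
     smap_comp D p r = smap_comp D j q \<and>
     siso D (fibre_product A E j p) (spair D q r)"


section \<open>Kan fibrations\<close>

definition has_rlp ::
    "'x sset \<Rightarrow> 'y sset \<Rightarrow> (nat \<Rightarrow> 'x \<Rightarrow> 'y) \<Rightarrow> 'u sset \<Rightarrow> 'v sset \<Rightarrow> (nat \<Rightarrow> 'u \<Rightarrow> 'v) \<Rightarrow> bool" where
  "has_rlp X Y p U V i \<longleftrightarrow>
     (\<forall>u \<in> smaps U X. \<forall>v \<in> smaps V Y. smap_comp U p u = smap_comp U v i \<longrightarrow>
        (\<exists>h \<in> smaps V X. smap_comp U h i = u \<and> smap_comp V p h = v))"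

definition kan_fibration :: "'x sset \<Rightarrow> 'y sset \<Rightarrow> (nat \<Rightarrow> 'x \<Rightarrow> 'y) \<Rightarrow> bool" where
  "kan_fibration X Y p \<longleftrightarrow> simplicial_set X \<and> simplicial_set Y \<and> p \<in> smaps X Y \<and>
     (\<forall>n k. 1 \<le> n \<and> k \<le> n \<longrightarrow> has_rlp X Y p (horn n k) (simplex n) (sid (horn n k)))"

definition to_point :: "'x sset \<Rightarrow> nat \<Rightarrow> 'x \<Rightarrow> nat \<Rightarrow> nat" where
  "to_point X = (\<lambda>n. \<lambda>x\<in>cells X n. \<lambda>i\<in>{..n}. 0)"

definition kan_complex :: "'x sset \<Rightarrow> bool" where
  "kan_complex X \<longleftrightarrow> kan_fibration X (simplex 0) (to_point X)"


section \<open>Weak homotopy equivalences and trivial cofibrations\<close>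

text \<open>
  \<open>elementary_homotopy X K\<close> relates the two endpoints of a map \<open>X \<times> \<Delta>\<^sup>1 \<rightarrow> K\<close>, i.e. of a
  1-simplex of the function complex \<open>K\<^sup>X\<close>.  The equivalence relation it generates is
  \<open>homotopy_rel X K\<close>, so the quotient of \<open>smaps X K\<close> by it is \<open>\<pi>\<^sub>0(K\<^sup>X)\<close>.
\<close>

definition elementary_homotopy ::
    "'a sset \<Rightarrow> 'c sset \<Rightarrow> (nat \<Rightarrow> 'a \<Rightarrow> 'c) \<Rightarrow> (nat \<Rightarrow> 'a \<Rightarrow> 'c) \<Rightarrow> bool" where
  "elementary_homotopy X K f g \<longleftrightarrow> f \<in> smaps X K \<and> g \<in> smaps X K \<and>
     (\<exists>H \<in> smaps (sprod X (simplex 1)) K. \<forall>n. \<forall>x \<in> cells X n.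
        H n (x, \<lambda>i\<in>{..n}. 0) = f n x \<and> H n (x, \<lambda>i\<in>{..n}. 1) = g n x)"

definition homotopy_rel :: "'a sset \<Rightarrow> 'c sset \<Rightarrow> ((nat \<Rightarrow> 'a \<Rightarrow> 'c) \<times> (nat \<Rightarrow> 'a \<Rightarrow> 'c)) set" where
  "homotopy_rel X K = {(f, g). f \<in> smaps X K \<and> g \<in> smaps X K \<and>
                                equivclp (elementary_homotopy X K) f g}"

definition homotopy_classes :: "'a sset \<Rightarrow> 'c sset \<Rightarrow> (nat \<Rightarrow> 'a \<Rightarrow> 'c) set set" where
  "homotopy_classes X K = smaps X K // homotopy_rel X K"

definition precomp_class ::
    "'a sset \<Rightarrow> 'c sset \<Rightarrow> (nat \<Rightarrow> 'a \<Rightarrow> 'b) \<Rightarrow> (nat \<Rightarrow> 'b \<Rightarrow> 'c) set \<Rightarrow> (nat \<Rightarrow> 'a \<Rightarrow> 'c) set" where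
  "precomp_class X K f C = homotopy_rel X K `` ((\<lambda>h. smap_comp X h f) ` C)"

text \<open>
  A map \<open>f : X \<rightarrow> Y\<close> is a weak homotopy equivalence if \<open>\<pi>\<^sub>0(K\<^sup>Y) \<rightarrow> \<pi>\<^sub>0(K\<^sup>X)\<close> is bijective for
  every Kan complex \<open>K\<close>.  A definition in HOL cannot quantify over all types of simplices of \<open>K\<close>.
  The type \<open>'a + 'b + nat\<close> loses nothing: it is infinite and contains \<open>'a\<close> and \<open>'b\<close>, so it has
  room for Kan complexes \<open>X'\<close> and \<open>Y'\<close> with anodyne maps \<open>X \<rightarrow> X'\<close> and \<open>Y \<rightarrow> Y'\<close> (countably many
  rounds of horn filling, each horn having finitely many nondegenerate simplices).
  Bijectivity for \<open>K = X'\<close> and \<open>K = Y'\<close> makes the induced map \<open>X' \<rightarrow> Y'\<close> a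
  homotopy equivalence, which gives bijectivity for all \<open>K\<close>, of whatever size.
\<close>

definition weak_homotopy_equivalence :: "'a sset \<Rightarrow> 'b sset \<Rightarrow> (nat \<Rightarrow> 'a \<Rightarrow> 'b) \<Rightarrow> bool" where
  "weak_homotopy_equivalence X Y f \<longleftrightarrow> f \<in> smaps X Y \<and>
     (\<forall>K :: ('a + 'b + nat) sset. kan_complex K \<longrightarrow>
        bij_betw (precomp_class X K f) (homotopy_classes Y K) (homotopy_classes X K))"

definition trivial_cofibration :: "'a sset \<Rightarrow> 'b sset \<Rightarrow> (nat \<Rightarrow> 'a \<Rightarrow> 'b) \<Rightarrow> bool" where
  "trivial_cofibration X Y f \<longleftrightarrow> simplicial_set X \<and> simplicial_set Y \<and>
     smono X Y f \<and> weak_homotopy_equivalence X Y f"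


section \<open>Smallness\<close>

definition small_map :: "'k rel \<Rightarrow> 'e sset \<Rightarrow> 'b sset \<Rightarrow> (nat \<Rightarrow> 'e \<Rightarrow> 'b) \<Rightarrow> bool" where
  "small_map \<kappa> E B p \<longleftrightarrow>
     (\<forall>n. \<forall>b \<in> cells B n. |{e \<in> cells E n. p n e = b}| <o \<kappa>)"


section \<open>Basic facts\<close>

lemma simplex_hom_comp:
  assumes "\<alpha> \<in> simplex_hom l m" "\<beta> \<in> simplex_hom m n"
  shows "compose {..l} \<beta> \<alpha> \<in> simplex_hom l n"
  using assms unfolding simplex_hom_def
  by (auto simp: compose_def mono_on_def PiE_iff Pi_iff)

lemma simplex_hom_assoc:
  assumes "\<alpha> \<in> simplex_hom l m"
  shows "compose {..l} (compose {..m} x \<beta>) \<alpha> = compose {..l} x (compose {..l} \<beta> \<alpha>)"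
  using assms unfolding simplex_hom_def compose_def by (auto simp: PiE_iff)

lemma simplicial_set_simplex: "simplicial_set (simplex k)"
proof -
  have "compose {..n} x (\<lambda>i\<in>{..n}. i) = x" if "x \<in> simplex_hom n k" for n x
    using that unfolding simplex_hom_def compose_def
    by (auto simp: PiE_iff extensional_def fun_eq_iff)
  then show ?thesis
    unfolding simplicial_set_def simplex_def
    by (auto simp: simplex_hom_comp simplex_hom_assoc)
qed

lemma horn_act:
  assumes "\<alpha> \<in> simplex_hom l m" "x \<in> cells (horn n k) m"
  shows "compose {..l} x \<alpha> \<in> cells (horn n k) l"
proof -
  from assms(2) obtain i where x: "x \<in> simplex_hom m n" and i: "i \<in> {..n} - {k}" "i \<notin> x ` {..m}"
    by (auto simp: horn_def)
  have "\<alpha> ` {..l} \<subseteq> {..m}"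
    using assms(1) by (auto simp: simplex_hom_def)
  then have "i \<notin> compose {..l} x \<alpha> ` {..l}"
    using i(2) by (force simp: compose_def)
  then show ?thesis
    using i(1) simplex_hom_comp[OF assms(1) x] unfolding horn_def by simp blast
qed

lemma horn_cell: "x \<in> cells (horn n k) m \<Longrightarrow> x \<in> cells (simplex n) m"
  by (simp add: horn_def simplex_def)

lemma simplicial_set_horn: "simplicial_set (horn n k)"
proof -
  have *: "act (horn n k) = act (simplex n)" by (simp add: horn_def)
  have "act (simplex n) l m \<alpha> x \<in> cells (horn n k) l"
    if "\<alpha> \<in> simplex_hom l m" "x \<in> cells (horn n k) m" for l m \<alpha> x
    using horn_act[OF that] by (simp add: simplex_def)
  then show ?thesis
    using simplicial_set_simplex[of n] horn_cell[of _ n k]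
    unfolding simplicial_set_def * by blast
qed

lemma horn_inclusion: "sid (horn n k) \<in> smaps (horn n k) (simplex n)"
proof -
  have "act (horn n k) = act (simplex n)" by (simp add: horn_def)
  then show ?thesis
    using simplicial_set_horn[of n k] horn_cell[of _ n k]
    unfolding simplicial_set_def smaps_def sid_def by simp
qed

lemma simplicial_set_sprod:
  "simplicial_set X \<Longrightarrow> simplicial_set Y \<Longrightarrow> simplicial_set (sprod X Y)"
  unfolding simplicial_set_def sprod_def by auto

lemma simplicial_set_fibre_product:
  assumes "simplicial_set A" "simplicial_set E" "j \<in> smaps A B" "p \<in> smaps E B"
  shows "simplicial_set (fibre_product A E j p)"
  using assms unfolding simplicial_set_def fibre_product_def sprod_def smaps_def
  by auto

lemma smaps_cell: "f \<in> smaps X Y \<Longrightarrow> x \<in> cells X n \<Longrightarrow> f n x \<in> cells Y n"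
  by (auto simp: smaps_def PiE_iff)

lemma smaps_eqI:
  assumes "f \<in> smaps X Y" "g \<in> smaps X Y" "\<And>n x. x \<in> cells X n \<Longrightarrow> f n x = g n x"
  shows "f = g"
proof
  fix n show "f n = g n"
    using assms by (intro PiE_ext[of _ "cells X n" "\<lambda>_. cells Y n"]) (auto simp: smaps_def)
qed

lemma sid_in_smaps: "simplicial_set X \<Longrightarrow> sid X \<in> smaps X X"
  unfolding simplicial_set_def smaps_def sid_def by auto

lemma smap_comp_apply: "x \<in> cells X n \<Longrightarrow> smap_comp X g f n x = g n (f n x)"
  by (simp add: smap_comp_def compose_def)

lemma smap_comp_in_smaps:
  assumes "simplicial_set X" "f \<in> smaps X Y" "g \<in> smaps Y Z"
  shows "smap_comp X g f \<in> smaps X Z"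
  using assms unfolding simplicial_set_def smaps_def smap_comp_def compose_def
  by (auto simp: PiE_iff Pi_iff)

lemma equiv_homotopy_rel: "equiv (smaps X K) (homotopy_rel X K)"
proof (rule equivI)
  show "homotopy_rel X K \<subseteq> smaps X K \<times> smaps X K"
    by (auto simp: homotopy_rel_def)
  show "refl_on (smaps X K) (homotopy_rel X K)"
    by (auto simp: homotopy_rel_def refl_on_def)
  show "sym (homotopy_rel X K)"
    by (auto simp: homotopy_rel_def sym_def intro: equivclp_sym)
  show "trans (homotopy_rel X K)"
    by (auto simp: homotopy_rel_def trans_def intro: equivclp_trans)
qed

lemma pullback_square_universal:
  assumes pb: "pullback_square D E A B r q p j"
    and T: "simplicial_set T"
    and a: "a \<in> smaps T A" and e: "e \<in> smaps T E" and ae: "smap_comp T j a = smap_comp T p e"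
  shows "\<exists>!t. t \<in> smaps T D \<and> smap_comp T q t = a \<and> smap_comp T r t = e"
proof -
  let ?P = "fibre_product A E j p"
  have rq: "r \<in> smaps D E" "q \<in> smaps D A" using pb by (auto simp: pullback_square_def)
  obtain g where g: "g \<in> smaps ?P D" and gf: "smap_comp D g (spair D q r) = sid D"
    and fg: "smap_comp ?P (spair D q r) g = sid ?P"
    using pb by (auto simp: pullback_square_def siso_def)
  have ae': "j n (a n x) = p n (e n x)" if "x \<in> cells T n" for n x
    using fun_cong[OF fun_cong[OF ae, of n], of x] that by (simp add: smap_comp_apply)
  have cell: "(a n x, e n x) \<in> cells ?P n" if "x \<in> cells T n" for n x
    using that ae' smaps_cell[OF a] smaps_cell[OF e] by (simp add: fibre_product_def)
  have pair: "spair T a e \<in> smaps T ?P"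
  proof -
    have "spair T a e m (act T m n \<alpha> x) = act ?P m n \<alpha> (spair T a e n x)"
      if \<alpha>: "\<alpha> \<in> simplex_hom m n" and x: "x \<in> cells T n" for m n \<alpha> x
    proof -
      have "act T m n \<alpha> x \<in> cells T m"
        using T \<alpha> x unfolding simplicial_set_def by blast
      moreover have "a m (act T m n \<alpha> x) = act A m n \<alpha> (a n x)"
        using a \<alpha> x unfolding smaps_def by blast
      moreover have "e m (act T m n \<alpha> x) = act E m n \<alpha> (e n x)"
        using e \<alpha> x unfolding smaps_def by blast
      ultimately show ?thesis
        using x by (simp add: spair_def fibre_product_def sprod_def)
    qed
    moreover have "spair T a e n \<in> cells T n \<rightarrow>\<^sub>E cells ?P n" for n
      using cell by (simp add: spair_def)
    ultimately show ?thesis unfolding smaps_def by blast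
  qed
  let ?t = "smap_comp T g (spair T a e)"
  have t: "?t \<in> smaps T D"
    using smap_comp_in_smaps[OF T pair g] .
  have proj: "q n (?t n x) = a n x \<and> r n (?t n x) = e n x" if x: "x \<in> cells T n" for n x
  proof -
    have c: "g n (a n x, e n x) \<in> cells D n"
      using smaps_cell[OF g cell[OF x]] .
    have "spair D q r n (g n (a n x, e n x)) = (a n x, e n x)"
      using fun_cong[OF fun_cong[OF fg, of n], of "(a n x, e n x)"] cell[OF x]
      by (simp add: smap_comp_apply sid_def)
    then show ?thesis using c x by (simp add: spair_def smap_comp_apply)
  qed
  have qt: "smap_comp T q ?t = a"
    by (rule smaps_eqI[OF smap_comp_in_smaps[OF T t rq(2)] a]) (simp add: smap_comp_apply[of _ T _ q] proj)
  have rt: "smap_comp T r ?t = e"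
    by (rule smaps_eqI[OF smap_comp_in_smaps[OF T t rq(1)] e]) (simp add: smap_comp_apply[of _ T _ r] proj)
  have uniq: "s = ?t" if s: "s \<in> smaps T D" "smap_comp T q s = a" "smap_comp T r s = e" for s
  proof (rule smaps_eqI[OF s(1) t])
    fix n x assume x: "x \<in> cells T n"
    have c: "s n x \<in> cells D n" using smaps_cell[OF s(1) x] .
    have "g n (q n (s n x), r n (s n x)) = s n x"
      using fun_cong[OF fun_cong[OF gf, of n], of "s n x"] c
      by (simp add: smap_comp_apply sid_def spair_def)
    moreover have "q n (s n x) = a n x" "r n (s n x) = e n x"
      unfolding s(2,3)[symmetric] using x by (simp_all only: smap_comp_apply)
    ultimately show "s n x = ?t n x" using x by (simp add: smap_comp_apply spair_def)
  qed
  show ?thesis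
  proof (rule ex1I)
    show "?t \<in> smaps T D \<and> smap_comp T q ?t = a \<and> smap_comp T r ?t = e"
      by (intro conjI t qt rt)
  qed (elim conjE, rule uniq)
qed

text \<open>
  Levelwise injectivity is left cancellability, already against the standard simplices.
\<close>

lemma smono_cancel:
  assumes f: "smono X Y f" and uv: "u \<in> smaps T X" "v \<in> smaps T X"
    and eq: "smap_comp T f u = smap_comp T f v"
  shows "u = v"
proof (rule smaps_eqI[OF uv])
  fix n x assume x: "x \<in> cells T n"
  then have "f n (u n x) = f n (v n x)" 
    using fun_cong[OF fun_cong[OF eq, of n], of x] by (simp add: smap_comp_apply)
  then show "u n x = v n x"
    using f smaps_cell[OF uv(1) x] smaps_cell[OF uv(2) x] by (auto simp: smono_def inj_on_def)
qed

lemma smonoI_cancel: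
  assumes X: "simplicial_set X" and f: "f \<in> smaps X Y"
    and cancel: "\<And>k u v. u \<in> smaps (simplex k) X \<Longrightarrow> v \<in> smaps (simplex k) X \<Longrightarrow>
       smap_comp (simplex k) f u = smap_comp (simplex k) f v \<Longrightarrow> u = v"
  shows "smono X Y f"
proof -
  have "x = y" if xy: "x \<in> cells X k" "y \<in> cells X k" "f k x = f k y" for k x y
  proof -
    let ?c = "\<lambda>x. \<lambda>m. \<lambda>\<alpha>\<in>simplex_hom m k. act X m k \<alpha> x"
    have c: "?c x \<in> smaps (simplex k) X" if "x \<in> cells X k" for x
      using X that unfolding simplicial_set_def smaps_def
      by (auto simp: simplex_def simplex_hom_comp)
    have "smap_comp (simplex k) f (?c x) = smap_comp (simplex k) f (?c y)"
      using f xy unfolding smaps_def smap_comp_def compose_def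
      by (auto simp: fun_eq_iff simplex_def)
    then have "?c x = ?c y" using cancel c xy by blast
    then have "?c x k (\<lambda>i\<in>{..k}. i) = ?c y k (\<lambda>i\<in>{..k}. i)" by (rule fun_cong[OF fun_cong])
    moreover have "(\<lambda>i\<in>{..k}. i) \<in> simplex_hom k k"
      by (auto simp: simplex_hom_def mono_on_def)
    ultimately show ?thesis using X xy by (simp add: simplicial_set_def)
  qed
  then show ?thesis using f by (auto simp: smono_def inj_on_def)
qed

end

theory Submission
  imports Defs
begin

text \<open>
  Small Kan fibrations are classified by a strictly functorial universe \<open>U\<close> (Hofmann--Streicher).
  If \<open>U\<close> is known to fill horns, the classifying map \<open>A \<rightarrow> U\<close> of \<open>q\<close> factors through a Kan
  complex \<open>K \<subseteq> U\<close> with no more simplices than \<open>A\<close> or \<open>\<nat>\<close>; since \<open>j\<close> is a weak equivalence, the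
  map \<open>A \<rightarrow> K\<close> extends along \<open>j\<close> up to homotopy, hence strictly by homotopy extension, and the
  extension \<open>B \<rightarrow> K \<subseteq> U\<close> classifies the required fibration.

  That \<open>U\<close> fills horns means that a fibration \<open>D \<rightarrow> \<Lambda>\<^sup>n\<^sub>k\<close> extends to \<open>\<Delta>\<^sup>n\<close>.  No minimal fibrations
  are needed: there are a map \<open>g : \<Delta>\<^sup>n \<rightarrow> \<Lambda>\<^sup>n\<^sub>k\<close> and a homotopy between \<open>g\<close> and the identity on
  \<open>\<Lambda>\<^sup>n\<^sub>k\<close>, which lifts to a transport map \<open>w : D \<rightarrow> D\<close> over \<open>g\<close>.  Gluing along \<open>w\<close> gives the extension:
  a simplex over \<open>b : \<Delta>\<^sup>m \<rightarrow> \<Delta>\<^sup>n\<close> is a simplex \<open>y\<close> of \<open>D\<close> over \<open>g b\<close> together with a partial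
  section \<open>s\<close> of \<open>D\<close> over the preimage of the horn such that \<open>w s\<close> is the restriction of \<open>y\<close>.
  Horns are filled by first filling the \<open>y\<close>-part, deforming it on the preimage of the horn to
  one that comes from a section, and extending the deformation.
\<close>

section \<open>Monotone maps\<close>

text \<open>Gluing does not apply to \<open>j\<close> itself: an arbitrary trivial cofibration need
  not come with a map from B to A whose restriction to A is homotopic to the identity, whereas horn
  inclusions do. The universe carries the extension from horns to \<open>j\<close>, because
  extending a fibration becomes extending a map. Two obstacles shape it. The extension must have a
  prescribed restriction, so pullback has to be functorial up to equality, and fillers in the
  universe are relabelled to agree with the given horn exactly and not only up to isomorphism.
  Moreover, a weak equivalence is tested only on Kan complexes with simplices in
  \<open>'a + 'b + nat\<close>, which is why the classifying map is first cut down to a Kan complex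
  of that type. Gluing keeps fibres small because a partial section over a simplex is determined by
  finitely many values, so that only finite products of fibres occur.\<close>

abbreviation ident :: "nat \<Rightarrow> nat \<Rightarrow> nat" where
  "ident n \<equiv> (\<lambda>i\<in>{..n}. i)"

definition endpt :: "nat \<Rightarrow> nat \<Rightarrow> nat \<Rightarrow> nat" where
  "endpt e n = (\<lambda>i\<in>{..n}. e)"

lemma simplex_hom_iff:
  "\<alpha> \<in> simplex_hom m n \<longleftrightarrow>
     \<alpha> \<in> extensional {..m} \<and> (\<forall>i\<le>m. \<alpha> i \<le> n) \<and> (\<forall>i j. i \<le> j \<longrightarrow> j \<le> m \<longrightarrow> \<alpha> i \<le> \<alpha> j)"
  unfolding simplex_hom_def by (auto simp: PiE_iff mono_on_def)

lemma simplex_homD: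
  assumes "\<alpha> \<in> simplex_hom m n"
  shows "i \<le> m \<Longrightarrow> \<alpha> i \<le> n" and "i \<le> j \<Longrightarrow> j \<le> m \<Longrightarrow> \<alpha> i \<le> \<alpha> j"
    and "\<alpha> \<in> extensional {..m}"
  using assms by (auto simp: simplex_hom_iff)

lemma simplex_hom_restrictI:
  assumes "\<And>i. i \<le> m \<Longrightarrow> f i \<le> n" "\<And>i j. i \<le> j \<Longrightarrow> j \<le> m \<Longrightarrow> f i \<le> f j"
  shows "restrict f {..m} \<in> simplex_hom m n"
  using assms by (auto simp: simplex_hom_iff)

lemma simplex_hom_eqI:
  assumes "\<alpha> \<in> simplex_hom m n" "\<beta> \<in> simplex_hom m n'" "\<And>i. i \<le> m \<Longrightarrow> \<alpha> i = \<beta> i"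
  shows "\<alpha> = \<beta>"
  using assms by (intro extensionalityI[of _ "{..m}"]) (auto dest: simplex_homD)

lemma compose_at [simp]: "i \<le> l \<Longrightarrow> compose {..l} \<beta> \<alpha> i = \<beta> (\<alpha> i)"
  by (simp add: compose_def)

lemma ident_hom [simp]: "ident n \<in> simplex_hom n n"
  by (auto simp: simplex_hom_iff)

lemma compose_ident_left: "\<alpha> \<in> simplex_hom m n \<Longrightarrow> compose {..m} (ident n) \<alpha> = \<alpha>"
  by (rule extensionalityI[of _ "{..m}"]) (auto dest: simplex_homD simp: compose_def)

lemma compose_ident_right: "\<alpha> \<in> simplex_hom m n \<Longrightarrow> compose {..m} \<alpha> (ident m) = \<alpha>"
  by (rule extensionalityI[of _ "{..m}"]) (auto dest: simplex_homD simp: compose_def)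

lemma endpt_at [simp]: "i \<le> n \<Longrightarrow> endpt e n i = e"
  by (simp add: endpt_def)

lemma endpt_hom: "e \<le> k \<Longrightarrow> endpt e n \<in> simplex_hom n k"
  by (auto simp: endpt_def simplex_hom_iff)

lemma compose_endpt: "\<alpha> \<in> simplex_hom m n \<Longrightarrow> compose {..m} (endpt e n) \<alpha> = endpt e m"
  by (rule extensionalityI[of _ "{..m}"]) (auto dest: simplex_homD simp: compose_def endpt_def)

lemma endpt_eq_iff: "endpt e n = endpt e' n \<longleftrightarrow> e = e'"
  by (metis endpt_at le0)

text \<open>\<open>\<beta>\<close> closes the gap at the missed value s and \<open>\<delta>\<close>,
  the coface that skips s, reopens it. This puts such cells under the control of dimension
  \<open>n - 1\<close> in \<open>minimal_cell\<close>.\<close>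

lemma factor_non_surj:
  assumes a: "\<alpha> \<in> simplex_hom m n" and s: "s \<le> n" "s \<notin> \<alpha> ` {..m}"
  obtains \<delta> \<beta> where "0 < n" "\<beta> \<in> simplex_hom m (n - 1)" "\<delta> \<in> simplex_hom (n - 1) n"
    "\<alpha> = compose {..m} \<delta> \<beta>"
proof -
  have ne: "\<alpha> i \<noteq> s" if "i \<le> m" for i using s that by auto
  note D = simplex_homD[OF a]
  have n: "0 < n" using ne[of 0] D(1)[of 0] s by auto
  let ?b = "\<lambda>t\<in>{..m}. if \<alpha> t < s then \<alpha> t else \<alpha> t - 1"
  let ?d = "\<lambda>i\<in>{..n-1}. if i < s then i else i + 1"
  have b: "?b \<in> simplex_hom m (n - 1)"
  proof (rule simplex_hom_restrictI)
    fix i assume "i \<le> m" then show "(if \<alpha> i < s then \<alpha> i else \<alpha> i - 1) \<le> n - 1"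
      using D(1)[of i] s by auto
  next
    fix i j assume "i \<le> j" "j \<le> m"
    then show "(if \<alpha> i < s then \<alpha> i else \<alpha> i - 1) \<le> (if \<alpha> j < s then \<alpha> j else \<alpha> j - 1)"
      using D(2)[of i j] ne[of i] ne[of j] by auto
  qed
  have d: "?d \<in> simplex_hom (n - 1) n"
    using n by (intro simplex_hom_restrictI) auto
  have "\<alpha> = compose {..m} ?d ?b"
  proof (rule simplex_hom_eqI[OF a simplex_hom_comp[OF b d]])
    fix i assume i: "i \<le> m"
    have "?b i \<le> n - 1" using simplex_homD(1)[OF b i] .
    then show "\<alpha> i = compose {..m} ?d ?b i"
      using ne[OF i] i by auto
  qed
  then show thesis using that n b d by blast
qed

text \<open>Take for \<sigma> the degeneracy that identifies s and Suc s and for \<delta> the coface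
  that skips Suc s. Then \<sigma> followed by \<delta> moves only Suc s, to s, where \<alpha> has
  the same value.\<close>

lemma factor_non_inj:
  assumes a: "\<alpha> \<in> simplex_hom m n" and s: "s < m" "\<alpha> s = \<alpha> (Suc s)"
  obtains \<delta> \<sigma> where "\<sigma> \<in> simplex_hom m (m - 1)" "\<delta> \<in> simplex_hom (m - 1) m"
    "\<alpha> = compose {..m} (compose {..m-1} \<alpha> \<delta>) \<sigma>"
proof -
  let ?s = "\<lambda>t\<in>{..m}. if t \<le> s then t else t - 1"
  let ?d = "\<lambda>t\<in>{..m-1}. if t \<le> s then t else t + 1"
  have h: "?s \<in> simplex_hom m (m - 1)" "?d \<in> simplex_hom (m - 1) m"
    using s(1) by (intro simplex_hom_restrictI; auto)+
  have "\<alpha> = compose {..m} (compose {..m-1} \<alpha> ?d) ?s"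
  proof (rule simplex_hom_eqI[OF a simplex_hom_comp[OF h(1) simplex_hom_comp[OF h(2) a]]])
    fix i assume i: "i \<le> m"
    then consider "i \<le> s" | "i = Suc s" | "i > Suc s" by linarith
    then show "\<alpha> i = compose {..m} (compose {..m-1} \<alpha> ?d) ?s i"
      using i s by cases (auto simp: compose_def)
  qed
  then show thesis using that h by blast
qed

lemma simplex_hom_inj_or_factor:
  assumes a: "\<alpha> \<in> simplex_hom m n" and ni: "\<not> inj_on \<alpha> {..m}"
  obtains s where "s < m" "\<alpha> s = \<alpha> (Suc s)"
proof -
  obtain i j where ij: "i < j" "j \<le> m" "\<alpha> i = \<alpha> j"
    using ni by (metis atMost_iff inj_onI linorder_neqE_nat)
  have "\<alpha> i \<le> \<alpha> (Suc i)" "\<alpha> (Suc i) \<le> \<alpha> j"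
    using simplex_homD(2)[OF a, of i "Suc i"] simplex_homD(2)[OF a, of "Suc i" j] ij by auto
  then show thesis using that[of i] ij by auto
qed

lemma surj_endo_ident:
  assumes a: "\<alpha> \<in> simplex_hom n n" and s: "{..n} \<subseteq> \<alpha> ` {..n}"
  shows "\<alpha> = ident n"
proof (rule simplex_hom_eqI[OF a ident_hom])
  note D = simplex_homD[OF a]
  have "card {..n} \<le> card (\<alpha> ` {..n})" using s by (intro card_mono) auto
  then have inj: "inj_on \<alpha> {..n}"
    using card_image_le[of "{..n}" \<alpha>] by (intro eq_card_imp_inj_on) auto
  have st: "\<alpha> i < \<alpha> (Suc i)" if "Suc i \<le> n" for i
    using D(2)[of i "Suc i"] inj_onD[OF inj, of i "Suc i"] that by (force simp: order_less_le)
  have up: "i \<le> n \<Longrightarrow> i \<le> \<alpha> i" for i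
    by (induction i) (use st in \<open>force+\<close>)
  have dn: "\<alpha> (n - i) \<le> n - i" if "i \<le> n" for i
    using that
  proof (induction i)
    case (Suc i)
    then have "\<alpha> (n - Suc i) < \<alpha> (n - i)" using st[of "n - Suc i"] by (simp add: Suc_diff_Suc)
    then show ?case using Suc by auto
  qed (simp add: D)
  fix i assume i: "i \<le> n"
  then show "\<alpha> i = ident n i" using up[OF i] dn[of "n - i"] by auto
qed

text \<open>Any section of a monotone surjection is automatically monotone, so its values can be
  chosen freely. Letting it pass through a prescribed t is what allows two operators with the same
  effect on a cell to be compared at t.\<close>

lemma section_through:
  assumes a: "\<sigma> \<in> simplex_hom m n" and s: "{..n} \<subseteq> \<sigma> ` {..m}" and t: "t \<le> m"
  obtains \<delta> where "\<delta> \<in> simplex_hom n m" "compose {..n} \<sigma> \<delta> = ident n" "\<delta> (\<sigma> t) = t"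
proof -
  define d where "d = (\<lambda>i\<in>{..n}. if i = \<sigma> t then t else (SOME u. u \<le> m \<and> \<sigma> u = i))"
  have ex: "\<exists>u. u \<le> m \<and> \<sigma> u = i" if "i \<le> n" for i using s that by force
  have d: "d i \<le> m \<and> \<sigma> (d i) = i" if "i \<le> n" for i
    using someI_ex[OF ex[OF that]] that t by (auto simp: d_def)
  have h: "d \<in> simplex_hom n m"
  proof -
    have "d i \<le> d j" if "i \<le> j" "j \<le> n" for i j
      using d[of i] d[of j] simplex_homD(2)[OF a, of "d j" "d i"] that by (cases "i = j") force+
    then show ?thesis using d by (auto simp: simplex_hom_iff d_def)
  qed
  have "compose {..n} \<sigma> d = ident n"
    using d by (intro simplex_hom_eqI[OF simplex_hom_comp[OF h a] ident_hom]) auto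
  moreover have "d (\<sigma> t) = t" using simplex_homD(1)[OF a t] by (simp add: d_def)
  ultimately show thesis using that h by blast
qed

lemma finite_simplex_hom [simp]: "finite (simplex_hom m n)"
  unfolding simplex_hom_def by (rule finite_subset[of _ "{..m} \<rightarrow>\<^sub>E {..n}"]) (auto intro: finite_PiE)


section \<open>Simplicial maps on subcomplexes\<close>

lemma simplicial_setD:
  assumes "simplicial_set X"
  shows "\<alpha> \<in> simplex_hom m n \<Longrightarrow> x \<in> cells X n \<Longrightarrow> act X m n \<alpha> x \<in> cells X m"
    and "x \<in> cells X n \<Longrightarrow> act X n n (ident n) x = x"
    and "\<alpha> \<in> simplex_hom l m \<Longrightarrow> \<beta> \<in> simplex_hom m n \<Longrightarrow> x \<in> cells X n \<Longrightarrow>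
        act X l m \<alpha> (act X m n \<beta> x) = act X l n (compose {..l} \<beta> \<alpha>) x"
  using assms unfolding simplicial_set_def by blast+

definition subcomplex :: "'w sset \<Rightarrow> (nat \<Rightarrow> 'w set) \<Rightarrow> bool" where
  "subcomplex W S \<longleftrightarrow> (\<forall>n. S n \<subseteq> cells W n) \<and>
     (\<forall>m n. \<forall>\<alpha> \<in> simplex_hom m n. \<forall>w \<in> S n. act W m n \<alpha> w \<in> S m)"

text \<open>Values off S are left free, in contrast to \<open>smaps\<close>, which demands
  extensionality: partial maps can then be restricted and glued by case distinction without
  renormalising.\<close>

definition smap_on :: "'w sset \<Rightarrow> (nat \<Rightarrow> 'w set) \<Rightarrow> 'x sset \<Rightarrow> (nat \<Rightarrow> 'w \<Rightarrow> 'x) \<Rightarrow> bool" where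
  "smap_on W S X f \<longleftrightarrow> (\<forall>n. \<forall>w \<in> S n. f n w \<in> cells X n) \<and>
     (\<forall>m n. \<forall>\<alpha> \<in> simplex_hom m n. \<forall>w \<in> S n. f m (act W m n \<alpha> w) = act X m n \<alpha> (f n w))"

definition lift_on :: "'w sset \<Rightarrow> (nat \<Rightarrow> 'w set) \<Rightarrow> 'x sset \<Rightarrow> (nat \<Rightarrow> 'x \<Rightarrow> 'y) \<Rightarrow>
    (nat \<Rightarrow> 'w \<Rightarrow> 'y) \<Rightarrow> (nat \<Rightarrow> 'w \<Rightarrow> 'x) \<Rightarrow> bool" where
  "lift_on W S X q v f \<longleftrightarrow> smap_on W S X f \<and> (\<forall>n. \<forall>w \<in> S n. q n (f n w) = v n w)"

text \<open>The base map v stays fixed while f varies, so the property composes along a filtration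
  of W and can be pulled back along the characteristic map of an attached cell.\<close>

definition lift_ext :: "'w sset \<Rightarrow> (nat \<Rightarrow> 'w set) \<Rightarrow> (nat \<Rightarrow> 'w set) \<Rightarrow> 'x sset \<Rightarrow>
    (nat \<Rightarrow> 'x \<Rightarrow> 'y) \<Rightarrow> (nat \<Rightarrow> 'w \<Rightarrow> 'y) \<Rightarrow> bool" where
  "lift_ext W S S' X q v \<longleftrightarrow> (\<forall>f. lift_on W S X q v f \<longrightarrow>
     (\<exists>f'. lift_on W S' X q v f' \<and> (\<forall>n. \<forall>w \<in> S n. f' n w = f n w)))"

lemma subcomplexD:
  assumes "subcomplex W S"
  shows "w \<in> S n \<Longrightarrow> w \<in> cells W n"
    and "\<alpha> \<in> simplex_hom m n \<Longrightarrow> w \<in> S n \<Longrightarrow> act W m n \<alpha> w \<in> S m"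
  using assms unfolding subcomplex_def by blast+

lemma subcomplexI:
  assumes "\<And>n w. w \<in> S n \<Longrightarrow> w \<in> cells W n"
    and "\<And>m n \<alpha> w. \<alpha> \<in> simplex_hom m n \<Longrightarrow> w \<in> S n \<Longrightarrow> act W m n \<alpha> w \<in> S m"
  shows "subcomplex W S"
  using assms unfolding subcomplex_def by blast

lemma smap_onD:
  assumes "smap_on W S X f"
  shows "w \<in> S n \<Longrightarrow> f n w \<in> cells X n"
    and "\<alpha> \<in> simplex_hom m n \<Longrightarrow> w \<in> S n \<Longrightarrow> f m (act W m n \<alpha> w) = act X m n \<alpha> (f n w)"
  using assms unfolding smap_on_def by blast+

lemma smap_onI:
  assumes "\<And>n w. w \<in> S n \<Longrightarrow> f n w \<in> cells X n"
    and "\<And>m n \<alpha> w. \<alpha> \<in> simplex_hom m n \<Longrightarrow> w \<in> S n \<Longrightarrow> f m (act W m n \<alpha> w) = act X m n \<alpha> (f n w)"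
  shows "smap_on W S X f"
  using assms unfolding smap_on_def by blast

lemma smap_on_smaps: "f \<in> smaps X Y \<Longrightarrow> smap_on X (cells X) Y f"
  unfolding smaps_def smap_on_def by (auto simp: PiE_iff)

lemma smaps_actD:
  "f \<in> smaps X Y \<Longrightarrow> \<alpha> \<in> simplex_hom m n \<Longrightarrow> x \<in> cells X n \<Longrightarrow>
     f m (act X m n \<alpha> x) = act Y m n \<alpha> (f n x)"
  unfolding smaps_def by blast

lemma lift_onD:
  assumes "lift_on W S X q v f"
  shows "w \<in> S n \<Longrightarrow> f n w \<in> cells X n"
    and "\<alpha> \<in> simplex_hom m n \<Longrightarrow> w \<in> S n \<Longrightarrow> f m (act W m n \<alpha> w) = act X m n \<alpha> (f n w)"
    and "w \<in> S n \<Longrightarrow> q n (f n w) = v n w"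
  using assms unfolding lift_on_def smap_on_def by blast+

lemma lift_onI:
  assumes "\<And>n w. w \<in> S n \<Longrightarrow> f n w \<in> cells X n"
    and "\<And>m n \<alpha> w. \<alpha> \<in> simplex_hom m n \<Longrightarrow> w \<in> S n \<Longrightarrow> f m (act W m n \<alpha> w) = act X m n \<alpha> (f n w)"
    and "\<And>n w. w \<in> S n \<Longrightarrow> q n (f n w) = v n w"
  shows "lift_on W S X q v f"
  using assms unfolding lift_on_def smap_on_def by blast

lemma lift_extD:
  assumes "lift_ext W S S' X q v" "lift_on W S X q v f"
  obtains f' where "lift_on W S' X q v f'" "\<And>n w. w \<in> S n \<Longrightarrow> f' n w = f n w"
  using assms unfolding lift_ext_def by blast

lemma lift_ext_trans:
  assumes "lift_ext W S S' X q v" "lift_ext W S' S'' X q v" "\<And>n. S n \<subseteq> S' n"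
  shows "lift_ext W S S'' X q v"
  unfolding lift_ext_def
proof (intro allI impI)
  fix f assume "lift_on W S X q v f"
  from lift_extD[OF assms(1) this] obtain f'
    where f': "lift_on W S' X q v f'" "\<And>n w. w \<in> S n \<Longrightarrow> f' n w = f n w" by blast
  from lift_extD[OF assms(2) f'(1)] obtain f''
    where "lift_on W S'' X q v f''" "\<And>n w. w \<in> S' n \<Longrightarrow> f'' n w = f' n w" by blast
  then show "\<exists>f'. lift_on W S'' X q v f' \<and> (\<forall>n. \<forall>w\<in>S n. f' n w = f n w)"
    using f' assms(3) by (metis subsetD)
qed

text \<open>Injectivity off S makes the union of S and the image of \<phi> a pushout of S and Q
  along the preimage of S, and extension of lifts passes to pushouts. Inside S the map \<phi> may
  identify cells, since there the values come from f.\<close>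

lemma lift_ext_attach:
  assumes Q: "simplicial_set Q" and phi: "smap_on Q (cells Q) W \<phi>" and S: "subcomplex W S"
    and inj: "\<And>n x y. x \<in> cells Q n \<Longrightarrow> y \<in> cells Q n \<Longrightarrow> \<phi> n x \<notin> S n \<Longrightarrow> \<phi> n x = \<phi> n y \<Longrightarrow> x = y"
    and ext: "lift_ext Q (\<lambda>n. {x \<in> cells Q n. \<phi> n x \<in> S n}) (cells Q) X q (\<lambda>n x. v n (\<phi> n x))"
  shows "lift_ext W S (\<lambda>n. S n \<union> \<phi> n ` cells Q n) X q v"
  unfolding lift_ext_def
proof (intro allI impI)
  fix f assume f: "lift_on W S X q v f"
  note fD = lift_onD[OF f]
  have "lift_on Q (\<lambda>n. {x \<in> cells Q n. \<phi> n x \<in> S n}) X q (\<lambda>n x. v n (\<phi> n x)) (\<lambda>n x. f n (\<phi> n x))"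
    by (rule lift_onI) (auto simp: fD smap_onD[OF phi])
  from lift_extD[OF ext this] obtain F where F: "lift_on Q (cells Q) X q (\<lambda>n x. v n (\<phi> n x)) F"
    and FS: "\<And>n x. x \<in> {x \<in> cells Q n. \<phi> n x \<in> S n} \<Longrightarrow> F n x = f n (\<phi> n x)"
    by blast
  define f' where "f' n w = (if w \<in> S n then f n w else F n (SOME x. x \<in> cells Q n \<and> \<phi> n x = w))" for n w
  have f'S: "f' n w = f n w" if "w \<in> S n" for n w using that by (simp add: f'_def)
  have f'Q: "f' n (\<phi> n x) = F n x" if x: "x \<in> cells Q n" for n x
  proof (cases "\<phi> n x \<in> S n")
    case True then show ?thesis using x FS by (simp add: f'_def)
  next
    case False
    have "(SOME y. y \<in> cells Q n \<and> \<phi> n y = \<phi> n x) = x"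
      using inj x False by (intro some_equality) metis+
    then show ?thesis using False by (simp add: f'_def)
  qed
  note FD = lift_onD[OF F]
  have "lift_on W (\<lambda>n. S n \<union> \<phi> n ` cells Q n) X q v f'"
  proof (rule lift_onI)
    fix m n \<alpha> w assume a: "\<alpha> \<in> simplex_hom m n" and w: "w \<in> S n \<union> \<phi> n ` cells Q n"
    then show "f' m (act W m n \<alpha> w) = act X m n \<alpha> (f' n w)"
    proof (elim UnE imageE)
      assume "w \<in> S n" then show ?thesis using a f'S fD subcomplexD[OF S] by simp
    next
      fix x assume x: "w = \<phi> n x" "x \<in> cells Q n"
      then have "act W m n \<alpha> w = \<phi> m (act Q m n \<alpha> x)" using smap_onD[OF phi] a by simp
      then show ?thesis using x a f'Q FD simplicial_setD(1)[OF Q] by simp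
    qed
  qed (auto simp: f'S f'Q fD FD)
  then show "\<exists>f'. lift_on W (\<lambda>n. S n \<union> \<phi> n ` cells Q n) X q v f' \<and> (\<forall>n. \<forall>w\<in>S n. f' n w = f n w)"
    using f'S by blast
qed

lemma cells_simplex [simp]: "cells (simplex n) m = simplex_hom m n"
  and act_simplex [simp]: "act (simplex n) l m \<alpha> x = compose {..l} x \<alpha>"
  by (simp_all add: simplex_def)

lemma act_horn [simp]: "act (horn n k) l m \<alpha> x = compose {..l} x \<alpha>"
  by (simp add: horn_def)

lemma cells_sprod [simp]: "cells (sprod X Y) n = cells X n \<times> cells Y n"
  and act_sprod [simp]: "act (sprod X Y) m n \<alpha> (x, y) = (act X m n \<alpha> x, act Y m n \<alpha> y)"
  by (simp_all add: sprod_def)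

lemma subcomplex_horn: "subcomplex (simplex n) (cells (horn n k))"
  by (rule subcomplexI) (auto dest: horn_cell intro: horn_act)

lemma kan_lift_ext:
  assumes K: "kan_fibration X Y q" and nk: "1 \<le> n" "k \<le> n"
    and v: "smap_on (simplex n) (cells (simplex n)) Y v"
  shows "lift_ext (simplex n) (cells (horn n k)) (cells (simplex n)) X q v"
  unfolding lift_ext_def
proof (intro allI impI)
  fix f assume f: "lift_on (simplex n) (cells (horn n k)) X q v f"
  let ?H = "horn n k" and ?D = "simplex n"
  let ?u = "\<lambda>m. restrict (f m) (cells ?H m)" and ?v = "\<lambda>m. restrict (v m) (cells ?D m)"
  note fD = lift_onD[OF f] and vD = smap_onD[OF v]
  have u: "?u \<in> smaps ?H X"
    using fD(1,2) horn_act unfolding smaps_def by auto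
  have v': "?v \<in> smaps ?D Y"
    using vD unfolding smaps_def by (auto simp: simplex_hom_comp)
  have "smap_comp ?H q ?u = smap_comp ?H ?v (sid ?H)"
    using fD(3) horn_cell[of _ n k] by (auto simp: smap_comp_def compose_def sid_def fun_eq_iff)
  with K nk u v' obtain h where h: "h \<in> smaps ?D X" "smap_comp ?H h (sid ?H) = ?u" "smap_comp ?D q h = ?v"
    unfolding kan_fibration_def has_rlp_def by blast
  have 1: "h m w = f m w" if "w \<in> cells ?H m" for m w
    using fun_cong[OF fun_cong[OF h(2), of m], of w] that by (simp add: smap_comp_apply sid_def)
  have 2: "q m (h m w) = v m w" if "w \<in> cells ?D m" for m w
    using fun_cong[OF fun_cong[OF h(3), of m], of w] that by (simp add: smap_comp_apply)
  have "lift_on ?D (cells ?D) X q v h"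
    using smap_on_smaps[OF h(1)] 2 unfolding lift_on_def by blast
  then show "\<exists>f'. lift_on ?D (cells ?D) X q v f' \<and> (\<forall>m. \<forall>w\<in>cells ?H m. f' m w = f m w)"
    using 1 by blast
qed

section \<open>Prisms and the homotopy extension property\<close>

abbreviation cyl :: "'a sset \<Rightarrow> ('a \<times> (nat \<Rightarrow> nat)) sset" where
  "cyl B \<equiv> sprod B (simplex 1)"

lemma simplicial_set_cyl: "simplicial_set B \<Longrightarrow> simplicial_set (cyl B)"
  by (intro simplicial_set_sprod simplicial_set_simplex)

text \<open>The shuffle that changes level in column i: vertices t \<le> i go to (t, 0) and later
  ones to (t - 1, 1), so the column over i is the only one visited twice.\<close>

definition prism_map :: "nat \<Rightarrow> nat \<Rightarrow> (nat \<Rightarrow> nat) \<Rightarrow> (nat \<Rightarrow> nat) \<times> (nat \<Rightarrow> nat)" where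
  "prism_map i l \<beta> = (\<lambda>t\<in>{..l}. if \<beta> t \<le> i then \<beta> t else \<beta> t - 1, \<lambda>t\<in>{..l}. if \<beta> t \<le> i then 0 else 1)"

lemma prism_map_cell:
  assumes b: "\<beta> \<in> simplex_hom l (Suc n)" and i: "i \<le> n"
  shows "prism_map i l \<beta> \<in> cells (cyl (simplex n)) l"
proof -
  note D = simplex_homD[OF b]
  have "(\<lambda>t\<in>{..l}. if \<beta> t \<le> i then \<beta> t else \<beta> t - 1) \<in> simplex_hom l n"
  proof (rule simplex_hom_restrictI)
    fix t assume "t \<le> l" then show "(if \<beta> t \<le> i then \<beta> t else \<beta> t - 1) \<le> n"
      using D(1)[of t] i by auto
  next
    fix s t assume "s \<le> t" "t \<le> l"
    then show "(if \<beta> s \<le> i then \<beta> s else \<beta> s - 1) \<le> (if \<beta> t \<le> i then \<beta> t else \<beta> t - 1)"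
      using D(2)[of s t] by auto
  qed
  moreover have "(\<lambda>t\<in>{..l}. if \<beta> t \<le> i then 0 else 1) \<in> simplex_hom l 1"
  proof (rule simplex_hom_restrictI)
    fix s t assume "s \<le> t" "t \<le> l"
    then show "(if \<beta> s \<le> i then 0 else 1) \<le> (if \<beta> t \<le> i then 0 else (1::nat))"
      using D(2)[of s t] by auto
  qed auto
  ultimately show ?thesis by (simp add: prism_map_def)
qed

lemma smap_on_prism_map:
  assumes "i \<le> n"
  shows "smap_on (simplex (Suc n)) (cells (simplex (Suc n))) (cyl (simplex n)) (prism_map i)"
proof (rule smap_onI)
  show "prism_map i l \<beta> \<in> cells (cyl (simplex n)) l" if "\<beta> \<in> cells (simplex (Suc n)) l" for l \<beta>
    using prism_map_cell that assms by simp
  fix l m \<alpha> \<beta> assume a: "\<alpha> \<in> simplex_hom l m" "\<beta> \<in> cells (simplex (Suc n)) m"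
  then show "prism_map i l (act (simplex (Suc n)) l m \<alpha> \<beta>) = act (cyl (simplex n)) l m \<alpha> (prism_map i m \<beta>)"
    by (auto simp: prism_map_def compose_def fun_eq_iff dest: simplex_homD)
qed

lemma prism_map_inj:
  assumes b: "\<beta> \<in> simplex_hom l N" "\<gamma> \<in> simplex_hom l N" and eq: "prism_map i l \<beta> = prism_map i l \<gamma>"
  shows "\<beta> = \<gamma>"
proof (rule simplex_hom_eqI[OF b])
  fix t assume t: "t \<le> l"
  have "fst (prism_map i l \<beta>) t = fst (prism_map i l \<gamma>) t" "snd (prism_map i l \<beta>) t = snd (prism_map i l \<gamma>) t"
    using eq by simp_all
  then show "\<beta> t = \<gamma> t" using t
    by (cases "\<beta> t \<le> i"; cases "\<gamma> t \<le> i") (simp_all add: prism_map_def)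
qed

lemma prism_map_surj:
  assumes a: "\<alpha> \<in> simplex_hom l n" and \<tau>: "\<tau> \<in> simplex_hom l 1"
    and lo: "\<And>t. t \<le> l \<Longrightarrow> \<tau> t = 0 \<Longrightarrow> \<alpha> t \<le> i" and hi: "\<And>t. t \<le> l \<Longrightarrow> \<tau> t = 1 \<Longrightarrow> i \<le> \<alpha> t"
  shows "(\<alpha>, \<tau>) \<in> prism_map i l ` simplex_hom l (Suc n)"
proof (rule image_eqI)
  \<comment> \<open>On a shuffle the two coordinates of a vertex add up to its index, so the sum is
    the only candidate for a preimage; \<open>lo\<close> and \<open>hi\<close> say that the level
    changes in column i.\<close>
  let ?b = "\<lambda>t\<in>{..l}. \<alpha> t + \<tau> t"
  note D = simplex_homD[OF a] simplex_homD[OF \<tau>]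
  show "?b \<in> simplex_hom l (Suc n)"
    using D(1,4) D(2,5) by (intro simplex_hom_restrictI) (fastforce intro: add_mono)+
  have T: "\<tau> t = 0 \<or> \<tau> t = 1" if "t \<le> l" for t using D(4)[OF that] by linarith
  show "(\<alpha>, \<tau>) = prism_map i l ?b"
    unfolding prism_map_def prod.inject
  proof (intro conjI extensionalityI[OF D(3)] extensionalityI[OF D(6)] restrict_extensional)
    fix t assume "t \<in> {..l}"
    then have t: "t \<le> l" by simp
    show "\<alpha> t = (\<lambda>t\<in>{..l}. if ?b t \<le> i then ?b t else ?b t - 1) t"
      using T[OF t] lo[OF t] hi[OF t] t by auto
    show "\<tau> t = (\<lambda>t\<in>{..l}. if ?b t \<le> i then 0 else 1) t"
      using T[OF t] lo[OF t] hi[OF t] t by auto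
  qed
qed

text \<open>For monotone \<alpha> this says that \<alpha> is a cell of the boundary
  \<open>\<partial>\<Delta>\<^sup>n\<close>.\<close>

definition nonsurj :: "nat \<Rightarrow> nat \<Rightarrow> (nat \<Rightarrow> nat) \<Rightarrow> bool" where
  "nonsurj n m \<alpha> \<longleftrightarrow> \<not> {..n} \<subseteq> \<alpha> ` {..m}"

lemma nonsurjI: "s \<le> n \<Longrightarrow> s \<notin> \<alpha> ` {..m} \<Longrightarrow> nonsurj n m \<alpha>"
  unfolding nonsurj_def by blast

lemma nonsurjE:
  assumes "nonsurj n m \<alpha>" obtains s where "s \<le> n" "s \<notin> \<alpha> ` {..m}"
  using assms unfolding nonsurj_def by blast

lemma nonsurj_comp: "\<alpha> \<in> simplex_hom l m \<Longrightarrow> nonsurj n m \<beta> \<Longrightarrow> nonsurj n l (compose {..l} \<beta> \<alpha>)"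
proof -
  assume a: "\<alpha> \<in> simplex_hom l m" and b: "nonsurj n m \<beta>"
  obtain s where s: "s \<le> n" "s \<notin> \<beta> ` {..m}" using b by (rule nonsurjE)
  have "s \<notin> compose {..l} \<beta> \<alpha> ` {..l}"
    using s(2) simplex_homD(1)[OF a] by (auto simp: image_iff)
  then show ?thesis using s(1) by (rule nonsurjI[rotated])
qed

text \<open>The first coordinate of the shuffle identifies the vertices i and Suc i and is otherwise
  injective. A value is missed exactly when \<beta> misses its whole preimage, which is a single
  vertex except for the pair i, Suc i. Hence all faces of the shuffle but those opposite i and Suc i
  lie over the boundary.\<close>

lemma nonsurj_prism:
  assumes b: "\<beta> \<in> simplex_hom l (Suc n)" and i: "i \<le> n"
  shows "nonsurj n l (fst (prism_map i l \<beta>)) \<longleftrightarrow> (\<exists>s\<in>{..Suc n} - {i, Suc i}. s \<notin> \<beta> ` {..l}) \<or> (i \<notin> \<beta> ` {..l} \<and> Suc i \<notin> \<beta> ` {..l})"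
proof -
  let ?a = "fst (prism_map i l \<beta>)"
  have at: "?a t = (if \<beta> t \<le> i then \<beta> t else \<beta> t - 1)" if "t \<le> l" for t using that by (simp add: prism_map_def)
  have *: "s \<in> ?a ` {..l} \<longleftrightarrow> (s \<le> i \<and> s \<in> \<beta> ` {..l}) \<or> (i \<le> s \<and> Suc s \<in> \<beta> ` {..l})" for s
  proof
    assume "s \<in> ?a ` {..l}"
    then obtain t where t: "t \<le> l" "s = ?a t" by auto
    show "(s \<le> i \<and> s \<in> \<beta> ` {..l}) \<or> (i \<le> s \<and> Suc s \<in> \<beta> ` {..l})"
    proof (cases "\<beta> t \<le> i")
      case True then show ?thesis using t at[OF t(1)] by auto
    next
      case False
      then have "\<beta> t = Suc s" "i \<le> s" using t at[OF t(1)] by auto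
      then show ?thesis using t by (metis atMost_iff imageI)
    qed
  next
    assume "(s \<le> i \<and> s \<in> \<beta> ` {..l}) \<or> (i \<le> s \<and> Suc s \<in> \<beta> ` {..l})"
    then show "s \<in> ?a ` {..l}"
    proof (elim disjE conjE imageE)
      fix t assume "s \<le> i" "s = \<beta> t" "t \<in> {..l}"
      then show ?thesis using at[of t] by (intro image_eqI[of _ _ t]) auto
    next
      fix t assume "i \<le> s" "Suc s = \<beta> t" "t \<in> {..l}"
      then show ?thesis using at[of t] by (intro image_eqI[of _ _ t]) auto
    qed
  qed
  show ?thesis (is "_ \<longleftrightarrow> ?R")
  proof
    assume "nonsurj n l ?a"
    then obtain s where s: "s \<le> n" "s \<notin> ?a ` {..l}" by (rule nonsurjE)
    consider "s < i" | "s = i" | "s > i" by linarith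
    then show ?R
    proof cases
      case 1 then show ?thesis using s unfolding * by (intro disjI1 bexI[of _ s]) auto
    next
      case 2 then show ?thesis using s unfolding * by blast
    next
      case 3 then show ?thesis using s unfolding * by (intro disjI1 bexI[of _ "Suc s"]) auto
    qed
  next
    assume ?R
    then show "nonsurj n l ?a"
    proof
      assume "i \<notin> \<beta> ` {..l} \<and> Suc i \<notin> \<beta> ` {..l}"
      then show ?thesis by (intro nonsurjI[OF i]) (simp add: *)
    next
      assume "\<exists>s\<in>{..Suc n} - {i, Suc i}. s \<notin> \<beta> ` {..l}"
      then obtain s where s: "s \<le> Suc n" "s \<noteq> i" "s \<noteq> Suc i" "s \<notin> \<beta> ` {..l}" by auto
      show ?thesis
      proof (cases "s < i")
        case True then show ?thesis using i s by (intro nonsurjI[of s]) (auto simp: *)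
      next
        case False
        then have "Suc (s - 1) = s" "\<not> s - 1 \<le> i" "s - 1 \<le> n" using s by auto
        then show ?thesis using s(4) by (intro nonsurjI[of "s - 1"]) (simp_all add: * del: One_nat_def)
      qed
    qed
  qed
qed

text \<open>
  For \<open>e = 0\<close> the filtration runs from \<open>prism_filt 0 n (Suc n)\<close>, which is
  \<open>\<Delta>\<^sup>n \<times> {0} \<union> \<partial>\<Delta>\<^sup>n \<times> \<Delta>\<^sup>1\<close>, down to \<open>prism_filt 0 n 0\<close>, the whole prism; for \<open>e = 1\<close> it runs from
  index \<open>0\<close> up to \<open>Suc n\<close>.  Passing between \<open>i\<close> and \<open>Suc i\<close> attaches the shuffle
  \<open>(0,0), \<dots>, (i,0), (i,1), \<dots>, (n,1)\<close>, whose intersection with the smaller stage is a horn.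
\<close>

definition prism_filt :: "nat \<Rightarrow> nat \<Rightarrow> nat \<Rightarrow> nat \<Rightarrow> ((nat \<Rightarrow> nat) \<times> (nat \<Rightarrow> nat)) set" where
  "prism_filt e n i m = {(\<alpha>, \<tau>). \<alpha> \<in> simplex_hom m n \<and> \<tau> \<in> simplex_hom m 1 \<and>
     (nonsurj n m \<alpha> \<or> (\<forall>t\<le>m. \<tau> t \<noteq> e \<longrightarrow> (if e = 0 then i \<le> \<alpha> t else \<alpha> t < i)))}"

lemma prism_filt_iff:
  "w \<in> prism_filt e n i m \<longleftrightarrow> w \<in> cells (cyl (simplex n)) m \<and> (nonsurj n m (fst w) \<or>
     (\<forall>t\<le>m. snd w t \<noteq> e \<longrightarrow> (if e = 0 then i \<le> fst w t else fst w t < i)))"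
  by (cases w) (simp add: prism_filt_def conj_assoc)

lemma subcomplex_prism_filt: "subcomplex (cyl (simplex n)) (prism_filt e n i)"
proof (rule subcomplexI)
  fix m l \<alpha> w assume a: "\<alpha> \<in> simplex_hom m l" and w: "w \<in> prism_filt e n i l"
  then obtain x \<tau> where x: "w = (x, \<tau>)" by (cases w)
  show "act (cyl (simplex n)) m l \<alpha> w \<in> prism_filt e n i m"
    using a w nonsurj_comp[OF a, of n x] simplex_homD(1)[OF a]
    by (auto simp: x prism_filt_def simplex_hom_comp)
qed (auto simp: prism_filt_def)

text \<open>Of the two faces of the shuffle that are not over the boundary, the one opposite the
  vertex (i, 1 - e) already lies in the smaller stage and the one opposite (i, e) does not. The
  intersection is therefore the horn at k, the index of the vertex (i, e).\<close>

lemma prism_filt_step: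
  assumes K: "kan_fibration X Y q" and e: "e \<le> 1" and i: "i \<le> n"
    and v: "smap_on (cyl (simplex n)) (cells (cyl (simplex n))) Y v"
  defines "i1 \<equiv> (if e = 0 then Suc i else i)" and "i2 \<equiv> (if e = 0 then i else Suc i)"
  shows "lift_ext (cyl (simplex n)) (prism_filt e n i1) (prism_filt e n i2) X q v"
proof -
  let ?S = "prism_filt e n i1" and ?Q = "simplex (Suc n)"
  define k where "k = (if e = 0 then i else Suc i)"
  define i2' where "i2' = (if e = 0 then Suc i else i)"
  have k: "k \<le> Suc n" using i by (simp add: k_def)
  have mem: "prism_map i l \<beta> \<in> ?S l \<longleftrightarrow> \<beta> \<in> cells (horn (Suc n) k) l" if b: "\<beta> \<in> simplex_hom l (Suc n)" for l \<beta>
  proof -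
    have at: "snd (prism_map i l \<beta>) t = (if \<beta> t \<le> i then 0 else 1)"
      "fst (prism_map i l \<beta>) t = (if \<beta> t \<le> i then \<beta> t else \<beta> t - 1)" if "t \<le> l" for t
      using that by (simp_all add: prism_map_def)
    have "(snd (prism_map i l \<beta>) t \<noteq> e \<longrightarrow>
        (if e = 0 then i1 \<le> fst (prism_map i l \<beta>) t else fst (prism_map i l \<beta>) t < i1)) \<longleftrightarrow> \<beta> t \<noteq> i2'"
      if "t \<le> l" for t
      using e unfolding at[OF that] i1_def i2'_def by auto
    then have "(\<forall>t\<le>l. snd (prism_map i l \<beta>) t \<noteq> e \<longrightarrow>
        (if e = 0 then i1 \<le> fst (prism_map i l \<beta>) t else fst (prism_map i l \<beta>) t < i1)) \<longleftrightarrow> i2' \<notin> \<beta> ` {..l}"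
      by auto
    then have "prism_map i l \<beta> \<in> ?S l \<longleftrightarrow> nonsurj n l (fst (prism_map i l \<beta>)) \<or> i2' \<notin> \<beta> ` {..l}"
      using prism_map_cell[OF b i] unfolding prism_filt_iff by simp
    then show ?thesis unfolding nonsurj_prism[OF b i] using b i
      by (auto simp: horn_def k_def i2'_def)
  qed
  have un: "?S l \<union> prism_map i l ` cells ?Q l = prism_filt e n i2 l" for l
  proof (intro set_eqI iffI)
    fix w assume "w \<in> ?S l \<union> prism_map i l ` cells ?Q l"
    then show "w \<in> prism_filt e n i2 l"
    proof
      assume "w \<in> ?S l" then show ?thesis by (force simp: prism_filt_def i1_def i2_def split: if_splits)
    next
      assume "w \<in> prism_map i l ` cells ?Q l"
      then obtain \<beta> where b: "\<beta> \<in> simplex_hom l (Suc n)" "w = prism_map i l \<beta>" by auto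
      then show ?thesis using prism_map_cell[OF b(1) i] e
        by (auto simp: prism_filt_def i2_def prism_map_def)
    qed
  next
    fix w assume w: "w \<in> prism_filt e n i2 l"
    obtain \<alpha> \<tau> where at: "w = (\<alpha>, \<tau>)" by (cases w)
    show "w \<in> ?S l \<union> prism_map i l ` cells ?Q l"
    proof (cases "w \<in> ?S l")
      case False
      have h: "\<alpha> \<in> simplex_hom l n" "\<tau> \<in> simplex_hom l 1" using w by (auto simp: at prism_filt_def)
      have T: "\<tau> t = 0 \<or> \<tau> t = 1" if "t \<le> l" for t using simplex_homD(1)[OF h(2) that] by linarith
      obtain s where s: "s \<le> l" "\<tau> s \<noteq> e" "\<not> (if e = 0 then i1 \<le> \<alpha> s else \<alpha> s < i1)"
        and ns: "\<not> nonsurj n l \<alpha>"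
        using False w by (auto simp: at prism_filt_def split: if_splits)
      have all: "\<tau> t \<noteq> e \<Longrightarrow> (if e = 0 then i2 \<le> \<alpha> t else \<alpha> t < i2)" if "t \<le> l" for t
        using w ns that by (auto simp: at prism_filt_def split: if_splits)
      \<comment> \<open>A simplex that is new at this stage has a vertex s over i at level 1 - e.
        Monotonicity then places its vertices at level e on the shuffle, and the bound
        \<open>all\<close> those at level 1 - e.\<close>
      have as: "\<alpha> s = i" using s all[OF s(1)] by (auto simp: i1_def i2_def split: if_splits)
      have "(\<alpha>, \<tau>) \<in> prism_map i l ` simplex_hom l (Suc n)"
      proof (rule prism_map_surj[OF h])
        fix t assume t: "t \<le> l" "\<tau> t = 0"
        show "\<alpha> t \<le> i"
        proof (cases "e = 0")
          case True
          then have "\<tau> s = 1" using T[OF s(1)] s(2) by auto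
          then have "t \<le> s" using simplex_homD(2)[OF h(2), of s t] t by linarith
          then show ?thesis using simplex_homD(2)[OF h(1)] s(1) as by metis
        next
          case False
          then show ?thesis using all[OF t(1)] t e by (auto simp: i2_def)
        qed
      next
        fix t assume t: "t \<le> l" "\<tau> t = 1"
        show "i \<le> \<alpha> t"
        proof (cases "e = 0")
          case True
          then show ?thesis using all[OF t(1)] t by (auto simp: i2_def)
        next
          case False
          then have "\<tau> s = 0" using T[OF s(1)] s(2) e by auto
          then have "s \<le> t" using simplex_homD(2)[OF h(2), of t s] t s(1) by linarith
          then show ?thesis using simplex_homD(2)[OF h(1)] t(1) as by metis
        qed
      qed
      then show ?thesis by (simp add: at)
    qed simp
  qed
  have "lift_ext (cyl (simplex n)) ?S (\<lambda>l. ?S l \<union> prism_map i l ` cells ?Q l) X q v"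
  proof (rule lift_ext_attach[OF simplicial_set_simplex smap_on_prism_map[OF i] subcomplex_prism_filt])
    have eq: "(\<lambda>l. {x \<in> cells ?Q l. prism_map i l x \<in> ?S l}) = cells (horn (Suc n) k)"
      using mem horn_cell[of _ "Suc n" k] by (intro ext set_eqI) auto
    have "smap_on ?Q (cells ?Q) Y (\<lambda>l x. v l (prism_map i l x))"
      using smap_onD[OF smap_on_prism_map[OF i]] smap_onD[OF v] by (intro smap_onI) simp_all
    from kan_lift_ext[OF K _ k this]
    show "lift_ext ?Q (\<lambda>l. {x \<in> cells ?Q l. prism_map i l x \<in> ?S l}) (cells ?Q) X q (\<lambda>l x. v l (prism_map i l x))"
      unfolding eq by simp
  qed (use prism_map_inj in auto)
  then show ?thesis unfolding un .
qed

lemma prism_lift_ext: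
  assumes K: "kan_fibration X Y q" and e: "e \<le> 1"
    and v: "smap_on (cyl (simplex n)) (cells (cyl (simplex n))) Y v"
  shows "lift_ext (cyl (simplex n))
     (\<lambda>m. {(\<alpha>, \<tau>) \<in> cells (cyl (simplex n)) m. nonsurj n m \<alpha> \<or> \<tau> = endpt e m})
     (cells (cyl (simplex n))) X q v"
proof -
  let ?F = "prism_filt e n" and ?C = "cyl (simplex n)"
  have endpt: "(\<forall>t\<le>m. \<tau> t = e) \<longleftrightarrow> \<tau> = endpt e m" if "\<tau> \<in> simplex_hom m 1" for \<tau> m
    using simplex_hom_eqI[OF that endpt_hom[OF e]] by auto
  note step = prism_filt_step[OF K e _ v]
  show ?thesis
  proof (cases "e = 0")
    case True
    have "lift_ext ?C (?F (Suc n)) (?F (Suc n - j)) X q v" if "j \<le> Suc n" for j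
      using that
    proof (induction j)
      case 0 show ?case by (auto simp: lift_ext_def)
    next
      case (Suc j)
      have "lift_ext ?C (?F (Suc n - j)) (?F (Suc n - Suc j)) X q v"
        using step[of "n - j"] True Suc.prems by (simp add: Suc_diff_le)
      moreover have "?F (Suc n) m \<subseteq> ?F (Suc n - j) m" for m
        using True by (force simp: prism_filt_def)
      ultimately show ?case using Suc lift_ext_trans by (metis Suc_leD)
    qed
    from this[of "Suc n"] have "lift_ext ?C (?F (Suc n)) (?F 0) X q v" by simp
    moreover have "?F 0 = cells ?C" using True by (auto simp: prism_filt_def fun_eq_iff)
    moreover have "?F (Suc n) = (\<lambda>m. {(\<alpha>, \<tau>) \<in> cells ?C m. nonsurj n m \<alpha> \<or> \<tau> = endpt e m})"
    proof (intro ext set_eqI)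
      fix m and w :: "(nat \<Rightarrow> nat) \<times> (nat \<Rightarrow> nat)" obtain \<alpha> \<tau> where w: "w = (\<alpha>, \<tau>)" by (cases w)
      have "\<alpha> t \<le> n" if "\<alpha> \<in> simplex_hom m n" "t \<le> m" for t using simplex_homD(1)[OF that] .
      then show "w \<in> ?F (Suc n) m \<longleftrightarrow> w \<in> {(\<alpha>, \<tau>) \<in> cells ?C m. nonsurj n m \<alpha> \<or> \<tau> = endpt e m}"
        using endpt[of \<tau> m] True by (auto simp: w prism_filt_def) (metis not_less_eq_eq)+
    qed
    ultimately show ?thesis by simp
  next
    case False
    have "lift_ext ?C (?F 0) (?F j) X q v" if "j \<le> Suc n" for j
      using that
    proof (induction j)
      case 0 show ?case by (auto simp: lift_ext_def)
    next
      case (Suc j)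
      have "lift_ext ?C (?F j) (?F (Suc j)) X q v"
        using step[of j] False Suc.prems by simp
      moreover have "?F 0 m \<subseteq> ?F j m" for m
        using False by (force simp: prism_filt_def)
      ultimately show ?case using Suc lift_ext_trans by (metis Suc_leD)
    qed
    from this[of "Suc n"] have "lift_ext ?C (?F 0) (?F (Suc n)) X q v" by simp
    moreover have "?F (Suc n) = cells ?C"
      using False by (auto simp: prism_filt_def fun_eq_iff dest: simplex_homD(1) intro: le_imp_less_Suc)
    moreover have "?F 0 = (\<lambda>m. {(\<alpha>, \<tau>) \<in> cells ?C m. nonsurj n m \<alpha> \<or> \<tau> = endpt e m})"
    proof (intro ext set_eqI)
      fix m and w :: "(nat \<Rightarrow> nat) \<times> (nat \<Rightarrow> nat)" obtain \<alpha> \<tau> where w: "w = (\<alpha>, \<tau>)" by (cases w)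
      show "w \<in> ?F 0 m \<longleftrightarrow> w \<in> {(\<alpha>, \<tau>) \<in> cells ?C m. nonsurj n m \<alpha> \<or> \<tau> = endpt e m}"
        using endpt[of \<tau> m] False by (auto simp: w prism_filt_def)
    qed
    ultimately show ?thesis by simp
  qed
qed

section \<open>Cylinders over arbitrary simplicial sets\<close>

definition cyl_base :: "'b sset \<Rightarrow> nat \<Rightarrow> (nat \<Rightarrow> 'b set) \<Rightarrow> nat \<Rightarrow> ('b \<times> (nat \<Rightarrow> nat)) set" where
  "cyl_base B e S m = {(b, \<tau>) \<in> cells (cyl B) m. b \<in> S m \<or> \<tau> = endpt e m}"

lemma cyl_base_iff [simp]:
  "(b, \<tau>) \<in> cyl_base B e S m \<longleftrightarrow> b \<in> cells B m \<and> \<tau> \<in> simplex_hom m 1 \<and> (b \<in> S m \<or> \<tau> = endpt e m)"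
  by (auto simp: cyl_base_def)

lemma subcomplex_cyl_base:
  assumes B: "simplicial_set B" and S: "subcomplex B S"
  shows "subcomplex (cyl B) (cyl_base B e S)"
proof (rule subcomplexI)
  fix m n \<alpha> w assume a: "\<alpha> \<in> simplex_hom m n" and w: "w \<in> cyl_base B e S n"
  show "act (cyl B) m n \<alpha> w \<in> cyl_base B e S m"
    using a w subcomplexD(2)[OF S a] simplicial_setD(1)[OF B a]
    by (cases w) (auto simp: simplex_hom_comp compose_endpt)
qed (auto simp: cyl_base_def)

text \<open>
  A cell of minimal dimension outside a subcomplex is nondegenerate with boundary in the
  subcomplex, so attaching it is a pushout along \<open>\<partial>\<Delta>\<^sup>n \<rightarrow> \<Delta>\<^sup>n\<close>.
\<close>

lemma minimal_cell:
  assumes B: "simplicial_set B" and S: "subcomplex B S" and b: "b \<in> cells B n" "b \<notin> S n"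
    and min: "\<And>m. m < n \<Longrightarrow> cells B m \<subseteq> S m"
  shows "\<alpha> \<in> simplex_hom m n \<Longrightarrow> act B m n \<alpha> b \<in> S m \<longleftrightarrow> nonsurj n m \<alpha>"
    and "\<alpha> \<in> simplex_hom m n \<Longrightarrow> \<beta> \<in> simplex_hom m n \<Longrightarrow> act B m n \<alpha> b \<notin> S m \<Longrightarrow>
      act B m n \<alpha> b = act B m n \<beta> b \<Longrightarrow> \<alpha> = \<beta>"
proof -
  note BD = simplicial_setD[OF B]
  show 1: "act B m n \<alpha> b \<in> S m \<longleftrightarrow> nonsurj n m \<alpha>" if a: "\<alpha> \<in> simplex_hom m n" for \<alpha> m
  proof
    assume in_S: "act B m n \<alpha> b \<in> S m"
    show "nonsurj n m \<alpha>"
    proof (rule ccontr)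
      assume "\<not> nonsurj n m \<alpha>"
      then have s: "{..n} \<subseteq> \<alpha> ` {..m}" by (simp add: nonsurj_def)
      from section_through[OF a s, of 0] obtain \<delta>
        where d: "\<delta> \<in> simplex_hom n m" "compose {..n} \<alpha> \<delta> = ident n" by blast
      have "act B n m \<delta> (act B m n \<alpha> b) = b" using BD(2,3) d a b(1) by simp
      then show False using subcomplexD(2)[OF S d(1) in_S] b(2) by simp
    qed
  next
    assume "nonsurj n m \<alpha>"
    then obtain s where s: "s \<le> n" "s \<notin> \<alpha> ` {..m}" by (auto elim: nonsurjE)
    from factor_non_surj[OF a s] obtain \<delta> \<beta> where f: "0 < n" "\<beta> \<in> simplex_hom m (n - 1)"
      "\<delta> \<in> simplex_hom (n - 1) n" "\<alpha> = compose {..m} \<delta> \<beta>" by blast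
    have "act B (n - 1) n \<delta> b \<in> S (n - 1)" using min[of "n - 1"] f(1) BD(1)[OF f(3) b(1)] by auto
    then have "act B m (n - 1) \<beta> (act B (n - 1) n \<delta> b) \<in> S m" by (rule subcomplexD(2)[OF S f(2)])
    then show "act B m n \<alpha> b \<in> S m" using BD(3)[OF f(2,3) b(1)] f(4) by simp
  qed
  show "\<alpha> = \<beta>" if a: "\<alpha> \<in> simplex_hom m n" and c: "\<beta> \<in> simplex_hom m n"
    and nS: "act B m n \<alpha> b \<notin> S m" and eq: "act B m n \<alpha> b = act B m n \<beta> b"
  proof (rule simplex_hom_eqI[OF a c])
    fix t assume t: "t \<le> m"
    have s: "{..n} \<subseteq> \<alpha> ` {..m}" using nS 1[OF a] by (simp add: nonsurj_def)
    from section_through[OF a s t] obtain \<delta>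
      where d: "\<delta> \<in> simplex_hom n m" "compose {..n} \<alpha> \<delta> = ident n" "\<delta> (\<alpha> t) = t" by blast
    let ?t = "compose {..n} \<beta> \<delta>"
    have t': "?t \<in> simplex_hom n n" using d(1) c by (rule simplex_hom_comp)
    have "act B n n ?t b = act B n m \<delta> (act B m n \<alpha> b)" using BD(3) d(1) c b(1) eq by simp
    also have "\<dots> = b" using BD(2,3) d a b(1) by simp
    finally have "\<not> nonsurj n n ?t" using 1[OF t'] b(2) by simp
    then have "?t = ident n" using surj_endo_ident[OF t'] by (simp add: nonsurj_def)
    then have "?t (\<alpha> t) = \<alpha> t" using simplex_homD(1)[OF a t] by simp
    then show "\<alpha> t = \<beta> t" using d(3) simplex_homD(1)[OF a t] by simp
  qed
qed

text \<open>Multiplying by \<open>\<Delta>\<^sup>1\<close> turns attaching the cell b into attaching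
  a prism. By \<open>minimal_cell\<close> the map \<phi> is injective off the old base and pulls
  that base back to the open prism handled by \<open>prism_lift_ext\<close>.\<close>

lemma cyl_lift_ext_cell:
  assumes K: "kan_fibration X Y q" and e: "e \<le> 1" and B: "simplicial_set B" and S: "subcomplex B S"
    and v: "smap_on (cyl B) (cells (cyl B)) Y v"
    and b: "b \<in> cells B n" "b \<notin> S n" and min: "\<And>m. m < n \<Longrightarrow> cells B m \<subseteq> S m"
  defines "S' \<equiv> (\<lambda>m. S m \<union> (\<lambda>\<alpha>. act B m n \<alpha> b) ` simplex_hom m n)"
  shows "lift_ext (cyl B) (cyl_base B e S) (cyl_base B e S') X q v"
proof -
  note cell = minimal_cell[OF B S b min]
  define \<phi> where "\<phi> m = (\<lambda>(\<alpha>, \<tau>). (act B m n \<alpha> b, \<tau> :: nat \<Rightarrow> nat))" for m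
  let ?Q = "cyl (simplex n)"
  have phi: "smap_on ?Q (cells ?Q) (cyl B) \<phi>"
    using b(1) simplicial_setD[OF B] by (intro smap_onI) (auto simp: \<phi>_def simplex_hom_comp)
  have "lift_ext (cyl B) (cyl_base B e S) (\<lambda>m. cyl_base B e S m \<union> \<phi> m ` cells ?Q m) X q v"
  proof (rule lift_ext_attach[OF simplicial_set_cyl[OF simplicial_set_simplex] phi subcomplex_cyl_base[OF B S]])
    show "x = y" if "x \<in> cells ?Q m" "y \<in> cells ?Q m" "\<phi> m x \<notin> cyl_base B e S m" "\<phi> m x = \<phi> m y" for m x y
      using that cell(2) simplicial_setD(1)[OF B _ b(1)] by (auto simp: \<phi>_def)
    have eq: "(\<lambda>m. {x \<in> cells ?Q m. \<phi> m x \<in> cyl_base B e S m}) =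
        (\<lambda>m. {(\<alpha>, \<tau>) \<in> cells ?Q m. nonsurj n m \<alpha> \<or> \<tau> = endpt e m})"
      using simplicial_setD(1)[OF B _ b(1)] cell(1) by (auto simp: \<phi>_def fun_eq_iff)
    have "smap_on ?Q (cells ?Q) Y (\<lambda>m x. v m (\<phi> m x))"
      using smap_onD[OF phi] smap_onD[OF v] by (intro smap_onI) (simp_all del: cells_sprod)
    from prism_lift_ext[OF K e this]
    show "lift_ext ?Q (\<lambda>m. {x \<in> cells ?Q m. \<phi> m x \<in> cyl_base B e S m}) (cells ?Q) X q (\<lambda>m x. v m (\<phi> m x))"
      unfolding eq .
  qed
  moreover have "cyl_base B e S m \<union> \<phi> m ` cells ?Q m = cyl_base B e S' m" for m
    using simplicial_setD(1)[OF B _ b(1)]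
    by (auto simp: S'_def \<phi>_def image_iff cyl_base_def)
  ultimately show ?thesis by simp
qed

lemma subcomplex_add_cell:
  assumes B: "simplicial_set B" and S: "subcomplex B S" and b: "b \<in> cells B n"
  shows "subcomplex B (\<lambda>m. S m \<union> (\<lambda>\<alpha>. act B m n \<alpha> b) ` simplex_hom m n)"
  using simplicial_setD(1,3)[OF B] b subcomplexD[OF S]
  by (intro subcomplexI) (auto simp: simplex_hom_comp)

text \<open>Zorn's lemma on partial lifts. A lift is recorded as its graph over
  \<open>cyl_base\<close>, so that extension of lifts is inclusion and a chain is bounded by its
  union. If a maximal lift were partial, a missing cell of least dimension could be attached by
  \<open>cyl_lift_ext_cell\<close>.\<close>

theorem cyl_lift_ext:
  fixes X :: "'x sset" and B :: "'b sset"
  assumes K: "kan_fibration X Y q" and e: "e \<le> 1" and B: "simplicial_set B" and A: "subcomplex B A"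
    and v: "smap_on (cyl B) (cells (cyl B)) Y v"
  shows "lift_ext (cyl B) (cyl_base B e A) (cells (cyl B)) X q v"
  unfolding lift_ext_def
proof (intro allI impI)
  fix f assume f: "lift_on (cyl B) (cyl_base B e A) X q v f"
  let ?C = "cyl_base B e"
  define gr where "gr T F = {(n, w, F n w) | n w. w \<in> T n}"
    for T :: "nat \<Rightarrow> ('b \<times> (nat \<Rightarrow> nat)) set" and F :: "nat \<Rightarrow> 'b \<times> (nat \<Rightarrow> nat) \<Rightarrow> 'x"
  have gr_iff: "(n, w, x) \<in> gr T F \<longleftrightarrow> w \<in> T n \<and> x = F n w" for n w x T F
    unfolding gr_def by blast
  define good where "good S F \<longleftrightarrow> subcomplex B S \<and> (\<forall>n. A n \<subseteq> S n) \<and> lift_on (cyl B) (?C S) X q v F \<and>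
      (\<forall>n. \<forall>w \<in> ?C A n. F n w = f n w)" for S F
  define \<G> where "\<G> = {gr (?C S) F | S F. good S F}"
  have "gr (?C A) f \<in> \<G>" using A f by (auto simp: \<G>_def good_def)
  then have ne: "\<G> \<noteq> {}" by blast
  have "\<exists>M\<in>\<G>. \<forall>G\<in>\<G>. M \<subseteq> G \<longrightarrow> G = M"
  proof (rule subset_Zorn_nonempty[OF ne])
    fix \<C> assume Cne: "\<C> \<noteq> {}" and "subset.chain \<G> \<C>"
    then have sub: "\<C> \<subseteq> \<G>" and lin: "\<And>G H. G \<in> \<C> \<Longrightarrow> H \<in> \<C> \<Longrightarrow> G \<subseteq> H \<or> H \<subseteq> G"
      by (auto simp: subset_chain_def)
    have "\<forall>G\<in>\<C>. \<exists>S F. G = gr (?C S) F \<and> good S F" using sub by (auto simp: \<G>_def)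
    then obtain SS FF where SF: "\<And>G. G \<in> \<C> \<Longrightarrow> G = gr (?C (SS G)) (FF G)" "\<And>G. G \<in> \<C> \<Longrightarrow> good (SS G) (FF G)"
      by metis
    define S where "S n = (\<Union>G\<in>\<C>. SS G n)" for n
    define F where "F n w = (THE x. (n, w, x) \<in> \<Union>\<C>)" for n w
    have mem: "(n, w, x) \<in> G \<longleftrightarrow> w \<in> ?C (SS G) n \<and> x = FF G n w" if "G \<in> \<C>" for n w x G
      by (subst SF(1)[OF that]) (simp add: gr_iff)
    have FG: "F n w = FF G n w" if G: "G \<in> \<C>" and w: "w \<in> ?C (SS G) n" for n w G
      unfolding F_def
    proof (rule the_equality)
      show "(n, w, FF G n w) \<in> \<Union>\<C>" using mem[OF G] G w by blast
      fix x assume "(n, w, x) \<in> \<Union>\<C>"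
      then obtain H where H: "H \<in> \<C>" "(n, w, x) \<in> H" by blast
      have "(n, w, FF G n w) \<in> G" using mem[OF G] w by blast
      then have "(n, w, FF G n w) \<in> H \<or> (n, w, x) \<in> G" using lin[OF G H(1)] H(2) by blast
      then show "x = FF G n w" using H(2) unfolding mem[OF G] mem[OF H(1)] by auto
    qed
    have base: "w \<in> ?C S n \<longleftrightarrow> (\<exists>G\<in>\<C>. w \<in> ?C (SS G) n)" for w n
      using Cne by (cases w) (auto simp: S_def)
    have gS: "subcomplex B (SS G)" "\<And>n. A n \<subseteq> SS G n" "lift_on (cyl B) (?C (SS G)) X q v (FF G)"
      "\<And>n w. w \<in> ?C A n \<Longrightarrow> FF G n w = f n w" if "G \<in> \<C>" for G
      using SF(2)[OF that] by (auto simp: good_def)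
    have "good S F"
      unfolding good_def
    proof (intro conjI allI ballI)
      show S: "subcomplex B S"
      proof (rule subcomplexI)
        fix n w assume "w \<in> S n"
        then obtain G where G: "G \<in> \<C>" "w \<in> SS G n" unfolding S_def by blast
        show "w \<in> cells B n" by (rule subcomplexD(1)[OF gS(1)[OF G(1)] G(2)])
        fix m \<alpha> assume a: "\<alpha> \<in> simplex_hom m n"
        show "act B m n \<alpha> w \<in> S m"
          unfolding S_def using subcomplexD(2)[OF gS(1)[OF G(1)] a G(2)] G(1) by blast
      qed
      show "A n \<subseteq> S n" for n unfolding S_def using Cne gS(2) by blast
      show "lift_on (cyl B) (?C S) X q v F"
      proof (rule lift_onI)
        fix m n \<alpha> w assume a: "\<alpha> \<in> simplex_hom m n" and w: "w \<in> ?C S n"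
        then obtain G where G: "G \<in> \<C>" "w \<in> ?C (SS G) n" using base by blast
        have "act (cyl B) m n \<alpha> w \<in> ?C (SS G) m"
          using subcomplexD(2)[OF subcomplex_cyl_base[OF B gS(1)[OF G(1)]] a G(2)] .
        then show "F m (act (cyl B) m n \<alpha> w) = act X m n \<alpha> (F n w)"
          using FG[OF G(1)] G(2) lift_onD(2)[OF gS(3)[OF G(1)] a G(2)] by metis
      next
        fix n w assume "w \<in> ?C S n"
        then obtain G where G: "G \<in> \<C>" "w \<in> ?C (SS G) n" using base by blast
        then show "F n w \<in> cells X n" "q n (F n w) = v n w"
          unfolding FG[OF G] using lift_onD(1,3)[OF gS(3)[OF G(1)] G(2)] by simp_all
      qed
      fix n w assume w: "w \<in> ?C A n"
      obtain G where G: "G \<in> \<C>" using Cne by blast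
      then have "w \<in> ?C (SS G) n" using w gS(2)[OF G] by (cases w) auto
      then show "F n w = f n w" using FG[OF G] gS(4)[OF G w] by simp
    qed
    moreover have "\<Union>\<C> = gr (?C S) F"
    proof (intro set_eqI)
      fix z :: "nat \<times> ('b \<times> (nat \<Rightarrow> nat)) \<times> 'x"
      obtain n w x where z: "z = (n, w, x)" by (cases z)
      have "z \<in> \<Union>\<C> \<longleftrightarrow> (\<exists>G\<in>\<C>. w \<in> ?C (SS G) n \<and> x = FF G n w)"
        unfolding z Union_iff using mem by (intro bex_cong refl)
      also have "\<dots> \<longleftrightarrow> (\<exists>G\<in>\<C>. w \<in> ?C (SS G) n) \<and> x = F n w" using FG by metis
      also have "\<dots> \<longleftrightarrow> z \<in> gr (?C S) F" by (simp add: z gr_iff base)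
      finally show "z \<in> \<Union>\<C> \<longleftrightarrow> z \<in> gr (?C S) F" .
    qed
    ultimately show "\<Union>\<C> \<in> \<G>" by (auto simp: \<G>_def)
  qed
  then obtain S F where g: "good S F" and max: "\<And>G. G \<in> \<G> \<Longrightarrow> gr (?C S) F \<subseteq> G \<Longrightarrow> G = gr (?C S) F"
    by (auto simp: \<G>_def)
  have S: "subcomplex B S" and AS: "\<And>n. A n \<subseteq> S n" and F: "lift_on (cyl B) (?C S) X q v F"
    and Ff: "\<And>n w. w \<in> ?C A n \<Longrightarrow> F n w = f n w"
    using g by (auto simp: good_def)
  have "cells B n \<subseteq> S n" for n
  proof (induction n rule: less_induct)
    case (less n)
    show ?case
    proof (rule ccontr)
      assume "\<not> cells B n \<subseteq> S n"
      then obtain b where b: "b \<in> cells B n" "b \<notin> S n" by blast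
      let ?S' = "\<lambda>m. S m \<union> (\<lambda>\<alpha>. act B m n \<alpha> b) ` simplex_hom m n"
      have "lift_ext (cyl B) (?C S) (?C ?S') X q v"
        by (rule cyl_lift_ext_cell[OF K e B S v b less])
      from lift_extD[OF this F] obtain F' where F': "lift_on (cyl B) (?C ?S') X q v F'"
        "\<And>n w. w \<in> ?C S n \<Longrightarrow> F' n w = F n w" by blast
      have "good ?S' F'"
        unfolding good_def
      proof (intro conjI allI ballI)
        show "subcomplex B ?S'" by (rule subcomplex_add_cell[OF B S b(1)])
        show "A m \<subseteq> ?S' m" for m using AS by blast
        show "F' m w = f m w" if "w \<in> ?C A m" for m w
        proof -
          have "w \<in> ?C S m" using that AS by (cases w) auto
          then show ?thesis using F'(2) Ff[OF that] by simp
        qed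
      qed (rule F'(1))
      then have "gr (?C ?S') F' \<in> \<G>" by (auto simp: \<G>_def)
      moreover have "gr (?C S) F \<subseteq> gr (?C ?S') F'"
      proof
        fix z assume z: "z \<in> gr (?C S) F"
        obtain m w x where nwx: "z = (m, w, x)" by (cases z)
        then have w: "w \<in> ?C S m" "x = F m w" using z by (simp_all add: gr_iff)
        then have "w \<in> ?C ?S' m" by (cases w) auto
        then show "z \<in> gr (?C ?S') F'" using w F'(2) by (simp add: nwx gr_iff)
      qed
      ultimately have eq: "gr (?C ?S') F' = gr (?C S) F" by (rule max)
      \<comment> \<open>The cell over b at the end e belongs to the domain from the start. Growth of
        the graph is visible only away from that end, hence the opposite constant.\<close>
      define \<tau> where "\<tau> = endpt (1 - e) n"
      have "1 - e \<noteq> e" by presburger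
      then have t: "\<tau> \<in> simplex_hom n 1" "\<tau> \<noteq> endpt e n"
        by (auto simp: \<tau>_def endpt_eq_iff intro!: endpt_hom)
      have "act B n n (ident n) b = b" using simplicial_setD(2)[OF B b(1)] .
      then have "b \<in> ?S' n" using ident_hom by (metis UnI2 imageI)
      then have "(b, \<tau>) \<in> ?C ?S' n" using b t by simp
      then have "(n, (b, \<tau>), F' n (b, \<tau>)) \<in> gr (?C S) F" unfolding eq[symmetric] by (simp add: gr_iff)
      then show False using b t by (simp add: gr_iff)
    qed
  qed
  then have "?C S = cells (cyl B)" by (auto simp: fun_eq_iff cyl_base_def)
  then show "\<exists>f'. lift_on (cyl B) (cells (cyl B)) X q v f' \<and> (\<forall>n. \<forall>w\<in>?C A n. f' n w = f n w)"
    using F Ff by auto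
qed

text \<open>The data f0 at the end e and f1 over A agree where both are defined and so form one lift
  on \<open>cyl_base\<close>. Either end may be prescribed because the homotopies used later run in
  both directions; an empty A gives plain homotopy lifting.\<close>

lemma homotopy_lifting:
  assumes K: "kan_fibration X Y q" and e: "e \<le> 1" and B: "simplicial_set B" and A: "subcomplex B A"
    and v: "smap_on (cyl B) (cells (cyl B)) Y v"
    and f0: "lift_on B (cells B) X q (\<lambda>n b. v n (b, endpt e n)) f0"
    and f1: "lift_on (cyl B) (\<lambda>n. A n \<times> simplex_hom n 1) X q v f1"
    and eq: "\<And>n b. b \<in> A n \<Longrightarrow> f1 n (b, endpt e n) = f0 n b"
  obtains f where "lift_on (cyl B) (cells (cyl B)) X q v f"
    "\<And>n b. b \<in> cells B n \<Longrightarrow> f n (b, endpt e n) = f0 n b"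
    "\<And>n b \<tau>. b \<in> A n \<Longrightarrow> \<tau> \<in> simplex_hom n 1 \<Longrightarrow> f n (b, \<tau>) = f1 n (b, \<tau>)"
proof -
  note AD = subcomplexD[OF A]
  define g where "g n w = (if fst w \<in> A n then f1 n w else f0 n (fst w))" for n w
  have gA: "g n (b, \<tau>) = f1 n (b, \<tau>)" if "b \<in> A n" for n b \<tau> using that by (simp add: g_def)
  have g0: "g n (b, endpt e n) = f0 n b" for n b using eq by (simp add: g_def)
  have "lift_on (cyl B) (cyl_base B e A) X q v g"
  proof (rule lift_onI)
    fix n w assume w: "w \<in> cyl_base B e A n"
    obtain b \<tau> where bt: "w = (b, \<tau>)" by (cases w)
    show "g n w \<in> cells X n" "q n (g n w) = v n w"
      using w lift_onD(1,3)[OF f1, of "(b, \<tau>)"] lift_onD(1,3)[OF f0] g0 gA by (auto simp: bt)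
    fix m \<alpha> assume a: "\<alpha> \<in> simplex_hom m n"
    show "g m (act (cyl B) m n \<alpha> w) = act X m n \<alpha> (g n w)"
    proof (cases "b \<in> A n")
      case True
      then show ?thesis using w lift_onD(2)[OF f1 a, of "(b, \<tau>)"] gA AD(2)[OF a] by (auto simp: bt)
    next
      case False
      then have "\<tau> = endpt e n" "b \<in> cells B n" using w by (auto simp: bt)
      then show ?thesis using g0 lift_onD(2)[OF f0 a] by (simp add: bt compose_endpt[OF a])
    qed
  qed
  from lift_extD[OF cyl_lift_ext[OF K e B A v] this] obtain f
    where f: "lift_on (cyl B) (cells (cyl B)) X q v f" "\<And>n w. w \<in> cyl_base B e A n \<Longrightarrow> f n w = g n w"
    by blast
  show thesis
  proof (rule that[OF f(1)])
    show "f n (b, endpt e n) = f0 n b" if "b \<in> cells B n" for n b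
      using f(2)[of "(b, endpt e n)"] that g0 endpt_hom[OF e] by simp
    show "f n (b, \<tau>) = f1 n (b, \<tau>)" if "b \<in> A n" "\<tau> \<in> simplex_hom n 1" for n b \<tau>
      using f(2)[of "(b, \<tau>)"] that gA AD(1) by simp
  qed
qed

section \<open>Extending a Kan fibration from a homotopy retract\<close>

lemma kan_fibrationI:
  assumes X: "simplicial_set X" and Y: "simplicial_set Y" and q: "q \<in> smaps X Y"
    and lift: "\<And>n k v f. 1 \<le> n \<Longrightarrow> k \<le> n \<Longrightarrow> smap_on (simplex n) (cells (simplex n)) Y v \<Longrightarrow>
      lift_on (simplex n) (cells (horn n k)) X q v f \<Longrightarrow>
      \<exists>f'. lift_on (simplex n) (cells (simplex n)) X q v f' \<and>
           (\<forall>m. \<forall>w\<in>cells (horn n k) m. f' m w = f m w)"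
  shows "kan_fibration X Y q"
  unfolding kan_fibration_def has_rlp_def
proof (intro conjI X Y q allI impI ballI)
  fix n k u v assume nk: "1 \<le> n \<and> k \<le> n" and u: "u \<in> smaps (horn n k) X"
    and v: "v \<in> smaps (simplex n) Y" and eq: "smap_comp (horn n k) q u = smap_comp (horn n k) v (sid (horn n k))"
  let ?H = "horn n k" and ?D = "simplex n"
  have "q m (u m w) = v m w" if "w \<in> cells ?H m" for m w
    using fun_cong[OF fun_cong[OF eq, of m], of w] that by (simp add: smap_comp_apply sid_def)
  then have "lift_on ?D (cells ?H) X q v u"
    using smaps_cell[OF u] smaps_actD[OF u] by (intro lift_onI) auto
  from lift[OF conjunct1[OF nk] conjunct2[OF nk] smap_on_smaps[OF v] this] obtain f'
    where f': "lift_on ?D (cells ?D) X q v f'" "\<forall>m. \<forall>w\<in>cells ?H m. f' m w = u m w" by blast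
  let ?h = "\<lambda>m. restrict (f' m) (cells ?D m)"
  have h: "?h \<in> smaps ?D X"
    using lift_onD(1,2)[OF f'(1)] unfolding smaps_def by (auto simp: simplex_hom_comp)
  moreover have "smap_comp ?H ?h (sid ?H) = u"
    by (rule smaps_eqI[OF smap_comp_in_smaps[OF simplicial_set_horn horn_inclusion h] u])
      (use f'(2) horn_cell[of _ n k] in \<open>auto simp: smap_comp_apply sid_def\<close>)
  moreover have "smap_comp ?D q ?h = v"
    by (rule smaps_eqI[OF smap_comp_in_smaps[OF simplicial_set_simplex h q] v])
      (use lift_onD(3)[OF f'(1)] in \<open>auto simp: smap_comp_apply\<close>)
  ultimately show "\<exists>h\<in>smaps ?D X. smap_comp ?H h (sid ?H) = u \<and> smap_comp ?D q h = v" by blast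
qed

abbreviation restr_cells :: "'b sset \<Rightarrow> (nat \<Rightarrow> 'b set) \<Rightarrow> 'b sset" where
  "restr_cells B L \<equiv> B\<lparr>cells := L\<rparr>"

lemma simplicial_set_restr_cells:
  assumes B: "simplicial_set B" and L: "subcomplex B L"
  shows "simplicial_set (restr_cells B L)"
  unfolding simplicial_set_def
proof (intro conjI allI ballI)
  note B = simplicial_setD[OF B] and L = subcomplexD[OF L]
  fix l m n \<alpha> \<beta> x
  show "x \<in> cells (restr_cells B L) n \<Longrightarrow> act (restr_cells B L) n n (ident n) x = x"
    using B(2) L(1) by simp
  show "\<alpha> \<in> simplex_hom m n \<Longrightarrow> x \<in> cells (restr_cells B L) n \<Longrightarrow>
      act (restr_cells B L) m n \<alpha> x \<in> cells (restr_cells B L) m"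
    using L(2) by simp
  show "\<alpha> \<in> simplex_hom l m \<Longrightarrow> \<beta> \<in> simplex_hom m n \<Longrightarrow> x \<in> cells (restr_cells B L) n \<Longrightarrow>
      act (restr_cells B L) l m \<alpha> (act (restr_cells B L) m n \<beta> x) =
      act (restr_cells B L) l n (compose {..l} \<beta> \<alpha>) x"
    using B(3) L(1) by simp
qed

text \<open>Above dimension n every cell of \<open>\<Delta>\<^sup>n\<close> is degenerate, so its
  value is forced by a cell of lower dimension. This reduces partial sections and horns to finitely
  many values, on which the cardinality bounds rest.\<close>

lemma smap_on_determined:
  assumes T: "subcomplex (simplex n) T" and s: "smap_on (simplex n) T X s" and s': "smap_on (simplex n) T X s'"
    and low: "\<And>l \<alpha>. l \<le> n \<Longrightarrow> \<alpha> \<in> T l \<Longrightarrow> s l \<alpha> = s' l \<alpha>"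
  shows "\<alpha> \<in> T l \<Longrightarrow> s l \<alpha> = s' l \<alpha>"
proof (induction l arbitrary: \<alpha> rule: less_induct)
  case (less l)
  show ?case
  proof (cases "l \<le> n")
    case False
    have a: "\<alpha> \<in> simplex_hom l n" using subcomplexD(1)[OF T less.prems] by simp
    have "card (\<alpha> ` {..l}) \<le> card {..n}" using simplex_homD(1)[OF a] by (intro card_mono) auto
    then have "\<not> inj_on \<alpha> {..l}" using False card_image[of \<alpha> "{..l}"] by auto
    then obtain j where "j < l" "\<alpha> j = \<alpha> (Suc j)" by (rule simplex_hom_inj_or_factor[OF a])
    then obtain \<delta> \<sigma> where f: "\<sigma> \<in> simplex_hom l (l - 1)" "\<delta> \<in> simplex_hom (l - 1) l"
      "\<alpha> = compose {..l} (compose {..l-1} \<alpha> \<delta>) \<sigma>" by (rule factor_non_inj[OF a])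
    have t: "compose {..l-1} \<alpha> \<delta> \<in> T (l - 1)" using subcomplexD(2)[OF T f(2) less.prems] by simp
    have "s l \<alpha> = act X l (l - 1) \<sigma> (s (l - 1) (compose {..l-1} \<alpha> \<delta>))"
      using smap_onD(2)[OF s f(1) t] f(3) by simp
    moreover have "s' l \<alpha> = act X l (l - 1) \<sigma> (s' (l - 1) (compose {..l-1} \<alpha> \<delta>))"
      using smap_onD(2)[OF s' f(1) t] f(3) by simp
    ultimately show ?thesis using less.IH[OF _ t] False by simp
  qed (use low less.prems in auto)
qed

section \<open>Cardinality of finite products\<close>

lemma finite_ordLess_infinite_card:
  assumes "Card_order \<kappa>" "infinite (Field \<kappa>)" "finite A"
  shows "|A| <o \<kappa>"
  using assms card_of_Well_order[of A]
  by (intro finite_ordLess_infinite) (auto simp: Field_card_of card_order_on_def)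

lemma Times_ordLess_infinite:
  assumes \<kappa>: "Card_order \<kappa>" "infinite (Field \<kappa>)" and A: "|A| <o \<kappa>" and B: "|B| <o \<kappa>"
  shows "|A \<times> B| <o \<kappa>"
proof (cases "finite (A <+> B)")
  case True
  then have "finite (A \<times> B)" by (auto simp: finite_Plus_iff)
  then show ?thesis by (rule finite_ordLess_infinite_card[OF \<kappa>])
next
  case False
  let ?C = "A <+> B"
  have "|A \<times> B| \<le>o |?C \<times> ?C|"
    by (rule card_of_ordLeqI[of "map_prod Inl Inr"]) (auto simp: inj_on_def)
  also have "|?C \<times> ?C| =o |?C|" using False by (rule card_of_Times_same_infinite)
  also have "|?C| <o \<kappa>" by (rule card_of_Plus_ordLess_infinite_Field[OF \<kappa>(2,1) A B])
  finally show ?thesis .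
qed

lemma finite_PiE_ordLess:
  assumes \<kappa>: "Card_order \<kappa>" "infinite (Field \<kappa>)" and G: "finite G" and A: "\<And>g. g \<in> G \<Longrightarrow> |A g| <o \<kappa>"
  shows "|PiE G A| <o \<kappa>"
  using G A
proof (induction G)
  case empty
  show ?case
    using finite_ordLess_infinite_card[OF \<kappa>, of "{\<lambda>x. undefined}"] by simp
next
  case (insert g G)
  have "|A g \<times> PiE G A| <o \<kappa>"
    using insert by (intro Times_ordLess_infinite[OF \<kappa>]) auto
  moreover have "|(\<lambda>(y, f). f(g := y)) ` (A g \<times> PiE G A)| \<le>o |A g \<times> PiE G A|"
    by (rule card_of_image)
  ultimately show ?case unfolding PiE_insert_eq using ordLeq_ordLess_trans by fastforce
qed

text \<open>
  The subcomplex \<open>L\<close> need not be a retract of \<open>B\<close>: the map \<open>g : B \<rightarrow> L\<close> restricts on \<open>L\<close> to a map that is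
  only homotopic to the identity, in one of the two directions.
\<close>

locale retract_extension =
  fixes B :: "'b sset" and L :: "nat \<Rightarrow> 'b set" and D :: "'d sset" and q :: "nat \<Rightarrow> 'd \<Rightarrow> 'b"
    and g :: "nat \<Rightarrow> 'b \<Rightarrow> 'b" and h :: "nat \<Rightarrow> 'b \<times> (nat \<Rightarrow> nat) \<Rightarrow> 'b" and e e' :: nat
  assumes B: "simplicial_set B" and L: "subcomplex B L"
    and kan: "kan_fibration D (restr_cells B L) q"
    and g: "smap_on B (cells B) (restr_cells B L) g"
    and h: "smap_on (cyl (restr_cells B L)) (cells (cyl (restr_cells B L))) (restr_cells B L) h"
    and e: "e \<le> 1" "e' \<le> 1"
    and he: "\<And>n x. x \<in> L n \<Longrightarrow> h n (x, endpt e n) = g n x"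
    and he': "\<And>n x. x \<in> L n \<Longrightarrow> h n (x, endpt e' n) = x"
begin

section \<open>Basic facts and the transport map\<close>

lemmas BD = simplicial_setD[OF B]
lemmas LD = subcomplexD[OF L]

lemma D: "simplicial_set D" and q: "q \<in> smaps D (restr_cells B L)"
  using kan by (auto simp: kan_fibration_def)

lemmas DD = simplicial_setD[OF D]

lemma qD: "d \<in> cells D n \<Longrightarrow> q n d \<in> L n"
  "\<alpha> \<in> simplex_hom m n \<Longrightarrow> d \<in> cells D n \<Longrightarrow> q m (act D m n \<alpha> d) = act B m n \<alpha> (q n d)"
  using smaps_cell[OF q] smaps_actD[OF q] by simp_all

lemma gD: "b \<in> cells B n \<Longrightarrow> g n b \<in> L n"
  "\<alpha> \<in> simplex_hom m n \<Longrightarrow> b \<in> cells B n \<Longrightarrow> g m (act B m n \<alpha> b) = act B m n \<alpha> (g n b)"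
  using smap_onD[OF g] by simp_all

lemma hD: "x \<in> L n \<Longrightarrow> \<tau> \<in> simplex_hom n 1 \<Longrightarrow> h n (x, \<tau>) \<in> L n"
  "\<alpha> \<in> simplex_hom m n \<Longrightarrow> x \<in> L n \<Longrightarrow> \<tau> \<in> simplex_hom n 1 \<Longrightarrow>
     h m (act B m n \<alpha> x, compose {..m} \<tau> \<alpha>) = act B m n \<alpha> (h n (x, \<tau>))"
  using smap_onD(1)[OF h, of "(x, \<tau>)"] smap_onD(2)[OF h, of _ _ _ "(x, \<tau>)"] by simp_all

text \<open>The lift starts at the end e', where h is the identity of L, so that the identity of D
  is an admissible start; no subcomplex is prescribed. Its end e then lies over g.\<close>

lemma ex_transport:
  "\<exists>i. lift_on (cyl D) (cells (cyl D)) D q (\<lambda>n w. h n (q n (fst w), snd w)) i \<and>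
     (\<forall>n. \<forall>d \<in> cells D n. i n (d, endpt e' n) = d)"
proof -
  have v: "smap_on (cyl D) (cells (cyl D)) (restr_cells B L) (\<lambda>n w. h n (q n (fst w), snd w))"
    by (intro smap_onI) (auto simp: hD qD)
  have f0: "lift_on D (cells D) D q (\<lambda>n b. h n (q n (fst (b, endpt e' n)), snd (b, endpt e' n))) (\<lambda>n d. d)"
    by (rule lift_onI) (auto simp: he' qD)
  have f1: "lift_on (cyl D) (\<lambda>n. {} \<times> simplex_hom n 1) D q (\<lambda>n w. h n (q n (fst w), snd w)) (\<lambda>n w. undefined)"
    by (rule lift_onI) auto
  have sub: "subcomplex D (\<lambda>_. {})" by (simp add: subcomplex_def)
  obtain f where "lift_on (cyl D) (cells (cyl D)) D q (\<lambda>n w. h n (q n (fst w), snd w)) f"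
    "\<And>n b. b \<in> cells D n \<Longrightarrow> f n (b, endpt e' n) = b"
    by (rule homotopy_lifting[OF kan e(2) D sub v f0 f1]) auto
  then show ?thesis by blast
qed

definition tr :: "nat \<Rightarrow> 'd \<times> (nat \<Rightarrow> nat) \<Rightarrow> 'd" where
  "tr = (SOME i. lift_on (cyl D) (cells (cyl D)) D q (\<lambda>n w. h n (q n (fst w), snd w)) i \<and>
     (\<forall>n. \<forall>d \<in> cells D n. i n (d, endpt e' n) = d))"

lemma trD:
  "d \<in> cells D n \<Longrightarrow> \<tau> \<in> simplex_hom n 1 \<Longrightarrow> tr n (d, \<tau>) \<in> cells D n"
  "d \<in> cells D n \<Longrightarrow> \<tau> \<in> simplex_hom n 1 \<Longrightarrow> q n (tr n (d, \<tau>)) = h n (q n d, \<tau>)"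
  "\<alpha> \<in> simplex_hom m n \<Longrightarrow> d \<in> cells D n \<Longrightarrow> \<tau> \<in> simplex_hom n 1 \<Longrightarrow>
     tr m (act D m n \<alpha> d, compose {..m} \<tau> \<alpha>) = act D m n \<alpha> (tr n (d, \<tau>))"
  "d \<in> cells D n \<Longrightarrow> tr n (d, endpt e' n) = d"
  using someI_ex[OF ex_transport, folded tr_def] lift_onD(1,3)[of "cyl D" _ _ _ _ _ "(d, \<tau>)"]
    lift_onD(2)[of "cyl D" _ _ _ _ _ _ _ _ "(d, \<tau>)"] by fastforce+

text \<open>The map \<open>w : D \<rightarrow> D\<close> over g along which D is glued.\<close>

definition tr1 :: "nat \<Rightarrow> 'd \<Rightarrow> 'd" where
  "tr1 n d = tr n (d, endpt e n)"

lemma tr1D: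
  "d \<in> cells D n \<Longrightarrow> tr1 n d \<in> cells D n"
  "d \<in> cells D n \<Longrightarrow> q n (tr1 n d) = g n (q n d)"
  "\<alpha> \<in> simplex_hom m n \<Longrightarrow> d \<in> cells D n \<Longrightarrow> tr1 m (act D m n \<alpha> d) = act D m n \<alpha> (tr1 n d)"
  using trD(1,2)[OF _ endpt_hom[OF e(1)]] trD(3)[OF _ _ endpt_hom[OF e(1)]]
  by (simp_all add: tr1_def he qD compose_endpt)

section \<open>Partial sections and the glued simplicial set\<close>

definition preim :: "nat \<Rightarrow> 'b \<Rightarrow> nat \<Rightarrow> (nat \<Rightarrow> nat) set" where
  "preim m b l = {\<alpha> \<in> simplex_hom l m. act B l m \<alpha> b \<in> L l}"

lemma preimD: "\<alpha> \<in> preim m b l \<Longrightarrow> \<alpha> \<in> simplex_hom l m" "\<alpha> \<in> preim m b l \<Longrightarrow> act B l m \<alpha> b \<in> L l"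
  by (auto simp: preim_def)

lemma preim_comp_iff:
  assumes "b \<in> cells B m" "\<beta> \<in> simplex_hom l m" "\<gamma> \<in> simplex_hom k l"
  shows "compose {..k} \<beta> \<gamma> \<in> preim m b k \<longleftrightarrow> \<gamma> \<in> preim l (act B l m \<beta> b) k"
  using assms by (simp add: preim_def BD simplex_hom_comp)

lemma subcomplex_preim:
  assumes b: "b \<in> cells B m" shows "subcomplex (simplex m) (preim m b)"
proof (rule subcomplexI)
  fix k l \<alpha> w assume a: "\<alpha> \<in> simplex_hom k l" and w: "w \<in> preim m b l"
  then have "act B k m (compose {..k} w \<alpha>) b = act B k l \<alpha> (act B l m w b)"
    using b by (simp add: BD preim_def)
  then show "act (simplex m) k l \<alpha> w \<in> preim m b k"
    using a w LD(2)[OF a preimD(2)[OF w]] by (simp add: preim_def simplex_hom_comp)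
qed (simp add: preim_def)

text \<open>Extensionality makes a section equal to any other with the same values on the preimage.
  Without it the simplicial identities of \<open>ext_sset\<close> would fail off the preimage and
  fibres could not be counted.\<close>

definition sections :: "nat \<Rightarrow> 'b \<Rightarrow> (nat \<Rightarrow> (nat \<Rightarrow> nat) \<Rightarrow> 'd) set" where
  "sections m b = {s. (\<forall>l. s l \<in> extensional (preim m b l)) \<and>
     lift_on (simplex m) (preim m b) D q (\<lambda>l \<alpha>. act B l m \<alpha> b) s}"

definition section_pull :: "nat \<Rightarrow> nat \<Rightarrow> (nat \<Rightarrow> nat) \<Rightarrow> 'b \<Rightarrow> (nat \<Rightarrow> (nat \<Rightarrow> nat) \<Rightarrow> 'd) \<Rightarrow>
    nat \<Rightarrow> (nat \<Rightarrow> nat) \<Rightarrow> 'd" where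
  "section_pull l m \<beta> b s = (\<lambda>k. \<lambda>\<gamma>\<in>preim l (act B l m \<beta> b) k. s k (compose {..k} \<beta> \<gamma>))"

text \<open>Write i for the inclusion of L into B. This is the fibre product of the pullback of D
  along g and the pushforward of D along i, over the pushforward of the restriction of the former to
  L, the second leg being induced by \<open>tr1\<close>. Restricting a pushforward along a
  monomorphism gives back the original object, so over L the fibre product collapses to D.\<close>

definition ext_sset :: "('b \<times> 'd \<times> (nat \<Rightarrow> (nat \<Rightarrow> nat) \<Rightarrow> 'd)) sset" where
  "ext_sset = \<lparr>cells = (\<lambda>m. {(b, y, s). b \<in> cells B m \<and> y \<in> cells D m \<and> q m y = g m b \<and>
        s \<in> sections m b \<and> (\<forall>l. \<forall>\<alpha> \<in> preim m b l. tr1 l (s l \<alpha>) = act D l m \<alpha> y)}),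
     act = (\<lambda>l m \<beta> (b, y, s). (act B l m \<beta> b, act D l m \<beta> y, section_pull l m \<beta> b s))\<rparr>"

definition ext_proj :: "nat \<Rightarrow> 'b \<times> 'd \<times> (nat \<Rightarrow> (nat \<Rightarrow> nat) \<Rightarrow> 'd) \<Rightarrow> 'b" where
  "ext_proj m = restrict fst (cells ext_sset m)"

definition ext_incl :: "nat \<Rightarrow> 'd \<Rightarrow> 'b \<times> 'd \<times> (nat \<Rightarrow> (nat \<Rightarrow> nat) \<Rightarrow> 'd)" where
  "ext_incl m = (\<lambda>d\<in>cells D m. (q m d, tr1 m d, \<lambda>l. \<lambda>\<alpha>\<in>simplex_hom l m. act D l m \<alpha> d))"

lemma ext_cells_iff:
  "(b, y, s) \<in> cells ext_sset m \<longleftrightarrow> b \<in> cells B m \<and> y \<in> cells D m \<and> q m y = g m b \<and>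
        s \<in> sections m b \<and> (\<forall>l. \<forall>\<alpha> \<in> preim m b l. tr1 l (s l \<alpha>) = act D l m \<alpha> y)"
  by (simp add: ext_sset_def)

lemma act_ext: "act ext_sset l m \<beta> (b, y, s) = (act B l m \<beta> b, act D l m \<beta> y, section_pull l m \<beta> b s)"
  by (simp add: ext_sset_def)

lemma sectionsD:
  assumes "s \<in> sections m b"
  shows "\<alpha> \<in> preim m b l \<Longrightarrow> s l \<alpha> \<in> cells D l" "\<alpha> \<in> preim m b l \<Longrightarrow> q l (s l \<alpha>) = act B l m \<alpha> b"
    "\<alpha> \<in> preim m b l \<Longrightarrow> \<beta> \<in> simplex_hom k l \<Longrightarrow> s k (compose {..k} \<alpha> \<beta>) = act D k l \<beta> (s l \<alpha>)"
    "s l \<in> extensional (preim m b l)"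
proof -
  from assms have s: "lift_on (simplex m) (preim m b) D q (\<lambda>l \<alpha>. act B l m \<alpha> b) s"
    and x: "\<And>l. s l \<in> extensional (preim m b l)"
    by (simp_all add: sections_def)
  show "\<alpha> \<in> preim m b l \<Longrightarrow> s l \<alpha> \<in> cells D l" "\<alpha> \<in> preim m b l \<Longrightarrow> q l (s l \<alpha>) = act B l m \<alpha> b"
    "\<alpha> \<in> preim m b l \<Longrightarrow> \<beta> \<in> simplex_hom k l \<Longrightarrow> s k (compose {..k} \<alpha> \<beta>) = act D k l \<beta> (s l \<alpha>)"
    "s l \<in> extensional (preim m b l)"
    using lift_onD(1)[OF s] lift_onD(3)[OF s] lift_onD(2)[OF s, of \<beta> k l \<alpha>] x by simp_all
qed

lemma sectionsI:
  assumes "\<And>l. s l \<in> extensional (preim m b l)"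
    "\<And>l \<alpha>. \<alpha> \<in> preim m b l \<Longrightarrow> s l \<alpha> \<in> cells D l" "\<And>l \<alpha>. \<alpha> \<in> preim m b l \<Longrightarrow> q l (s l \<alpha>) = act B l m \<alpha> b"
    "\<And>k l \<alpha> \<beta>. \<alpha> \<in> preim m b l \<Longrightarrow> \<beta> \<in> simplex_hom k l \<Longrightarrow> s k (compose {..k} \<alpha> \<beta>) = act D k l \<beta> (s l \<alpha>)"
  shows "s \<in> sections m b"
  using assms unfolding sections_def by (auto intro: lift_onI)

lemma sections_eqI:
  assumes "s \<in> sections m b" "s' \<in> sections m b" "\<And>l \<alpha>. \<alpha> \<in> preim m b l \<Longrightarrow> s l \<alpha> = s' l \<alpha>"
  shows "s = s'"
  using assms sectionsD(4) by (metis extensionalityI ext)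

lemma section_pull_sections:
  assumes b: "b \<in> cells B m" and s: "s \<in> sections m b" and \<beta>: "\<beta> \<in> simplex_hom l m"
  shows "section_pull l m \<beta> b s \<in> sections l (act B l m \<beta> b)"
proof (rule sectionsI)
  note sD = sectionsD[OF s]
  let ?p = "preim l (act B l m \<beta> b)"
  have pc: "compose {..k} \<beta> \<gamma> \<in> preim m b k" if "\<gamma> \<in> ?p k" for k \<gamma>
    using preim_comp_iff[OF b \<beta>] that preimD(1) by blast
  show "section_pull l m \<beta> b s k \<gamma> \<in> cells D k" if "\<gamma> \<in> ?p k" for k \<gamma>
    using that sD(1) pc by (simp add: section_pull_def)
  show "q k (section_pull l m \<beta> b s k \<gamma>) = act B k l \<gamma> (act B l m \<beta> b)" if "\<gamma> \<in> ?p k" for k \<gamma>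
    using that sD(2) pc preimD(1)[OF that] \<beta> b by (simp add: section_pull_def BD)
  show "section_pull l m \<beta> b s j (compose {..j} \<gamma> \<alpha>) = act D j k \<alpha> (section_pull l m \<beta> b s k \<gamma>)"
    if c: "\<gamma> \<in> ?p k" and a: "\<alpha> \<in> simplex_hom j k" for j k \<gamma> \<alpha>
  proof -
    have "compose {..j} \<gamma> \<alpha> \<in> ?p j"
      using subcomplexD(2)[OF subcomplex_preim[OF BD(1)[OF \<beta> b]] a c] by simp
    moreover have "compose {..j} \<beta> (compose {..j} \<gamma> \<alpha>) = compose {..j} (compose {..k} \<beta> \<gamma>) \<alpha>"
      by (simp add: simplex_hom_assoc[OF a])
    ultimately show ?thesis using c sD(3)[OF pc[OF c] a] by (simp add: section_pull_def)
  qed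
qed (auto simp: section_pull_def)

lemma simplicial_set_ext: "simplicial_set ext_sset"
  unfolding simplicial_set_def
proof (intro conjI allI ballI)
  fix l m \<beta> x assume a: "\<beta> \<in> simplex_hom l m" and x: "x \<in> cells ext_sset m"
  obtain b y s where bys: "x = (b, y, s)" by (cases x)
  note c = x[unfolded bys ext_cells_iff]
  show "act ext_sset l m \<beta> x \<in> cells ext_sset l"
    unfolding bys act_ext ext_cells_iff
  proof (intro conjI allI ballI)
    fix k \<gamma> assume k: "\<gamma> \<in> preim l (act B l m \<beta> b) k"
    then have "compose {..k} \<beta> \<gamma> \<in> preim m b k" using preim_comp_iff a c preimD(1) by blast
    then show "tr1 k (section_pull l m \<beta> b s k \<gamma>) = act D k l \<gamma> (act D l m \<beta> y)"
      using k c a preimD(1)[OF k] by (simp add: section_pull_def DD)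
  qed (use a c section_pull_sections in \<open>auto simp: BD DD qD gD\<close>)
next
  fix m x assume x: "x \<in> cells ext_sset m"
  obtain b y s where bys: "x = (b, y, s)" by (cases x)
  note c = x[unfolded bys ext_cells_iff]
  have "section_pull m m (ident m) b s = s"
  proof (rule sections_eqI)
    have "section_pull m m (ident m) b s \<in> sections m (act B m m (ident m) b)"
      using c by (intro section_pull_sections) auto
    then show "section_pull m m (ident m) b s \<in> sections m b" using c BD(2) by simp
    show "s \<in> sections m b" using c by blast
    fix l \<alpha> assume "\<alpha> \<in> preim m b l"
    then show "section_pull m m (ident m) b s l \<alpha> = s l \<alpha>"
      using c BD(2) compose_ident_left preimD(1) by (simp add: section_pull_def)
  qed
  then show "act ext_sset m m (ident m) x = x" using c by (simp add: bys act_ext BD DD)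
next
  fix k l m \<alpha> \<beta> x assume a: "\<alpha> \<in> simplex_hom k l" and b: "\<beta> \<in> simplex_hom l m" and x: "x \<in> cells ext_sset m"
  obtain b' y s where bys: "x = (b', y, s)" by (cases x)
  note c = x[unfolded bys ext_cells_iff]
  have ab: "compose {..k} \<beta> \<alpha> \<in> simplex_hom k m" using a b by (rule simplex_hom_comp)
  have "section_pull k l \<alpha> (act B l m \<beta> b') (section_pull l m \<beta> b' s) = section_pull k m (compose {..k} \<beta> \<alpha>) b' s"
  proof (rule sections_eqI)
    show "section_pull k m (compose {..k} \<beta> \<alpha>) b' s \<in> sections k (act B k m (compose {..k} \<beta> \<alpha>) b')"
      using c ab by (intro section_pull_sections) auto
    have "section_pull k l \<alpha> (act B l m \<beta> b') (section_pull l m \<beta> b' s) \<in> sections k (act B k l \<alpha> (act B l m \<beta> b'))"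
      using c a b by (intro section_pull_sections BD(1)) auto
    then show "section_pull k l \<alpha> (act B l m \<beta> b') (section_pull l m \<beta> b' s) \<in> sections k (act B k m (compose {..k} \<beta> \<alpha>) b')"
      using a b c by (simp add: BD)
    fix j \<gamma> assume j: "\<gamma> \<in> preim k (act B k m (compose {..k} \<beta> \<alpha>) b') j"
    then have j': "\<gamma> \<in> preim k (act B k l \<alpha> (act B l m \<beta> b')) j" using a b c by (simp add: BD)
    then have "compose {..j} \<alpha> \<gamma> \<in> preim l (act B l m \<beta> b') j"
      using preim_comp_iff[OF BD(1)[OF b] a preimD(1)[OF j]] c by blast
    then show "section_pull k l \<alpha> (act B l m \<beta> b') (section_pull l m \<beta> b' s) j \<gamma> = section_pull k m (compose {..k} \<beta> \<alpha>) b' s j \<gamma>"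
      using j j' simplex_hom_assoc[OF preimD(1)[OF j], of \<beta> \<alpha>] by (simp add: section_pull_def)
  qed
  then show "act ext_sset k l \<alpha> (act ext_sset l m \<beta> x) = act ext_sset k m (compose {..k} \<beta> \<alpha>) x"
    using a b c by (simp add: bys act_ext BD DD)
qed

lemma ext_proj_smaps: "ext_proj \<in> smaps ext_sset B"
  using simplicial_set_ext unfolding smaps_def ext_proj_def simplicial_set_def
  by (auto simp: ext_cells_iff act_ext)

text \<open>By \<open>smap_on_determined\<close> a section is given by its finitely many values in
  dimensions up to n, each in a fibre of q. Together with y, again an element of a fibre of q, this
  bounds a fibre of the extension by a finite product of sets below \<kappa>.\<close>

lemma small_ext:
  assumes \<kappa>: "Card_order \<kappa>" "infinite (Field \<kappa>)" and sm: "small_map \<kappa> D (restr_cells B L) q"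
  shows "small_map \<kappa> ext_sset B ext_proj"
  unfolding small_map_def
proof (intro allI ballI)
  fix n b assume b: "b \<in> cells B n"
  have fib: "|{d \<in> cells D l. q l d = x}| <o \<kappa>" if "x \<in> L l" for l x
    using sm that by (simp add: small_map_def)
  let ?G = "SIGMA l:{..n}. preim n b l"
  let ?P = "PiE ?G (\<lambda>(l, \<alpha>). {d \<in> cells D l. q l d = act B l n \<alpha> b})"
  have "finite (preim n b l)" for l by (rule finite_subset[OF _ finite_simplex_hom]) (auto simp: preim_def)
  then have "|?P| <o \<kappa>"
    using fib preimD(2) by (intro finite_PiE_ordLess[OF \<kappa>] finite_SigmaI) auto
  moreover have "|sections n b| \<le>o |?P|"
  proof (rule card_of_ordLeqI)
    let ?f = "\<lambda>s. \<lambda>(l, \<alpha>)\<in>?G. s l \<alpha>"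
    show "inj_on ?f (sections n b)"
    proof (rule inj_onI)
      fix s s' assume s: "s \<in> sections n b" "s' \<in> sections n b" and eq: "?f s = ?f s'"
      have low: "s l \<alpha> = s' l \<alpha>" if "l \<le> n" "\<alpha> \<in> preim n b l" for l \<alpha>
        using fun_cong[OF eq, of "(l, \<alpha>)"] that by simp
      have on: "smap_on (simplex n) (preim n b) D s" "smap_on (simplex n) (preim n b) D s'"
        using s by (simp_all add: sections_def lift_on_def)
      show "s = s'"
        by (rule sections_eqI[OF s]) (rule smap_on_determined[OF subcomplex_preim[OF b] on low])
    qed
    show "?f s \<in> ?P" if "s \<in> sections n b" for s
      using sectionsD(1,2)[OF that] by (intro restrict_PiE_iff[THEN iffD2]) auto
  qed
  ultimately have S: "|sections n b| <o \<kappa>" using ordLeq_ordLess_trans by blast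
  have "|{y \<in> cells D n. q n y = g n b} \<times> sections n b| <o \<kappa>"
    by (rule Times_ordLess_infinite[OF \<kappa> fib[OF gD(1)[OF b]] S])
  moreover have "|{x \<in> cells ext_sset n. ext_proj n x = b}| \<le>o |{y \<in> cells D n. q n y = g n b} \<times> sections n b|"
    by (rule card_of_ordLeqI[of snd]) (auto simp: inj_on_def ext_proj_def ext_cells_iff)
  ultimately show "|{x \<in> cells ext_sset n. ext_proj n x = b}| <o \<kappa>" using ordLeq_ordLess_trans by blast
qed

lemma preim_full: "b \<in> L m \<Longrightarrow> preim m b l = simplex_hom l m"
  using LD(2) by (auto simp: preim_def)

lemma ext_incl_proj: "d \<in> cells D n \<Longrightarrow> fst (ext_incl n d) = q n d"
  by (simp add: ext_incl_def)

text \<open>Over a cell of L the preimage is all of \<open>\<Delta>\<^sup>n\<close>, so by Yoneda a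
  section is a single element d, its value at the identity, and the gluing condition at the identity
  forces y to be \<open>tr1 n d\<close>.\<close>

lemma ext_incl_bij: "bij_betw (ext_incl n) (cells D n) {x \<in> cells ext_sset n. fst x \<in> L n}"
  unfolding bij_betw_def
proof (intro conjI set_eqI iffI inj_onI)
  fix d d' assume d: "d \<in> cells D n" "d' \<in> cells D n" and eq: "ext_incl n d = ext_incl n d'"
  have "snd (snd (ext_incl n d)) n (ident n) = snd (snd (ext_incl n d')) n (ident n)" using eq by simp
  then show "d = d'" using d DD(2) by (simp add: ext_incl_def)
next
  fix x assume "x \<in> ext_incl n ` cells D n"
  then obtain d where d: "d \<in> cells D n" "x = ext_incl n d" by blast
  have "(\<lambda>l. \<lambda>\<alpha>\<in>simplex_hom l n. act D l n \<alpha> d) \<in> sections n (q n d)"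
    by (rule sectionsI) (use d(1) in \<open>simp_all add: preim_full[OF qD(1)[OF d(1)]] DD qD simplex_hom_comp\<close>)
  then have "(q n d, tr1 n d, \<lambda>l. \<lambda>\<alpha>\<in>simplex_hom l n. act D l n \<alpha> d) \<in> cells ext_sset n"
    using d(1) LD(1)[OF qD(1)[OF d(1)]] unfolding ext_cells_iff preim_full[OF qD(1)[OF d(1)]]
    by (simp add: tr1D)
  then show "x \<in> {x \<in> cells ext_sset n. fst x \<in> L n}"
    using d qD(1)[OF d(1)] by (simp add: ext_incl_def)
next
  fix x assume x: "x \<in> {x \<in> cells ext_sset n. fst x \<in> L n}"
  obtain b y s where bys: "x = (b, y, s)" by (cases x)
  have b: "b \<in> L n" and c: "b \<in> cells B n" "y \<in> cells D n" "q n y = g n b" "s \<in> sections n b"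
    "\<And>l \<alpha>. \<alpha> \<in> preim n b l \<Longrightarrow> tr1 l (s l \<alpha>) = act D l n \<alpha> y"
    using x by (auto simp: bys ext_cells_iff)
  note sD = sectionsD[OF c(4), unfolded preim_full[OF b]]
  define d where "d = s n (ident n)"
  have d: "d \<in> cells D n" "q n d = b" "tr1 n d = y"
    using sD(1,2)[OF ident_hom] c(5)[of "ident n" n] by (simp_all add: d_def BD c DD preim_full[OF b])
  have s_eq: "s = (\<lambda>l. \<lambda>\<alpha>\<in>simplex_hom l n. act D l n \<alpha> d)"
  proof (rule ext, rule extensionalityI[OF sD(4)])
    fix l \<alpha> assume a: "\<alpha> \<in> simplex_hom l n"
    show "s l \<alpha> = (\<lambda>\<alpha>\<in>simplex_hom l n. act D l n \<alpha> d) \<alpha>"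
      using sD(3)[OF ident_hom a] a by (simp add: d_def compose_ident_left)
  qed auto
  have "x = ext_incl n d" unfolding bys ext_incl_def s_eq using d by simp
  then show "x \<in> ext_incl n ` cells D n" using d by blast
qed

lemma ext_incl_act:
  assumes "\<alpha> \<in> simplex_hom m n" "d \<in> cells D n"
  shows "ext_incl m (act D m n \<alpha> d) = act ext_sset m n \<alpha> (ext_incl n d)"
proof -
  have "act B m n \<alpha> (q n d) \<in> L m" using assms LD(2) qD(1) by blast
  then show ?thesis
    using assms by (auto simp: ext_incl_def act_ext DD qD tr1D section_pull_def preim_full simplex_hom_comp fun_eq_iff)
qed

lemma ext_incl_smaps: "ext_incl \<in> smaps D ext_sset"
proof -
  have "ext_incl n d \<in> cells ext_sset n" if "d \<in> cells D n" for n d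
    using ext_incl_bij[of n] that by (auto simp: bij_betw_def)
  then show ?thesis unfolding smaps_def using ext_incl_act by (auto simp: ext_incl_def)
qed

lemma kan_ext: "kan_fibration ext_sset B ext_proj"
proof (rule kan_fibrationI[OF simplicial_set_ext B ext_proj_smaps])
  fix m k v f
  assume mk: "1 \<le> m" "k \<le> m" and v: "smap_on (simplex m) (cells (simplex m)) B v"
    and f: "lift_on (simplex m) (cells (horn m k)) ext_sset ext_proj v f"
  let ?H = "cells (horn m k)" and ?A = "restr_cells B L"
  define b where "b = v m (ident m)"
  have b: "b \<in> cells B m" using smap_onD(1)[OF v, of "ident m" m] by (simp add: b_def)
  have vb: "v l \<alpha> = act B l m \<alpha> b" if "\<alpha> \<in> simplex_hom l m" for l \<alpha>
    using smap_onD(2)[OF v, of \<alpha> l m "ident m"] that by (simp add: b_def compose_ident_left)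
  let ?T = "preim m b"
  have ba: "act B l m \<alpha> b \<in> cells B l" if "\<alpha> \<in> simplex_hom l m" for l \<alpha> using BD(1) that b by blast
  have bac: "act B j m (compose {..j} \<alpha> \<gamma>) b = act B j l \<gamma> (act B l m \<alpha> b)"
    if "\<alpha> \<in> simplex_hom l m" "\<gamma> \<in> simplex_hom j l" for j l \<alpha> \<gamma> using BD(3) that b by simp
  have Hh: "\<alpha> \<in> simplex_hom l m" if "\<alpha> \<in> ?H l" for l \<alpha> using horn_cell[OF that] by simp
  have Hc: "compose {..j} \<alpha> \<gamma> \<in> ?H j" if "\<alpha> \<in> ?H l" "\<gamma> \<in> simplex_hom j l" for j l \<alpha> \<gamma> using horn_act that by blast
  have Tc: "compose {..j} \<alpha> \<gamma> \<in> ?T j" if "\<alpha> \<in> ?T l" "\<gamma> \<in> simplex_hom j l" for j l \<alpha> \<gamma>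
    using subcomplexD(2)[OF subcomplex_preim[OF b]] that by simp
  note Th = preimD(1)[of _ m b]
  note TL = preimD(2)[of _ m b]
  define y where "y l \<alpha> = fst (snd (f l \<alpha>))" for l \<alpha>
  define s where "s l \<alpha> = snd (snd (f l \<alpha>))" for l \<alpha>
  \<comment> \<open>Each cell of the horn carries its own section. Simpliciality makes them
    restrictions of one section d over the part of the horn inside \<open>preim m b\<close>, whose
    value at \<alpha> is read off at the identity; \<open>s_d\<close> recovers the individual
    sections.\<close>
  define d where "d l \<alpha> = s l \<alpha> l (ident l)" for l \<alpha>
  have f_eq: "f l \<alpha> = (act B l m \<alpha> b, y l \<alpha>, s l \<alpha>)" if "\<alpha> \<in> ?H l" for l \<alpha>
    using lift_onD(1,3)[OF f that] vb[OF Hh[OF that]] by (simp add: ext_proj_def y_def s_def prod_eq_iff)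
  have fc: "y l \<alpha> \<in> cells D l \<and> q l (y l \<alpha>) = g l (act B l m \<alpha> b) \<and> s l \<alpha> \<in> sections l (act B l m \<alpha> b) \<and>
     (\<forall>j. \<forall>\<gamma> \<in> preim l (act B l m \<alpha> b) j. tr1 j (s l \<alpha> j \<gamma>) = act D j l \<gamma> (y l \<alpha>))" if "\<alpha> \<in> ?H l" for l \<alpha>
    using lift_onD(1)[OF f that] unfolding f_eq[OF that] ext_cells_iff by blast
  have f_act: "y j (compose {..j} \<alpha> \<gamma>) = act D j l \<gamma> (y l \<alpha>) \<and>
     s j (compose {..j} \<alpha> \<gamma>) = section_pull j l \<gamma> (act B l m \<alpha> b) (s l \<alpha>)"
    if "\<alpha> \<in> ?H l" "\<gamma> \<in> simplex_hom j l" for j l \<alpha> \<gamma>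
    using lift_onD(2)[OF f that(2,1)] f_eq[OF that(1)] f_eq[OF Hc[OF that]] by (simp add: act_ext)
  have s_d: "s l \<alpha> j \<gamma> = d j (compose {..j} \<alpha> \<gamma>)" if a: "\<alpha> \<in> ?H l" and c: "\<gamma> \<in> preim l (act B l m \<alpha> b) j" for j l \<alpha> \<gamma>
  proof -
    have c': "\<gamma> \<in> simplex_hom j l" using c preimD(1) by blast
    have "ident j \<in> preim j (act B j l \<gamma> (act B l m \<alpha> b)) j"
      using c preimD(2)[OF c] c' BD(1) BD(2) ba[OF Hh[OF a]] by (simp add: preim_def)
    then show ?thesis
      using f_act[OF a c'] compose_ident_right[OF c'] by (simp add: d_def section_pull_def)
  qed
  have idT: "ident l \<in> preim l (act B l m \<alpha> b) l" if "\<alpha> \<in> ?T l" for l \<alpha>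
    using TL[OF that] BD(2) ba[OF Th[OF that]] by (simp add: preim_def)
  have dD: "d l \<alpha> \<in> cells D l" "q l (d l \<alpha>) = act B l m \<alpha> b" "tr1 l (d l \<alpha>) = y l \<alpha>"
    if "\<alpha> \<in> ?H l" "\<alpha> \<in> ?T l" for l \<alpha>
  proof -
    have sec: "s l \<alpha> \<in> sections l (act B l m \<alpha> b)" using fc[OF that(1)] by blast
    note i = idT[OF that(2)]
    show "d l \<alpha> \<in> cells D l" unfolding d_def by (rule sectionsD(1)[OF sec i])
    show "q l (d l \<alpha>) = act B l m \<alpha> b"
      unfolding d_def using sectionsD(2)[OF sec i] BD(2)[OF ba[OF Hh[OF that(1)]]] by simp
    show "tr1 l (d l \<alpha>) = y l \<alpha>"
      unfolding d_def using fc[OF that(1)] i DD(2)[of "y l \<alpha>" l] by simp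
  qed
  have d_act: "d j (compose {..j} \<alpha> \<gamma>) = act D j l \<gamma> (d l \<alpha>)"
    if "\<alpha> \<in> ?H l" "\<alpha> \<in> ?T l" "\<gamma> \<in> simplex_hom j l" for j l \<alpha> \<gamma>
  proof -
    have c: "\<gamma> \<in> preim l (act B l m \<alpha> b) j"
      using preim_comp_iff[OF b Hh[OF that(1)] that(3)] Tc[OF that(2,3)] by simp
    have "d j (compose {..j} \<alpha> \<gamma>) = s l \<alpha> j (compose {..j} (ident l) \<gamma>)"
      using s_d[OF that(1) c] compose_ident_left[OF that(3)] by simp
    also have "\<dots> = act D j l \<gamma> (d l \<alpha>)"
      unfolding d_def using sectionsD(3)[OF _ idT[OF that(2)] that(3)] fc[OF that(1)] by blast
    finally show ?thesis .
  qed

  have hact: "h j (act B j m (compose {..j} \<alpha> \<gamma>) b, compose {..j} \<tau> \<gamma>) = act B j l \<gamma> (h l (act B l m \<alpha> b, \<tau>))"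
    if "\<gamma> \<in> simplex_hom j l" "\<alpha> \<in> ?T l" "\<tau> \<in> simplex_hom l 1" for j l \<alpha> \<tau> \<gamma>
    using hD(2)[OF that(1) TL[OF that(2)] that(3)] bac[OF Th[OF that(2)] that(1)] by simp
  have gact: "g j (act B j m (compose {..j} \<alpha> \<gamma>) b) = act B j l \<gamma> (g l (act B l m \<alpha> b))"
    if "\<gamma> \<in> simplex_hom j l" "\<alpha> \<in> simplex_hom l m" for j l \<alpha> \<gamma>
    using gD(2)[OF that(1) ba[OF that(2)]] bac[OF that(2,1)] by simp

  txt \<open>
    The given horn is a horn \<open>y\<close> in \<open>D\<close> over \<open>g b\<close> with a partial section \<open>d\<close> on \<open>T \<inter> H\<close>.
    Fill \<open>y\<close> arbitrarily, to \<open>yb\<close>.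
  \<close>
  have "lift_on (simplex m) ?H D q (\<lambda>l \<alpha>. g l (act B l m \<alpha> b)) y"
    using fc f_act by (intro lift_onI) auto
  moreover have "smap_on (simplex m) (cells (simplex m)) ?A (\<lambda>l \<alpha>. g l (act B l m \<alpha> b))"
    using ba by (intro smap_onI) (simp_all add: gD(1) gact)
  ultimately obtain yb where yb: "lift_on (simplex m) (cells (simplex m)) D q (\<lambda>l \<alpha>. g l (act B l m \<alpha> b)) yb"
    and yb_H: "\<And>l \<alpha>. \<alpha> \<in> ?H l \<Longrightarrow> yb l \<alpha> = y l \<alpha>"
    using lift_extD[OF kan_lift_ext[OF kan mk]] by blast
  note ybD = lift_onD[OF yb, simplified]

  txt \<open>
    Lift the homotopy \<open>h\<close> over \<open>T\<close> starting from \<open>yb\<close>, relative to \<open>T \<inter> H\<close>, where the lift is the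
    transport of \<open>d\<close>.  The other end \<open>db\<close> of the lift \<open>sb\<close> extends \<open>d\<close> to \<open>T\<close>.
  \<close>
  let ?Q = "restr_cells (simplex m) ?T"
  have Q: "simplicial_set ?Q"
    by (rule simplicial_set_restr_cells[OF simplicial_set_simplex subcomplex_preim[OF b]])
  have vQ: "smap_on (cyl ?Q) (cells (cyl ?Q)) ?A (\<lambda>l w. h l (act B l m (fst w) b, snd w))"
  proof (rule smap_onI)
    fix j l \<gamma> w assume "\<gamma> \<in> simplex_hom j l" "w \<in> cells (cyl ?Q) l"
    then show "h j (act B j m (fst (act (cyl ?Q) j l \<gamma> w)) b, snd (act (cyl ?Q) j l \<gamma> w)) =
        act ?A j l \<gamma> (h l (act B l m (fst w) b, snd w))"
      using hact by (cases w) simp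
  qed (auto simp: hD TL)
  have sub1: "subcomplex ?Q (\<lambda>l. ?T l \<inter> ?H l)"
    using Hc Tc by (intro subcomplexI) auto
  have f0: "lift_on ?Q (cells ?Q) D q (\<lambda>l \<alpha>. h l (act B l m (fst (\<alpha>, endpt e l)) b, snd (\<alpha>, endpt e l))) yb"
    using ybD Th by (intro lift_onI) (auto simp: he TL)
  have f1: "lift_on (cyl ?Q) (\<lambda>l. (?T l \<inter> ?H l) \<times> simplex_hom l 1) D q (\<lambda>l w. h l (act B l m (fst w) b, snd w))
      (\<lambda>l w. tr l (d l (fst w), snd w))"
    using dD d_act by (intro lift_onI) (auto simp: trD)
  have compat1: "tr l (d l (fst (\<alpha>, endpt e l)), snd (\<alpha>, endpt e l)) = yb l \<alpha>" if "\<alpha> \<in> ?T l \<inter> ?H l" for l \<alpha>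
    using that dD(3) yb_H by (simp add: tr1_def)
  obtain sb where sb: "lift_on (cyl ?Q) (cells (cyl ?Q)) D q (\<lambda>l w. h l (act B l m (fst w) b, snd w)) sb"
    and sb_e: "\<And>l \<alpha>. \<alpha> \<in> ?T l \<Longrightarrow> sb l (\<alpha>, endpt e l) = yb l \<alpha>"
    and sb_H: "\<And>l \<alpha> \<tau>. \<alpha> \<in> ?T l \<Longrightarrow> \<alpha> \<in> ?H l \<Longrightarrow> \<tau> \<in> simplex_hom l 1 \<Longrightarrow> sb l (\<alpha>, \<tau>) = tr l (d l \<alpha>, \<tau>)"
    by (rule homotopy_lifting[OF kan e(1) Q sub1 vQ f0 f1 compat1]) auto
  have sbD: "sb l (\<alpha>, \<tau>) \<in> cells D l" "q l (sb l (\<alpha>, \<tau>)) = h l (act B l m \<alpha> b, \<tau>)"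
    "\<gamma> \<in> simplex_hom j l \<Longrightarrow> sb j (compose {..j} \<alpha> \<gamma>, compose {..j} \<tau> \<gamma>) = act D j l \<gamma> (sb l (\<alpha>, \<tau>))"
    if "\<alpha> \<in> ?T l" "\<tau> \<in> simplex_hom l 1" for j l \<alpha> \<tau> \<gamma>
    using lift_onD(1,3)[OF sb, of "(\<alpha>, \<tau>)" l] lift_onD(2)[OF sb, of \<gamma> j l "(\<alpha>, \<tau>)"] that by simp_all
  define db where "db l \<alpha> = sb l (\<alpha>, endpt e' l)" for l \<alpha>
  have dbD: "db l \<alpha> \<in> cells D l" "q l (db l \<alpha>) = act B l m \<alpha> b"
    "\<gamma> \<in> simplex_hom j l \<Longrightarrow> db j (compose {..j} \<alpha> \<gamma>) = act D j l \<gamma> (db l \<alpha>)"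
    if "\<alpha> \<in> ?T l" for j l \<alpha> \<gamma>
    using sbD[OF that endpt_hom[OF e(2)]] he' TL[OF that] by (simp_all add: db_def compose_endpt)
  have db_H: "db l \<alpha> = d l \<alpha>" if "\<alpha> \<in> ?T l" "\<alpha> \<in> ?H l" for l \<alpha>
    using sb_H[OF that endpt_hom[OF e(2)]] dD(1)[OF that(2,1)] by (simp add: db_def trD)

  txt \<open>
    \<open>sb\<close> and the transport of \<open>db\<close> are two lifts of \<open>h\<close> with the same end \<open>db\<close>, hence homotopic relative
    to \<open>T \<inter> H\<close>.  At the other end this gives a homotopy \<open>K\<close> from \<open>yb\<close> to \<open>tr1 db\<close>.
  \<close>
  let ?Q2 = "cyl ?Q"
  let ?A2 = "\<lambda>l. {(\<alpha>, \<rho>) \<in> ?T l \<times> simplex_hom l 1. \<rho> = endpt 0 l \<or> \<rho> = endpt 1 l \<or> \<alpha> \<in> ?H l}"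
  let ?v2 = "\<lambda>l w. h l (act B l m (fst (fst w)) b, snd w)"
  \<comment> \<open>Where \<alpha> lies in the horn, sb is the transport of d and db equals d, so
    both branches agree. Testing only \<open>\<rho> = endpt 0 l\<close> is therefore harmless for
    the intermediate \<rho> that are allowed there.\<close>
  let ?f2 = "\<lambda>l w. if snd (fst w) = endpt 0 l then sb l (fst (fst w), snd w) else tr l (db l (fst (fst w)), snd w)"
  have sub2: "subcomplex ?Q2 ?A2"
    using Hc Tc by (intro subcomplexI) (auto simp: compose_endpt simplex_hom_comp intro: endpt_hom)
  have v2: "smap_on (cyl ?Q2) (cells (cyl ?Q2)) ?A ?v2"
  proof (rule smap_onI)
    fix j l \<gamma> w assume c: "\<gamma> \<in> simplex_hom j l" "w \<in> cells (cyl ?Q2) l"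
    obtain \<alpha> \<rho> \<sigma> where "w = ((\<alpha>, \<rho>), \<sigma>)" by (cases w) auto
    then show "?v2 j (act (cyl ?Q2) j l \<gamma> w) = act ?A j l \<gamma> (?v2 l w)"
      using hact c by simp
  qed (auto simp: hD TL)
  have f02: "lift_on ?Q2 (cells ?Q2) D q (\<lambda>l w. ?v2 l (w, endpt e' l)) (\<lambda>l w. db l (fst w))"
    using dbD by (intro lift_onI) (auto simp: he' TL)
  have f2_act: "?f2 j (act (cyl ?Q2) j l \<gamma> ((\<alpha>, \<rho>), \<sigma>)) = act D j l \<gamma> (?f2 l ((\<alpha>, \<rho>), \<sigma>))"
    if c: "\<gamma> \<in> simplex_hom j l" and a: "\<alpha> \<in> ?T l" and s: "\<sigma> \<in> simplex_hom l 1"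
      and r: "\<rho> = endpt 0 l \<or> \<rho> = endpt 1 l \<or> \<alpha> \<in> ?H l" for j l \<gamma> \<alpha> \<rho> \<sigma>
  proof (cases "\<alpha> \<in> ?H l")
    case True
    have "?f2 l ((\<alpha>, \<rho>), \<sigma>) = tr l (d l \<alpha>, \<sigma>)" using True a s sb_H db_H by simp
    moreover have "?f2 j (act (cyl ?Q2) j l \<gamma> ((\<alpha>, \<rho>), \<sigma>)) = tr j (d j (compose {..j} \<alpha> \<gamma>), compose {..j} \<sigma> \<gamma>)"
      using True a s sb_H db_H Hc[OF True c] Tc[OF a c] simplex_hom_comp[OF c s] by simp
    ultimately show ?thesis using d_act[OF True a c] trD(3)[OF c dD(1)[OF True a] s] by simp
  next
    case False
    have "endpt 1 l \<noteq> endpt 0 l" "endpt 1 j \<noteq> endpt 0 j" by (simp_all add: endpt_eq_iff)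
    then show ?thesis using False r c a s sbD(3)[OF a s c] dbD(1)[OF a] dbD(3)[OF a c] trD(3)[OF c dbD(1)[OF a] s]
      by (auto simp: compose_endpt[OF c])
  qed
  have f12: "lift_on (cyl ?Q2) (\<lambda>l. ?A2 l \<times> simplex_hom l 1) D q ?v2 ?f2"
  proof (rule lift_onI)
    fix l w assume "w \<in> ?A2 l \<times> simplex_hom l 1"
    then show "?f2 l w \<in> cells D l" "q l (?f2 l w) = ?v2 l w"
      using sbD(1,2) dbD(1,2) by (auto simp: trD)
  next
    fix j l \<gamma> w assume "\<gamma> \<in> simplex_hom j l" "w \<in> ?A2 l \<times> simplex_hom l 1"
    then show "?f2 j (act (cyl ?Q2) j l \<gamma> w) = act D j l \<gamma> (?f2 l w)"
      using f2_act by (cases w) blast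
  qed
  have compat2: "?f2 l (w, endpt e' l) = db l (fst w)" if "w \<in> ?A2 l" for l w
    using that dbD(1) by (auto simp: trD db_def[symmetric])
  obtain N where N: "lift_on (cyl ?Q2) (cells (cyl ?Q2)) D q ?v2 N"
    and N_A: "\<And>l w \<sigma>. w \<in> ?A2 l \<Longrightarrow> \<sigma> \<in> simplex_hom l 1 \<Longrightarrow> N l (w, \<sigma>) = ?f2 l (w, \<sigma>)"
    by (rule homotopy_lifting[OF kan e(2) simplicial_set_cyl[OF Q] sub2 v2 f02 f12 compat2]) auto
  define K where "K l \<alpha> \<rho> = N l ((\<alpha>, \<rho>), endpt e l)" for l \<alpha> \<rho>
  have KD: "K l \<alpha> \<rho> \<in> cells D l" "q l (K l \<alpha> \<rho>) = g l (act B l m \<alpha> b)"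
    "\<gamma> \<in> simplex_hom j l \<Longrightarrow> K j (compose {..j} \<alpha> \<gamma>) (compose {..j} \<rho> \<gamma>) = act D j l \<gamma> (K l \<alpha> \<rho>)"
    if "\<alpha> \<in> ?T l" "\<rho> \<in> simplex_hom l 1" for j l \<alpha> \<rho> \<gamma>
    using lift_onD(1,3)[OF N, of "((\<alpha>, \<rho>), endpt e l)" l]
      lift_onD(2)[OF N, of \<gamma> j l "((\<alpha>, \<rho>), endpt e l)"] that he TL[OF that(1)] endpt_hom[OF e(1)]
    by (simp_all add: K_def compose_endpt)
  have K0: "K l \<alpha> (endpt 0 l) = yb l \<alpha>" if "\<alpha> \<in> ?T l" for l \<alpha>
    using N_A[of "(\<alpha>, endpt 0 l)" l "endpt e l"] that endpt_hom[OF e(1)] endpt_hom[of 0 1 l] sb_e by (simp add: K_def)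
  have K1: "K l \<alpha> (endpt 1 l) = tr1 l (db l \<alpha>)" if "\<alpha> \<in> ?T l" for l \<alpha>
    using N_A[of "(\<alpha>, endpt 1 l)" l "endpt e l"] that endpt_hom[OF e(1)] endpt_hom[of 1 1 l]
    by (simp add: K_def endpt_eq_iff tr1_def)
  have KH: "K l \<alpha> \<rho> = y l \<alpha>" if "\<alpha> \<in> ?T l" "\<alpha> \<in> ?H l" "\<rho> \<in> simplex_hom l 1" for l \<alpha> \<rho>
    using N_A[of "(\<alpha>, \<rho>)" l "endpt e l"] that endpt_hom[OF e(1)] sb_e yb_H db_H dD(3) by (simp add: K_def tr1_def)

  txt \<open>
    Extend \<open>K\<close>, constant on \<open>H\<close>, to a homotopy starting from \<open>yb\<close>; its other end \<open>yh\<close> agrees with \<open>y\<close> on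
    \<open>H\<close> and with \<open>tr1 db\<close> on \<open>T\<close>.
  \<close>
  let ?f4 = "\<lambda>l w. if fst w \<in> ?T l then K l (fst w) (snd w) else y l (fst w)"
  have sub4: "subcomplex (simplex m) (\<lambda>l. ?T l \<union> ?H l)"
    using Hc Tc Hh Th by (intro subcomplexI) auto
  have v4: "smap_on (cyl (simplex m)) (cells (cyl (simplex m))) ?A (\<lambda>l w. g l (act B l m (fst w) b))"
    using ba by (intro smap_onI) (auto simp: gD(1) gact)
  have f04: "lift_on (simplex m) (cells (simplex m)) D q (\<lambda>l \<alpha>. g l (act B l m (fst (\<alpha>, endpt 0 l)) b)) yb"
    using yb by simp
  \<comment> \<open>A cell of H outside T may have faces in T. There K is constantly y by
    \<open>KH\<close>, so the case distinction is compatible with the action.\<close>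
  have f4_act: "?f4 j (act (cyl (simplex m)) j l \<gamma> (\<alpha>, \<rho>)) = act D j l \<gamma> (?f4 l (\<alpha>, \<rho>))"
    if c: "\<gamma> \<in> simplex_hom j l" and a: "\<alpha> \<in> ?T l \<union> ?H l" and r: "\<rho> \<in> simplex_hom l 1" for j l \<gamma> \<alpha> \<rho>
  proof (cases "\<alpha> \<in> ?T l")
    case True
    then show ?thesis using Tc[OF True c] KD(3)[OF True r c] by simp
  next
    case False
    then have H: "\<alpha> \<in> ?H l" using a by blast
    show ?thesis using False KH[OF _ Hc[OF H c] simplex_hom_comp[OF c r]] f_act[OF H c] by simp
  qed
  have f14: "lift_on (cyl (simplex m)) (\<lambda>l. (?T l \<union> ?H l) \<times> simplex_hom l 1) D q (\<lambda>l w. g l (act B l m (fst w) b)) ?f4"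
  proof (rule lift_onI)
    fix j l \<gamma> w assume "\<gamma> \<in> simplex_hom j l" "w \<in> (?T l \<union> ?H l) \<times> simplex_hom l 1"
    then show "?f4 j (act (cyl (simplex m)) j l \<gamma> w) = act D j l \<gamma> (?f4 l w)"
      using f4_act by (cases w) blast
  qed (use KD(1,2) fc in auto)
  have compat4: "?f4 l (\<alpha>, endpt 0 l) = yb l \<alpha>" if "\<alpha> \<in> ?T l \<union> ?H l" for l \<alpha>
    using that K0 yb_H by auto
  obtain R where R: "lift_on (cyl (simplex m)) (cells (cyl (simplex m))) D q (\<lambda>l w. g l (act B l m (fst w) b)) R"
    and R_A: "\<And>l \<alpha> \<rho>. \<alpha> \<in> ?T l \<union> ?H l \<Longrightarrow> \<rho> \<in> simplex_hom l 1 \<Longrightarrow> R l (\<alpha>, \<rho>) = ?f4 l (\<alpha>, \<rho>)"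
    by (rule homotopy_lifting[OF kan le0 simplicial_set_simplex sub4 v4 f04 f14 compat4]) auto
  define yh where "yh l \<alpha> = R l (\<alpha>, endpt 1 l)" for l \<alpha>
  have yhD: "yh l \<alpha> \<in> cells D l" "q l (yh l \<alpha>) = g l (act B l m \<alpha> b)"
    "\<gamma> \<in> simplex_hom j l \<Longrightarrow> yh j (compose {..j} \<alpha> \<gamma>) = act D j l \<gamma> (yh l \<alpha>)"
    if "\<alpha> \<in> simplex_hom l m" for j l \<alpha> \<gamma>
    using lift_onD(1,3)[OF R, of "(\<alpha>, endpt 1 l)" l]
      lift_onD(2)[OF R, of \<gamma> j l "(\<alpha>, endpt 1 l)"] that endpt_hom[of 1 1 l] by (simp_all add: yh_def compose_endpt)
  have yh_T: "yh l \<alpha> = tr1 l (db l \<alpha>)" if "\<alpha> \<in> ?T l" for l \<alpha>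
    using R_A[of \<alpha> l "endpt 1 l"] that K1 endpt_hom[of 1 1 l] by (simp add: yh_def)
  have yh_H: "yh l \<alpha> = y l \<alpha>" if "\<alpha> \<in> ?H l" for l \<alpha>
    using R_A[of \<alpha> l "endpt 1 l"] that KH endpt_hom[of 1 1 l] by (simp add: yh_def)

  \<comment> \<open>Reassembly: over \<alpha> the filler consists of \<open>yh\<close> and the
    section db pulled back along \<alpha>. The gluing condition is \<open>yh_T\<close>; agreement
    with the given horn is \<open>yh_H\<close> together with \<open>db_H\<close>.\<close>
  define ss where "ss l \<alpha> = (\<lambda>j. \<lambda>\<gamma>\<in>preim l (act B l m \<alpha> b) j. db j (compose {..j} \<alpha> \<gamma>))" for l \<alpha>
  define F where "F l \<alpha> = (act B l m \<alpha> b, yh l \<alpha>, ss l \<alpha>)" for l \<alpha>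
  have aT: "compose {..j} \<alpha> \<gamma> \<in> ?T j" if "\<alpha> \<in> simplex_hom l m" "\<gamma> \<in> preim l (act B l m \<alpha> b) j" for l j \<alpha> \<gamma>
    using preim_comp_iff[OF b that(1)] that(2) preimD(1) by blast
  have ss: "ss l \<alpha> \<in> sections l (act B l m \<alpha> b)" if a: "\<alpha> \<in> simplex_hom l m" for l \<alpha>
  proof (rule sectionsI)
    let ?p = "preim l (act B l m \<alpha> b)"
    show "ss l \<alpha> j \<gamma> \<in> cells D j" "q j (ss l \<alpha> j \<gamma>) = act B j l \<gamma> (act B l m \<alpha> b)" if "\<gamma> \<in> ?p j" for j \<gamma>
      using that dbD(1,2)[OF aT[OF a that]] bac[OF a preimD(1)[OF that]] by (simp_all add: ss_def)
    show "ss l \<alpha> i (compose {..i} \<gamma> \<beta>) = act D i j \<beta> (ss l \<alpha> j \<gamma>)"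
      if c: "\<gamma> \<in> ?p j" and \<beta>: "\<beta> \<in> simplex_hom i j" for i j \<gamma> \<beta>
    proof -
      have "compose {..i} \<gamma> \<beta> \<in> ?p i"
        using subcomplexD(2)[OF subcomplex_preim[OF ba[OF a]] \<beta> c] by simp
      then show ?thesis
        using c dbD(3)[OF aT[OF a c] \<beta>] simplex_hom_assoc[OF \<beta>, of \<alpha> \<gamma>] by (simp add: ss_def)
    qed
  qed (auto simp: ss_def)
  have Fc: "F l \<alpha> \<in> cells ext_sset l" if a: "\<alpha> \<in> simplex_hom l m" for l \<alpha>
    unfolding F_def ext_cells_iff
  proof (intro conjI allI ballI)
    fix j \<gamma> assume c: "\<gamma> \<in> preim l (act B l m \<alpha> b) j"
    then show "tr1 j (ss l \<alpha> j \<gamma>) = act D j l \<gamma> (yh l \<alpha>)"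
      using yh_T[OF aT[OF a c]] yhD(3)[OF a preimD(1)[OF c]] by (simp add: ss_def)
  qed (use ba yhD ss a in auto)
  have "lift_on (simplex m) (cells (simplex m)) ext_sset ext_proj v F"
  proof (rule lift_onI)
    fix l \<alpha> assume "\<alpha> \<in> cells (simplex m) l"
    then show "F l \<alpha> \<in> cells ext_sset l" "ext_proj l (F l \<alpha>) = v l \<alpha>"
      using Fc vb by (auto simp: ext_proj_def) (auto simp: F_def)
  next
    fix j l \<gamma> \<alpha> assume c: "\<gamma> \<in> simplex_hom j l" and "\<alpha> \<in> cells (simplex m) l"
    then have a: "\<alpha> \<in> simplex_hom l m" by simp
    have "ss j (compose {..j} \<alpha> \<gamma>) = section_pull j l \<gamma> (act B l m \<alpha> b) (ss l \<alpha>)"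
    proof (rule sections_eqI)
      show "ss j (compose {..j} \<alpha> \<gamma>) \<in> sections j (act B j l \<gamma> (act B l m \<alpha> b))"
        using ss[OF simplex_hom_comp[OF c a]] bac[OF a c] by simp
      show "section_pull j l \<gamma> (act B l m \<alpha> b) (ss l \<alpha>) \<in> sections j (act B j l \<gamma> (act B l m \<alpha> b))"
        by (rule section_pull_sections[OF ba[OF a] ss[OF a] c])
      fix i \<beta> assume \<beta>: "\<beta> \<in> preim j (act B j l \<gamma> (act B l m \<alpha> b)) i"
      have "compose {..i} \<gamma> \<beta> \<in> preim l (act B l m \<alpha> b) i"
        using preim_comp_iff[OF ba[OF a] c preimD(1)[OF \<beta>]] \<beta> by simp
      then show "ss j (compose {..j} \<alpha> \<gamma>) i \<beta> = section_pull j l \<gamma> (act B l m \<alpha> b) (ss l \<alpha>) i \<beta>"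
        using \<beta> bac[OF a c] simplex_hom_assoc[OF preimD(1)[OF \<beta>], of \<alpha> \<gamma>] by (simp add: ss_def section_pull_def)
    qed
    then show "F j (act (simplex m) j l \<gamma> \<alpha>) = act ext_sset j l \<gamma> (F l \<alpha>)"
      using yhD(3)[OF a c] bac[OF a c] by (simp add: F_def act_ext)
  qed
  moreover have "F l \<alpha> = f l \<alpha>" if H: "\<alpha> \<in> ?H l" for l \<alpha>
  proof -
    have "ss l \<alpha> = s l \<alpha>"
    proof (rule sections_eqI[OF ss[OF Hh[OF H]]])
      show "s l \<alpha> \<in> sections l (act B l m \<alpha> b)" using fc[OF H] by blast
      fix j \<gamma> assume c: "\<gamma> \<in> preim l (act B l m \<alpha> b) j"
      then show "ss l \<alpha> j \<gamma> = s l \<alpha> j \<gamma>"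
        using s_d[OF H c] db_H[OF aT[OF Hh[OF H] c] Hc[OF H preimD(1)[OF c]]] by (simp add: ss_def)
    qed
    then show ?thesis using yh_H[OF H] f_eq[OF H] by (simp add: F_def)
  qed
  ultimately show "\<exists>f'. lift_on (simplex m) (cells (simplex m)) ext_sset ext_proj v f' \<and>
      (\<forall>l. \<forall>w\<in>?H l. f' l w = f l w)" by blast
qed

end

section \<open>The horn as a homotopy retract of the simplex\<close>

lemma restr_cells_horn: "restr_cells (simplex N) (cells (horn N k)) = horn N k"
  by (simp add: horn_def simplex_def)

lemma horn_iff: "x \<in> cells (horn N k) m \<longleftrightarrow> x \<in> simplex_hom m N \<and> (\<exists>i\<le>N. i \<noteq> k \<and> (\<forall>t\<le>m. x t \<noteq> i))"
proof -
  have "i \<notin> x ` {..m} \<longleftrightarrow> (\<forall>t\<le>m. x t \<noteq> i)" for i by auto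
  then show ?thesis unfolding horn_def by auto
qed

text \<open>
  \<open>\<Lambda>\<^sup>N\<^sub>k\<close> is a homotopy retract of \<open>\<Delta>\<^sup>N\<close>: for \<open>k < N\<close> through \<open>i \<mapsto> min i k\<close>, which misses \<open>N\<close> and
  lies below the identity, and for \<open>k = N\<close> through \<open>i \<mapsto> max i k\<close>.
\<close>

lemma horn_homotopy_retract:
  assumes N: "1 \<le> N" "k \<le> N"
  obtains g h e e' where "smap_on (simplex N) (cells (simplex N)) (horn N k) g"
    "smap_on (cyl (horn N k)) (cells (cyl (horn N k))) (horn N k) h" "e \<le> 1" "e' \<le> 1"
    "\<And>n x. x \<in> cells (horn N k) n \<Longrightarrow> h n (x, endpt e n) = g n x"
    "\<And>n x. x \<in> cells (horn N k) n \<Longrightarrow> h n (x, endpt e' n) = x"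
proof -
  define mm :: "nat \<Rightarrow> nat" where "mm i = (if k < N then min i k else max i k)" for i
  \<comment> \<open>Monotonicity of the homotopy dictates the ends: a map below the identity must
    sit at 0, one above it at 1.\<close>
  define e e' :: nat where "e = (if k < N then 0 else 1)" and "e' = 1 - e"
  define g where "g m x = (\<lambda>t\<in>{..m}. mm (x t))" for m :: nat and x :: "nat \<Rightarrow> nat"
  define h where "h m w = (\<lambda>t\<in>{..m}. if snd w t = e then mm (fst w t) else fst w t)"
    for m :: nat and w :: "(nat \<Rightarrow> nat) \<times> (nat \<Rightarrow> nat)"
  have e: "e \<le> 1" "e' \<le> 1" "e \<noteq> e'" by (auto simp: e_def e'_def)
  \<comment> \<open>Each vertex either stays or moves to k. A cell that misses a vertex other than k
    still misses it afterwards, which keeps the homotopy inside the horn.\<close>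
  have mm: "i \<le> j \<Longrightarrow> mm i \<le> mm j" "i \<le> N \<Longrightarrow> mm i \<le> N" "mm i = i \<or> mm i = k" for i j
    using N by (auto simp: mm_def min_def max_def)
  have g: "g m x \<in> cells (horn N k) m" if x: "x \<in> simplex_hom m N" for m x
    unfolding horn_iff
  proof
    note D = simplex_homD[OF x]
    show "g m x \<in> simplex_hom m N"
      unfolding g_def using D mm by (intro simplex_hom_restrictI) auto
    show "\<exists>i\<le>N. i \<noteq> k \<and> (\<forall>t\<le>m. g m x t \<noteq> i)"
    proof (cases "k < N")
      case True then show ?thesis by (intro exI[of _ N]) (auto simp: g_def mm_def)
    next
      case False then show ?thesis using N by (intro exI[of _ 0]) (auto simp: g_def mm_def)
    qed
  qed
  have h: "h m (x, \<tau>) \<in> cells (horn N k) m" if x: "x \<in> cells (horn N k) m" and \<tau>: "\<tau> \<in> simplex_hom m 1" for m x \<tau>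
    unfolding horn_iff
  proof
    have xh: "x \<in> simplex_hom m N" using x by (simp add: horn_iff)
    note D = simplex_homD[OF xh] and T = simplex_homD[OF \<tau>]
    show "h m (x, \<tau>) \<in> simplex_hom m N"
      unfolding h_def
    proof (rule simplex_hom_restrictI)
      fix i assume "i \<le> m"
      then show "(if snd (x, \<tau>) i = e then mm (fst (x, \<tau>) i) else fst (x, \<tau>) i) \<le> N" using D(1) mm(2) by simp
    next
      fix i j assume ij: "i \<le> j" "j \<le> m"
      have "x i \<le> x j" "\<tau> i \<le> \<tau> j" "\<tau> j \<le> 1" using D(2) T(1,2) ij by auto
      then show "(if snd (x, \<tau>) i = e then mm (fst (x, \<tau>) i) else fst (x, \<tau>) i) \<le>
            (if snd (x, \<tau>) j = e then mm (fst (x, \<tau>) j) else fst (x, \<tau>) j)"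
        by (auto simp: e_def mm_def min_def max_def split: if_splits)
    qed
    obtain i where i: "i \<le> N" "i \<noteq> k" "\<And>t. t \<le> m \<Longrightarrow> x t \<noteq> i" using x by (auto simp: horn_iff)
    then show "\<exists>i\<le>N. i \<noteq> k \<and> (\<forall>t\<le>m. h m (x, \<tau>) t \<noteq> i)"
      using mm(3) by (intro exI[of _ i]) (auto simp: h_def, metis)
  qed
  show thesis
  proof (rule that[of g h e e'])
    show "smap_on (simplex N) (cells (simplex N)) (horn N k) g"
    proof (rule smap_onI)
      show "g l (act (simplex N) l m \<alpha> x) = act (horn N k) l m \<alpha> (g m x)"
        if "\<alpha> \<in> simplex_hom l m" for l m \<alpha> x
        using simplex_homD(1)[OF that] by (auto simp: g_def compose_def fun_eq_iff)
    qed (use g in auto)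
    show "smap_on (cyl (horn N k)) (cells (cyl (horn N k))) (horn N k) h"
    proof (rule smap_onI)
      show "h l (act (cyl (horn N k)) l m \<alpha> w) = act (horn N k) l m \<alpha> (h m w)"
        if "\<alpha> \<in> simplex_hom l m" for l m \<alpha> w
        using simplex_homD(1)[OF that] by (cases w) (auto simp: h_def compose_def fun_eq_iff)
    qed (use h in auto)
    show "h n (x, endpt e n) = g n x" for n x by (auto simp: h_def g_def fun_eq_iff)
    show "h n (x, endpt e' n) = x" if "x \<in> cells (horn N k) n" for n x
    proof -
      have "x \<in> simplex_hom n N" using that by (simp add: horn_iff)
      then show ?thesis using e simplex_homD(3)
        by (intro extensionalityI[of _ "{..n}"]) (auto simp: h_def)
    qed
  qed (use e in auto)
qed

theorem horn_fibration_extension: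
  fixes D :: "'d sset" and \<kappa> :: "'k rel"
  assumes N: "1 \<le> N" "k \<le> N" and kan: "kan_fibration D (horn N k) q"
    and \<kappa>: "Card_order \<kappa>" "infinite (Field \<kappa>)" and small: "small_map \<kappa> D (horn N k) q"
  obtains E :: "((nat \<Rightarrow> nat) \<times> 'd \<times> (nat \<Rightarrow> (nat \<Rightarrow> nat) \<Rightarrow> 'd)) sset" and p r
  where "kan_fibration E (simplex N) p" "small_map \<kappa> E (simplex N) p" "r \<in> smaps D E"
    "\<And>n. bij_betw (r n) (cells D n) {x \<in> cells E n. p n x \<in> cells (horn N k) n}"
    "\<And>n d. d \<in> cells D n \<Longrightarrow> p n (r n d) = q n d"
proof -
  obtain g h e e' where gh: "smap_on (simplex N) (cells (simplex N)) (horn N k) g"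
    "smap_on (cyl (horn N k)) (cells (cyl (horn N k))) (horn N k) h" "e \<le> 1" "e' \<le> 1"
    "\<And>n x. x \<in> cells (horn N k) n \<Longrightarrow> h n (x, endpt e n) = g n x"
    "\<And>n x. x \<in> cells (horn N k) n \<Longrightarrow> h n (x, endpt e' n) = x"
    using horn_homotopy_retract[OF N] by blast
  interpret R: retract_extension "simplex N" "cells (horn N k)" D q g h e e'
    by unfold_locales (simp_all only: restr_cells_horn simplicial_set_simplex subcomplex_horn kan gh)
  have incl: "R.ext_incl n d \<in> cells R.ext_sset n" if "d \<in> cells D n" for n d
    using smaps_cell[OF R.ext_incl_smaps that] .
  show thesis
  proof (rule that[OF R.kan_ext R.small_ext[OF \<kappa>] R.ext_incl_smaps])
    show "small_map \<kappa> D (restr_cells (simplex N) (cells (horn N k))) q" by (simp only: restr_cells_horn small)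
    show "bij_betw (R.ext_incl n) (cells D n) {x \<in> cells R.ext_sset n. R.ext_proj n x \<in> cells (horn N k) n}" for n
      using R.ext_incl_bij[of n] by (simp add: R.ext_proj_def cong: conj_cong)
    show "R.ext_proj n (R.ext_incl n d) = q n d" if "d \<in> cells D n" for n d
      using incl[OF that] R.ext_incl_proj[OF that] by (simp add: R.ext_proj_def)
  qed
qed


section \<open>A universe of small Kan fibrations\<close>

definition pr1 :: "('b \<times> 'k) sset \<Rightarrow> nat \<Rightarrow> 'b \<times> 'k \<Rightarrow> 'b" where
  "pr1 X = (\<lambda>n. restrict fst (cells X n))"

text \<open>Simplices are pairs of a base simplex and a label in \<open>'k\<close>, so the
  projection is \<open>fst\<close> and pullback can exchange the base component while keeping the
  label.\<close>

definition fib_over :: "'k rel \<Rightarrow> 'b sset \<Rightarrow> ('b \<times> 'k) sset \<Rightarrow> bool" where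
  "fib_over \<kappa> B X \<longleftrightarrow> kan_fibration X B (pr1 X) \<and> small_map \<kappa> X B (pr1 X)"

text \<open>
  \<open>classify B X n b\<close> is the pullback of \<open>X \<rightarrow> B\<close> along \<open>b : \<Delta>\<^sup>n \<rightarrow> B\<close>.  Since its cells do not
  mention \<open>b\<close>, pullback is strictly functorial (Hofmann--Streicher); for this its action has to
  be normalised outside its cells.
\<close>

definition classify :: "'b sset \<Rightarrow> ('b \<times> 'k) sset \<Rightarrow> nat \<Rightarrow> 'b \<Rightarrow> ((nat \<Rightarrow> nat) \<times> 'k) sset" where
  "classify B X n b = \<lparr>
     cells = (\<lambda>m. {(\<alpha>, x). \<alpha> \<in> simplex_hom m n \<and> (act B m n \<alpha> b, x) \<in> cells X m}),
     act = (\<lambda>l m \<beta> (\<alpha>, x).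
       if \<beta> \<in> simplex_hom l m \<and> \<alpha> \<in> simplex_hom m n \<and> (act B m n \<alpha> b, x) \<in> cells X m
       then (compose {..l} \<alpha> \<beta>, snd (act X l m \<beta> (act B m n \<alpha> b, x))) else undefined)\<rparr>"

text \<open>The second condition selects normalised representatives: pulling back along the identity
  resets the action outside the cells, and on other fibrations the identity of [n] would not act as
  the identity.\<close>

definition univ :: "'k rel \<Rightarrow> ((nat \<Rightarrow> nat) \<times> 'k) sset sset" where
  "univ \<kappa> = \<lparr>cells = (\<lambda>n. {X. fib_over \<kappa> (simplex n) X \<and> classify (simplex n) X n (ident n) = X}),
     act = (\<lambda>m n \<gamma> X. classify (simplex n) X m \<gamma>)\<rparr>"

text \<open>This plays the role of the pullback of the universal fibration along f: the labels over
  b are those of \<open>f n b\<close> over its top simplex.\<close>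

definition total :: "'b sset \<Rightarrow> (nat \<Rightarrow> 'b \<Rightarrow> ((nat \<Rightarrow> nat) \<times> 'k) sset) \<Rightarrow> ('b \<times> 'k) sset" where
  "total B f = \<lparr>cells = (\<lambda>n. {(b, x). b \<in> cells B n \<and> (ident n, x) \<in> cells (f n b) n}),
     act = (\<lambda>m n \<alpha> (b, x). (act B m n \<alpha> b, snd (act (f n b) m n \<alpha> (ident n, x))))\<rparr>"

lemma cells_classify: "(\<alpha>, x) \<in> cells (classify B X n b) m \<longleftrightarrow>
    \<alpha> \<in> simplex_hom m n \<and> (act B m n \<alpha> b, x) \<in> cells X m"
  by (simp add: classify_def)

lemma act_classify: "\<beta> \<in> simplex_hom l m \<Longrightarrow> \<alpha> \<in> simplex_hom m n \<Longrightarrow> (act B m n \<alpha> b, x) \<in> cells X m \<Longrightarrow>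
   act (classify B X n b) l m \<beta> (\<alpha>, x) = (compose {..l} \<alpha> \<beta>, snd (act X l m \<beta> (act B m n \<alpha> b, x)))"
  by (simp add: classify_def)

lemma classify_eqI:
  assumes c: "\<And>m \<alpha> x. \<alpha> \<in> simplex_hom m n \<Longrightarrow> (act B m n \<alpha> b, x) \<in> cells X m \<longleftrightarrow> (act B' m n \<alpha> b', x) \<in> cells X' m"
    and a: "\<And>l m \<alpha> \<beta> x. \<alpha> \<in> simplex_hom m n \<Longrightarrow> \<beta> \<in> simplex_hom l m \<Longrightarrow> (act B m n \<alpha> b, x) \<in> cells X m \<Longrightarrow>
       snd (act X l m \<beta> (act B m n \<alpha> b, x)) = snd (act X' l m \<beta> (act B' m n \<alpha> b', x))"
  shows "classify B X n b = classify B' X' n b'"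
proof -
  have "(\<alpha> \<in> simplex_hom m n \<and> (act B m n \<alpha> b, x) \<in> cells X m) =
      (\<alpha> \<in> simplex_hom m n \<and> (act B' m n \<alpha> b', x) \<in> cells X' m)" for m \<alpha> x
    using c by blast
  moreover have "(if \<beta> \<in> simplex_hom l m \<and> \<alpha> \<in> simplex_hom m n \<and> (act B m n \<alpha> b, x) \<in> cells X m
       then (compose {..l} \<alpha> \<beta>, snd (act X l m \<beta> (act B m n \<alpha> b, x))) else undefined) =
     (if \<beta> \<in> simplex_hom l m \<and> \<alpha> \<in> simplex_hom m n \<and> (act B' m n \<alpha> b', x) \<in> cells X' m
       then (compose {..l} \<alpha> \<beta>, snd (act X' l m \<beta> (act B' m n \<alpha> b', x))) else undefined)" for l m \<beta> \<alpha> x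
    using c a by auto
  ultimately show ?thesis unfolding classify_def by presburger
qed

lemma fib_overD:
  assumes "fib_over \<kappa> B X"
  shows "simplicial_set X" and "simplicial_set B"
    and "kan_fibration X B (pr1 X)" and "small_map \<kappa> X B (pr1 X)"
    and "x \<in> cells X n \<Longrightarrow> fst x \<in> cells B n"
    and "\<alpha> \<in> simplex_hom m n \<Longrightarrow> x \<in> cells X n \<Longrightarrow> fst (act X m n \<alpha> x) = act B m n \<alpha> (fst x)"
proof -
  show X: "simplicial_set X" and "simplicial_set B" and "kan_fibration X B (pr1 X)" "small_map \<kappa> X B (pr1 X)"
    using assms by (auto simp: fib_over_def kan_fibration_def)
  have p: "pr1 X \<in> smaps X B" using assms by (simp add: fib_over_def kan_fibration_def)
  show "x \<in> cells X n \<Longrightarrow> fst x \<in> cells B n" using smaps_cell[OF p, of x n] by (simp add: pr1_def)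
  show "\<alpha> \<in> simplex_hom m n \<Longrightarrow> x \<in> cells X n \<Longrightarrow> fst (act X m n \<alpha> x) = act B m n \<alpha> (fst x)"
    using smaps_actD[OF p, of \<alpha> m n x] simplicial_setD(1)[OF X, of \<alpha> m n x] by (simp add: pr1_def)
qed

lemma fib_over_act:
  assumes "fib_over \<kappa> B X" "\<alpha> \<in> simplex_hom m n" "(b, x) \<in> cells X n"
  shows "act X m n \<alpha> (b, x) = (act B m n \<alpha> b, snd (act X m n \<alpha> (b, x)))"
  using fib_overD(6)[OF assms] by (simp add: prod_eq_iff)

lemma fib_overI:
  assumes X: "simplicial_set X" and B: "simplicial_set B"
    and c: "\<And>n b x. (b, x) \<in> cells X n \<Longrightarrow> b \<in> cells B n"
    and a: "\<And>m n \<alpha> b x. \<alpha> \<in> simplex_hom m n \<Longrightarrow> (b, x) \<in> cells X n \<Longrightarrow> fst (act X m n \<alpha> (b, x)) = act B m n \<alpha> b"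
    and small: "\<And>n b. b \<in> cells B n \<Longrightarrow> |{x \<in> cells X n. fst x = b}| <o \<kappa>"
    and lift: "\<And>n k v f. 1 \<le> n \<Longrightarrow> k \<le> n \<Longrightarrow> smap_on (simplex n) (cells (simplex n)) B v \<Longrightarrow>
      lift_on (simplex n) (cells (horn n k)) X (\<lambda>_. fst) v f \<Longrightarrow>
      \<exists>f'. lift_on (simplex n) (cells (simplex n)) X (\<lambda>_. fst) v f' \<and>
           (\<forall>m. \<forall>w\<in>cells (horn n k) m. f' m w = f m w)"
  shows "fib_over \<kappa> B X"
proof -
  have eq: "lift_on W S X (pr1 X) v f \<longleftrightarrow> lift_on W S X (\<lambda>_. fst) v f" for W :: "(nat \<Rightarrow> nat) sset" and S v f
    by (auto simp: lift_on_def smap_on_def pr1_def)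
  have "pr1 X \<in> smaps X B"
    using c a simplicial_setD(1)[OF X] unfolding smaps_def pr1_def by auto
  then have "kan_fibration X B (pr1 X)"
    by (rule kan_fibrationI[OF X B]) (use lift in \<open>simp only: eq\<close>)
  moreover have "{x \<in> cells X n. pr1 X n x = b} = {x \<in> cells X n. fst x = b}" for n b
    by (auto simp: pr1_def)
  then have "small_map \<kappa> X B (pr1 X)" using small by (simp add: small_map_def)
  ultimately show ?thesis by (simp add: fib_over_def)
qed

lemma fib_over_small: "fib_over \<kappa> B X \<Longrightarrow> b \<in> cells B n \<Longrightarrow> |{x \<in> cells X n. fst x = b}| <o \<kappa>"
proof -
  assume X: "fib_over \<kappa> B X" and b: "b \<in> cells B n"
  have "{x \<in> cells X n. pr1 X n x = b} = {x \<in> cells X n. fst x = b}" by (auto simp: pr1_def)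
  moreover have "|{x \<in> cells X n. pr1 X n x = b}| <o \<kappa>"
    using fib_overD(4)[OF X] b unfolding small_map_def by blast
  ultimately show ?thesis by simp
qed

lemma fib_over_lift:
  assumes X: "fib_over \<kappa> B X" and nk: "1 \<le> n" "k \<le> n"
    and v: "smap_on (simplex n) (cells (simplex n)) B v"
    and f: "lift_on (simplex n) (cells (horn n k)) X (\<lambda>_. fst) v f"
  obtains f' where "lift_on (simplex n) (cells (simplex n)) X (\<lambda>_. fst) v f'"
    "\<And>m w. w \<in> cells (horn n k) m \<Longrightarrow> f' m w = f m w"
proof -
  have eq: "lift_on W S X (pr1 X) v f \<longleftrightarrow> lift_on W S X (\<lambda>_. fst) v f" for W :: "(nat \<Rightarrow> nat) sset" and S v f
    by (auto simp: lift_on_def smap_on_def pr1_def)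
  show thesis
    using lift_extD[OF kan_lift_ext[OF fib_overD(3)[OF X] nk v]] f that unfolding eq by blast
qed

text \<open>On both sides a cell is a pair of \<alpha> and a label over the simplex obtained from b
  by \<delta> and then \<alpha>. No trace of b is stored in the cells, so iterated pullbacks are
  equal rather than isomorphic.\<close>

lemma classify_classify:
  assumes B: "simplicial_set B" and b: "b \<in> cells B m" and d: "\<delta> \<in> simplex_hom l m"
  shows "classify (simplex m) (classify B X m b) l \<delta> = classify B X l (act B l m \<delta> b)"
proof (rule classify_eqI)
  note BD = simplicial_setD[OF B]
  fix j \<alpha> x assume a: "\<alpha> \<in> simplex_hom j l"
  have ad: "compose {..j} \<delta> \<alpha> \<in> simplex_hom j m" by (rule simplex_hom_comp[OF a d])
  have eq: "act B j m (compose {..j} \<delta> \<alpha>) b = act B j l \<alpha> (act B l m \<delta> b)"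
    using BD(3)[OF a d b] by simp
  show "(act (simplex m) j l \<alpha> \<delta>, x) \<in> cells (classify B X m b) j \<longleftrightarrow> (act B j l \<alpha> (act B l m \<delta> b), x) \<in> cells X j"
    using ad eq by (simp add: cells_classify)
  fix i \<beta> assume "\<beta> \<in> simplex_hom i j" "(act (simplex m) j l \<alpha> \<delta>, x) \<in> cells (classify B X m b) j"
  then show "snd (act (classify B X m b) i j \<beta> (act (simplex m) j l \<alpha> \<delta>, x)) =
      snd (act X i j \<beta> (act B j l \<alpha> (act B l m \<delta> b), x))"
    using ad eq by (simp add: cells_classify act_classify)
qed

lemma simplicial_set_classify:
  assumes X: "fib_over \<kappa> B X" and b: "b \<in> cells B n"
  shows "simplicial_set (classify B X n b)"
  unfolding simplicial_set_def
proof (intro conjI allI ballI)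
  note BD = simplicial_setD[OF fib_overD(2)[OF X]] and XD = simplicial_setD[OF fib_overD(1)[OF X]]
  let ?C = "classify B X n b"
  have eq: "act X l m \<beta> (act B m n \<alpha> b, x) = (act B l n (compose {..l} \<alpha> \<beta>) b, snd (act X l m \<beta> (act B m n \<alpha> b, x)))"
    if "\<beta> \<in> simplex_hom l m" "\<alpha> \<in> simplex_hom m n" "(act B m n \<alpha> b, x) \<in> cells X m" for l m \<alpha> \<beta> x
    using fib_over_act[OF X that(1,3)] BD(3)[OF that(1,2) b] by simp
  have in_X: "(act B l n (compose {..l} \<alpha> \<beta>) b, snd (act X l m \<beta> (act B m n \<alpha> b, x))) \<in> cells X l"
    if "\<beta> \<in> simplex_hom l m" "\<alpha> \<in> simplex_hom m n" "(act B m n \<alpha> b, x) \<in> cells X m" for l m \<alpha> \<beta> x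
    using XD(1)[OF that(1,3)] eq[OF that] by simp
  show "act ?C l m \<beta> y \<in> cells ?C l" if \<beta>: "\<beta> \<in> simplex_hom l m" and y: "y \<in> cells ?C m" for l m \<beta> y
  proof -
    obtain \<alpha> x where ax: "y = (\<alpha>, x)" by (cases y)
    have c: "\<alpha> \<in> simplex_hom m n" "(act B m n \<alpha> b, x) \<in> cells X m" using y by (auto simp: ax cells_classify)
    show ?thesis
      unfolding ax act_classify[OF \<beta> c] cells_classify using in_X[OF \<beta> c] simplex_hom_comp[OF \<beta> c(1)] by blast
  qed
  show "act ?C m m (ident m) y = y" if y: "y \<in> cells ?C m" for m y
  proof -
    obtain \<alpha> x where ax: "y = (\<alpha>, x)" by (cases y)
    have c: "\<alpha> \<in> simplex_hom m n" "(act B m n \<alpha> b, x) \<in> cells X m" using y by (auto simp: ax cells_classify)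
    show ?thesis
      unfolding ax act_classify[OF ident_hom c] using XD(2)[OF c(2)] compose_ident_right[OF c(1)] by simp
  qed
  show "act ?C l m \<beta> (act ?C m m' \<gamma> y) = act ?C l m' (compose {..l} \<gamma> \<beta>) y"
    if \<beta>: "\<beta> \<in> simplex_hom l m" and \<gamma>: "\<gamma> \<in> simplex_hom m m'" and y: "y \<in> cells ?C m'" for l m m' \<beta> \<gamma> y
  proof -
    obtain \<alpha> x where ax: "y = (\<alpha>, x)" by (cases y)
    have c: "\<alpha> \<in> simplex_hom m' n" "(act B m' n \<alpha> b, x) \<in> cells X m'" using y by (auto simp: ax cells_classify)
    note ag = simplex_hom_comp[OF \<gamma> c(1)] and gb = simplex_hom_comp[OF \<beta> \<gamma>]
    have "act X l m \<beta> (act B m n (compose {..m} \<alpha> \<gamma>) b, snd (act X m m' \<gamma> (act B m' n \<alpha> b, x))) =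
        act X l m' (compose {..l} \<gamma> \<beta>) (act B m' n \<alpha> b, x)"
      unfolding eq[OF \<gamma> c, symmetric] by (rule XD(3)[OF \<beta> \<gamma> c(2)])
    then show ?thesis
      unfolding ax act_classify[OF \<gamma> c] act_classify[OF \<beta> ag in_X[OF \<gamma> c]] act_classify[OF gb c]
      using simplex_hom_assoc[OF \<beta>, of \<alpha> \<gamma>] by simp
  qed
qed

text \<open>A lifting problem over \<open>\<Delta>\<^sup>n\<close> becomes one for X when b is
  applied to the base components. Its solution solves the original problem once the old base
  components are put back, since labels are unchanged.\<close>

lemma classify_fib_over:
  assumes X: "fib_over \<kappa> B X" and b: "b \<in> cells B n"
  shows "fib_over \<kappa> (simplex n) (classify B X n b)"
proof (rule fib_overI[OF simplicial_set_classify[OF X b] simplicial_set_simplex])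
  note BD = simplicial_setD[OF fib_overD(2)[OF X]]
  let ?C = "classify B X n b"
  show "\<alpha> \<in> cells (simplex n) m" if "(\<alpha>, x) \<in> cells ?C m" for \<alpha> x m using that by (simp add: cells_classify)
  show "fst (act ?C l m \<beta> (\<alpha>, x)) = act (simplex n) l m \<beta> \<alpha>" if "\<beta> \<in> simplex_hom l m" "(\<alpha>, x) \<in> cells ?C m"
    for l m \<beta> \<alpha> x using that by (simp add: cells_classify act_classify)
  show "|{x \<in> cells ?C m. fst x = \<alpha>}| <o \<kappa>" if "\<alpha> \<in> cells (simplex n) m" for m \<alpha>
  proof -
    have "|{x \<in> cells ?C m. fst x = \<alpha>}| \<le>o |{x \<in> cells X m. fst x = act B m n \<alpha> b}|"
      by (rule card_of_ordLeqI[of "\<lambda>y. (act B m n \<alpha> b, snd y)"]) (auto simp: inj_on_def cells_classify)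
    then show ?thesis using fib_over_small[OF X BD(1)[of \<alpha> m n b]] that b ordLeq_ordLess_trans by simp blast
  qed
  fix m k v f
  assume mk: "1 \<le> m" "k \<le> m" and v: "smap_on (simplex m) (cells (simplex m)) (simplex n) v"
    and f: "lift_on (simplex m) (cells (horn m k)) ?C (\<lambda>_. fst) v f"
  let ?S = "cells (simplex m)" and ?H = "cells (horn m k)"
  have vD: "v l w \<in> simplex_hom l n" if "w \<in> ?S l" for l w using smap_onD(1)[OF v that] by simp
  have v_act: "v j (compose {..j} w \<gamma>) = compose {..j} (v l w) \<gamma>" if "\<gamma> \<in> simplex_hom j l" "w \<in> ?S l" for j l w \<gamma>
    using smap_onD(2)[OF v that] by simp
  let ?v = "\<lambda>l w. act B l n (v l w) b"
  have v': "smap_on (simplex m) ?S B ?v"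
    using vD b by (intro smap_onI) (simp_all add: BD(1) BD(3) v_act)
  have f_eq: "f l w = (v l w, snd (f l w))" if "w \<in> ?H l" for l w
    using lift_onD(3)[OF f that] by (simp add: prod_eq_iff)
  have fX: "(?v l w, snd (f l w)) \<in> cells X l" if "w \<in> ?H l" for l w
    using lift_onD(1)[OF f that] f_eq[OF that] cells_classify by metis
  have f': "lift_on (simplex m) ?H X (\<lambda>_. fst) ?v (\<lambda>l w. (?v l w, snd (f l w)))"
  proof (rule lift_onI)
    fix j l \<gamma> w assume c: "\<gamma> \<in> simplex_hom j l" and w: "w \<in> ?H l"
    have vw: "v l w \<in> simplex_hom l n" by (rule vD[OF horn_cell[OF w]])
    have "f j (act (simplex m) j l \<gamma> w) = act ?C j l \<gamma> (v l w, snd (f l w))"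
      using lift_onD(2)[OF f c w] f_eq[OF w] by metis
    then have "snd (f j (act (simplex m) j l \<gamma> w)) = snd (act X j l \<gamma> (?v l w, snd (f l w)))"
      using act_classify[OF c vw fX[OF w]] by simp
    moreover have "?v j (act (simplex m) j l \<gamma> w) = act B j l \<gamma> (?v l w)"
      by (rule smap_onD(2)[OF v' c horn_cell[OF w]])
    ultimately show "(?v j (act (simplex m) j l \<gamma> w), snd (f j (act (simplex m) j l \<gamma> w))) = act X j l \<gamma> (?v l w, snd (f l w))"
      using fib_over_act[OF X c fX[OF w]] by simp
  qed (use fX in auto)
  obtain F where F: "lift_on (simplex m) ?S X (\<lambda>_. fst) ?v F"
    "\<And>l w. w \<in> ?H l \<Longrightarrow> F l w = (?v l w, snd (f l w))"
    using fib_over_lift[OF X mk v' f'] by blast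
  have F_eq: "F l w = (?v l w, snd (F l w))" if "w \<in> ?S l" for l w
    using lift_onD(3)[OF F(1) that] by (simp add: prod_eq_iff)
  have FX: "(?v l w, snd (F l w)) \<in> cells X l" if "w \<in> ?S l" for l w
    using lift_onD(1)[OF F(1) that] F_eq[OF that] by simp
  have "lift_on (simplex m) ?S ?C (\<lambda>_. fst) v (\<lambda>l w. (v l w, snd (F l w)))"
  proof (rule lift_onI)
    fix j l \<gamma> w assume c: "\<gamma> \<in> simplex_hom j l" and w: "w \<in> ?S l"
    have "F j (act (simplex m) j l \<gamma> w) = act X j l \<gamma> (?v l w, snd (F l w))"
      using lift_onD(2)[OF F(1) c w] F_eq[OF w] by metis
    then show "(v j (act (simplex m) j l \<gamma> w), snd (F j (act (simplex m) j l \<gamma> w))) = act ?C j l \<gamma> (v l w, snd (F l w))"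
      using act_classify[OF c vD[OF w] FX[OF w]] v_act[OF c w] by simp
  qed (use vD FX in \<open>auto simp: cells_classify\<close>)
  moreover have "(v l w, snd (F l w)) = f l w" if "w \<in> ?H l" for l w
    using F(2)[OF that] f_eq[OF that] by simp
  ultimately show "\<exists>f'. lift_on (simplex m) ?S ?C (\<lambda>_. fst) v f' \<and> (\<forall>l. \<forall>w\<in>?H l. f' l w = f l w)"
    by blast
qed

section \<open>The universe as a simplicial set and its total spaces\<close>

lemma cells_univ: "X \<in> cells (univ \<kappa>) n \<longleftrightarrow> fib_over \<kappa> (simplex n) X \<and> classify (simplex n) X n (ident n) = X"
  and act_univ: "act (univ \<kappa>) m n \<gamma> X = classify (simplex n) X m \<gamma>"
  by (simp_all add: univ_def)

lemma smap_on_classify: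
  assumes X: "fib_over \<kappa> B X"
  shows "smap_on B (cells B) (univ \<kappa>) (classify B X)"
proof (rule smap_onI)
  note B = fib_overD(2)[OF X]
  show "classify B X n b \<in> cells (univ \<kappa>) n" if "b \<in> cells B n" for n b
    using classify_fib_over[OF X that] classify_classify[OF B that ident_hom, of X] simplicial_setD(2)[OF B that]
    by (simp add: cells_univ)
  show "classify B X m (act B m n \<alpha> b) = act (univ \<kappa>) m n \<alpha> (classify B X n b)"
    if "\<alpha> \<in> simplex_hom m n" "b \<in> cells B n" for m n \<alpha> b
    using classify_classify[OF B that(2,1), of X] by (simp add: act_univ)
qed

lemma simplicial_set_univ: "simplicial_set (univ \<kappa>)"
  unfolding simplicial_set_def
proof (intro conjI allI ballI)
  fix m n \<alpha> X assume a: "\<alpha> \<in> simplex_hom m n" and X: "X \<in> cells (univ \<kappa>) n"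
  then have "fib_over \<kappa> (simplex n) X" by (simp add: cells_univ)
  then show "act (univ \<kappa>) m n \<alpha> X \<in> cells (univ \<kappa>) m"
    using smap_onD(1)[OF smap_on_classify, of \<kappa> "simplex n" X \<alpha> m] a by (simp add: act_univ)
next
  fix l m n \<alpha> \<beta> X assume a: "\<alpha> \<in> simplex_hom l m" "\<beta> \<in> simplex_hom m n" and X: "X \<in> cells (univ \<kappa>) n"
  then show "act (univ \<kappa>) l m \<alpha> (act (univ \<kappa>) m n \<beta> X) = act (univ \<kappa>) l n (compose {..l} \<beta> \<alpha>) X"
    using classify_classify[OF simplicial_set_simplex, of \<beta> n m \<alpha> l X] by (simp add: act_univ)
qed (simp add: cells_univ act_univ)

text \<open>Since f sends the simplex obtained from b by \<alpha> to the pullback of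
  \<open>f n b\<close> along \<alpha>, its labels are those of \<open>f n b\<close> over \<alpha>.
  Everything over b thus takes place inside the single fibration \<open>f n b\<close>.\<close>

lemma univ_act_cell:
  assumes f: "smap_on B (cells B) (univ \<kappa>) f" and b: "b \<in> cells B n" and a: "\<alpha> \<in> simplex_hom m n"
  shows "(ident m, x) \<in> cells (f m (act B m n \<alpha> b)) m \<longleftrightarrow> (\<alpha>, x) \<in> cells (f n b) m"
    and "\<beta> \<in> simplex_hom l m \<Longrightarrow> (\<alpha>, x) \<in> cells (f n b) m \<Longrightarrow>
      snd (act (f m (act B m n \<alpha> b)) l m \<beta> (ident m, x)) = snd (act (f n b) l m \<beta> (\<alpha>, x))"
  using smap_onD(2)[OF f a b] a
  by (simp_all add: act_univ cells_classify act_classify compose_ident_right)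

lemma univ_cellD:
  assumes f: "smap_on B (cells B) (univ \<kappa>) f" and b: "b \<in> cells B n"
  shows "fib_over \<kappa> (simplex n) (f n b)" "classify (simplex n) (f n b) n (ident n) = f n b"
  using smap_onD(1)[OF f b] by (auto simp: cells_univ)

lemma cells_total: "(b, x) \<in> cells (total B f) n \<longleftrightarrow> b \<in> cells B n \<and> (ident n, x) \<in> cells (f n b) n"
  and act_total: "act (total B f) m n \<alpha> (b, x) = (act B m n \<alpha> b, snd (act (f n b) m n \<alpha> (ident n, x)))"
  by (simp_all add: total_def)

lemma univ_act_ident:
  assumes f: "smap_on B (cells B) (univ \<kappa>) f" and b: "b \<in> cells B n" and a: "\<alpha> \<in> simplex_hom m n"
    and x: "(ident n, x) \<in> cells (f n b) n"
  shows "act (f n b) m n \<alpha> (ident n, x) = (\<alpha>, snd (act (f n b) m n \<alpha> (ident n, x)))"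
    and "(\<alpha>, snd (act (f n b) m n \<alpha> (ident n, x))) \<in> cells (f n b) m"
proof -
  note X = univ_cellD(1)[OF f b]
  show 1: "act (f n b) m n \<alpha> (ident n, x) = (\<alpha>, snd (act (f n b) m n \<alpha> (ident n, x)))"
    using fib_over_act[OF X a x] compose_ident_left[OF a] by simp
  show "(\<alpha>, snd (act (f n b) m n \<alpha> (ident n, x))) \<in> cells (f n b) m"
    using simplicial_setD(1)[OF fib_overD(1)[OF X] a x] 1 by simp
qed

lemma simplicial_set_total:
  assumes B: "simplicial_set B" and f: "smap_on B (cells B) (univ \<kappa>) f"
  shows "simplicial_set (total B f)"
  unfolding simplicial_set_def
proof (intro conjI allI ballI)
  note BD = simplicial_setD[OF B]
  fix m n \<alpha> y assume a: "\<alpha> \<in> simplex_hom m n" and y: "y \<in> cells (total B f) n"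
  obtain b x where bx: "y = (b, x)" by (cases y)
  have c: "b \<in> cells B n" "(ident n, x) \<in> cells (f n b) n" using y by (auto simp: bx cells_total)
  show "act (total B f) m n \<alpha> y \<in> cells (total B f) m"
    unfolding bx act_total cells_total univ_act_cell(1)[OF f c(1) a]
    using BD(1)[OF a c(1)] univ_act_ident(2)[OF f c(1) a c(2)] by blast
next
  fix n y assume y: "y \<in> cells (total B f) n"
  obtain b x where bx: "y = (b, x)" by (cases y)
  have c: "b \<in> cells B n" "(ident n, x) \<in> cells (f n b) n" using y by (auto simp: bx cells_total)
  show "act (total B f) n n (ident n) y = y"
    unfolding bx act_total
    using simplicial_setD(2)[OF B c(1)] simplicial_setD(2)[OF fib_overD(1)[OF univ_cellD(1)[OF f c(1)]] c(2)] by simp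
next
  note BD = simplicial_setD[OF B]
  fix l m n \<alpha> \<beta> y assume a: "\<alpha> \<in> simplex_hom l m" and b: "\<beta> \<in> simplex_hom m n" and y: "y \<in> cells (total B f) n"
  obtain z x where bx: "y = (z, x)" by (cases y)
  have c: "z \<in> cells B n" "(ident n, x) \<in> cells (f n z) n" using y by (auto simp: bx cells_total)
  note i = univ_act_ident[OF f c(1) b c(2)]
  have "snd (act (f m (act B m n \<beta> z)) l m \<alpha> (ident m, snd (act (f n z) m n \<beta> (ident n, x)))) =
     snd (act (f n z) l m \<alpha> (act (f n z) m n \<beta> (ident n, x)))"
    using univ_act_cell(2)[OF f c(1) b a i(2)] i(1) by simp
  then show "act (total B f) l m \<alpha> (act (total B f) m n \<beta> y) = act (total B f) l n (compose {..l} \<beta> \<alpha>) y"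
    unfolding bx act_total
    using BD(3)[OF a b c(1)] simplicial_setD(3)[OF fib_overD(1)[OF univ_cellD(1)[OF f c(1)]] a b c(2)] by simp
qed

text \<open>A horn lifting problem lies over one simplex b of B, the image of the identity. The part
  of the total space over b is \<open>f m b\<close>, a fibration by membership in the universe, so
  the problem is solved there.\<close>

theorem total_fib_over:
  assumes B: "simplicial_set B" and f: "smap_on B (cells B) (univ \<kappa>) f"
  shows "fib_over \<kappa> B (total B f)"
proof (rule fib_overI[OF simplicial_set_total[OF B f] B])
  let ?T = "total B f"
  show "b \<in> cells B n" if "(b, x) \<in> cells ?T n" for n b x using that by (simp add: cells_total)
  show "fst (act ?T m n \<alpha> (b, x)) = act B m n \<alpha> b" for m n \<alpha> b x by (simp add: act_total)
  show "|{x \<in> cells ?T n. fst x = b}| <o \<kappa>" if b: "b \<in> cells B n" for n b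
  proof -
    have "|{x \<in> cells ?T n. fst x = b}| \<le>o |{x \<in> cells (f n b) n. fst x = ident n}|"
      by (rule card_of_ordLeqI[of "\<lambda>y. (ident n, snd y)"]) (auto simp: inj_on_def cells_total)
    moreover have "|{x \<in> cells (f n b) n. fst x = ident n}| <o \<kappa>"
      by (rule fib_over_small[OF univ_cellD(1)[OF f b]]) simp
    ultimately show ?thesis by (rule ordLeq_ordLess_trans)
  qed
  fix m k v u
  assume mk: "1 \<le> m" "k \<le> m" and v: "smap_on (simplex m) (cells (simplex m)) B v"
    and u: "lift_on (simplex m) (cells (horn m k)) ?T (\<lambda>_. fst) v u"
  let ?S = "cells (simplex m)" and ?H = "cells (horn m k)"
  define b where "b = v m (ident m)"
  have b: "b \<in> cells B m" using smap_onD(1)[OF v, of "ident m" m] by (simp add: b_def)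
  have vb: "v l w = act B l m w b" if "w \<in> ?S l" for l w
    using smap_onD(2)[OF v, of w l m "ident m"] that by (simp add: b_def compose_ident_left)
  note X = univ_cellD(1)[OF f b]
  have u_eq: "u l w = (act B l m w b, snd (u l w))" if "w \<in> ?H l" for l w
    using lift_onD(3)[OF u that] vb[OF horn_cell[OF that]] by (simp add: prod_eq_iff)
  have uX: "(w, snd (u l w)) \<in> cells (f m b) l" if w: "w \<in> ?H l" for l w
  proof -
    have "(act B l m w b, snd (u l w)) \<in> cells ?T l" using lift_onD(1)[OF u w] u_eq[OF w] by simp
    then show ?thesis using univ_act_cell(1)[OF f b] horn_cell[OF w] by (simp add: cells_total)
  qed
  have u': "lift_on (simplex m) ?H (f m b) (\<lambda>_. fst) (\<lambda>l w. w) (\<lambda>l w. (w, snd (u l w)))"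
  proof (rule lift_onI)
    fix j l \<gamma> w assume c: "\<gamma> \<in> simplex_hom j l" and w: "w \<in> ?H l"
    have wS: "w \<in> simplex_hom l m" using horn_cell[OF w] by simp
    have "u j (act (simplex m) j l \<gamma> w) = act ?T j l \<gamma> (act B l m w b, snd (u l w))"
      using lift_onD(2)[OF u c w] u_eq[OF w] by metis
    then have "snd (u j (act (simplex m) j l \<gamma> w)) = snd (act (f m b) j l \<gamma> (w, snd (u l w)))"
      using univ_act_cell(2)[OF f b wS c uX[OF w]] by (simp add: act_total)
    then show "(act (simplex m) j l \<gamma> w, snd (u j (act (simplex m) j l \<gamma> w))) = act (f m b) j l \<gamma> (w, snd (u l w))"
      using fib_over_act[OF X c uX[OF w]] by simp
  qed (use uX in auto)
  have id: "smap_on (simplex m) ?S (simplex m) (\<lambda>l w. w)" by (rule smap_onI) auto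
  obtain F where F: "lift_on (simplex m) ?S (f m b) (\<lambda>_. fst) (\<lambda>l w. w) F"
    "\<And>l w. w \<in> ?H l \<Longrightarrow> F l w = (w, snd (u l w))"
    using fib_over_lift[OF X mk id u'] by blast
  have F_eq: "F l w = (w, snd (F l w))" if "w \<in> ?S l" for l w
    using lift_onD(3)[OF F(1) that] by (simp add: prod_eq_iff)
  have FX: "(w, snd (F l w)) \<in> cells (f m b) l" if "w \<in> ?S l" for l w
    using lift_onD(1)[OF F(1) that] F_eq[OF that] by simp
  have "lift_on (simplex m) ?S ?T (\<lambda>_. fst) v (\<lambda>l w. (v l w, snd (F l w)))"
  proof (rule lift_onI)
    fix l w assume w: "w \<in> ?S l"
    then show "(v l w, snd (F l w)) \<in> cells ?T l"
      using univ_act_cell(1)[OF f b] FX[OF w] smap_onD(1)[OF v w] vb[OF w] by (simp add: cells_total)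
  next
    fix j l \<gamma> w assume c: "\<gamma> \<in> simplex_hom j l" and w: "w \<in> ?S l"
    have "F j (act (simplex m) j l \<gamma> w) = act (f m b) j l \<gamma> (w, snd (F l w))"
      using lift_onD(2)[OF F(1) c w] F_eq[OF w] by metis
    moreover have "w \<in> simplex_hom l m" using w by simp
    ultimately show "(v j (act (simplex m) j l \<gamma> w), snd (F j (act (simplex m) j l \<gamma> w))) = act ?T j l \<gamma> (v l w, snd (F l w))"
      using univ_act_cell(2)[OF f b _ c FX[OF w]] smap_onD(2)[OF v c w] vb[OF w] by (simp add: act_total)
  qed simp
  moreover have "(v l w, snd (F l w)) = u l w" if "w \<in> ?H l" for l w
    using F(2)[OF that] u_eq[OF that] vb[OF horn_cell[OF that]] by simp
  ultimately show "\<exists>f'. lift_on (simplex m) ?S ?T (\<lambda>_. fst) v f' \<and> (\<forall>l. \<forall>w\<in>?H l. f' l w = u l w)"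
    by blast
qed

text \<open>Cells and actions correspond by \<open>univ_act_cell\<close>; the normalisation built
  into \<open>univ\<close> turns this correspondence into equality.\<close>

lemma classify_total:
  assumes B: "simplicial_set B" and f: "smap_on B (cells B) (univ \<kappa>) f" and b: "b \<in> cells B n"
  shows "classify B (total B f) n b = f n b"
proof -
  have "classify B (total B f) n b = classify (simplex n) (f n b) n (ident n)"
  proof (rule classify_eqI)
    fix m \<alpha> x assume a: "\<alpha> \<in> simplex_hom m n"
    note cell = univ_act_cell[OF f b a]
    show c: "(act B m n \<alpha> b, x) \<in> cells (total B f) m \<longleftrightarrow> (act (simplex n) m n \<alpha> (ident n), x) \<in> cells (f n b) m"
      using cell(1) simplicial_setD(1)[OF B a b] compose_ident_left[OF a] by (simp add: cells_total)
    fix l \<beta> assume "\<beta> \<in> simplex_hom l m" "(act B m n \<alpha> b, x) \<in> cells (total B f) m"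
    then show "snd (act (total B f) l m \<beta> (act B m n \<alpha> b, x)) = snd (act (f n b) l m \<beta> (act (simplex n) m n \<alpha> (ident n), x))"
      using c cell(2) compose_ident_left[OF a] by (simp add: act_total)
  qed
  then show ?thesis using univ_cellD(2)[OF f b] by simp
qed

section \<open>Transport along levelwise injections\<close>

definition transport :: "'a sset \<Rightarrow> (nat \<Rightarrow> 'a \<Rightarrow> 'b) \<Rightarrow> 'b sset" where
  "transport X c = \<lparr>cells = (\<lambda>n. c n ` cells X n),
     act = (\<lambda>m n \<alpha> y. c m (act X m n \<alpha> (inv_into (cells X n) (c n) y)))\<rparr>"

lemma cells_transport [simp]: "cells (transport X c) n = c n ` cells X n"
  by (simp add: transport_def)

lemma act_transport:
  "inj_on (c n) (cells X n) \<Longrightarrow> x \<in> cells X n \<Longrightarrow> act (transport X c) m n \<alpha> (c n x) = c m (act X m n \<alpha> x)"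
  by (simp add: transport_def)

lemma simplicial_set_transport:
  assumes X: "simplicial_set X" and c: "\<And>n. inj_on (c n) (cells X n)"
  shows "simplicial_set (transport X c)"
  unfolding simplicial_set_def
  using simplicial_setD[OF X] by (auto simp: act_transport[of c, OF c])

lemma kan_fibration_transport:
  assumes K: "kan_fibration X Y q" and c: "\<And>n. inj_on (c n) (cells X n)"
    and q': "\<And>n x. x \<in> cells X n \<Longrightarrow> q' n (c n x) = q n x" "\<And>n. q' n \<in> extensional (c n ` cells X n)"
  shows "kan_fibration (transport X c) Y q'"
proof (rule kan_fibrationI)
  have X: "simplicial_set X" and q: "q \<in> smaps X Y" using K by (auto simp: kan_fibration_def)
  show "simplicial_set Y" using K by (auto simp: kan_fibration_def)
  let ?T = "transport X c"
  note XD = simplicial_setD(1)[OF X] and act_T = act_transport[of c, OF c]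
  show T: "simplicial_set ?T" by (rule simplicial_set_transport[OF X c])
  show "q' \<in> smaps ?T Y"
    using smaps_cell[OF q] smaps_actD[OF q] q' XD unfolding smaps_def
    by (auto simp: PiE_iff act_T)
  fix n k v f
  assume nk: "1 \<le> n" "k \<le> n" and v: "smap_on (simplex n) (cells (simplex n)) Y v"
    and f: "lift_on (simplex n) (cells (horn n k)) ?T q' v f"
  let ?H = "cells (horn n k)" and ?S = "cells (simplex n)"
  define u where "u m w = inv_into (cells X m) (c m) (f m w)" for m w
  have u: "u m w \<in> cells X m \<and> f m w = c m (u m w)" if "w \<in> ?H m" for m w
    using lift_onD(1)[OF f that] by (auto simp: u_def inv_into_into f_inv_into_f)
  have "lift_on (simplex n) ?H X q v u"
  proof (rule lift_onI)
    fix l m \<alpha> w assume a: "\<alpha> \<in> simplex_hom l m" and w: "w \<in> ?H m"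
    have w': "act (simplex n) l m \<alpha> w \<in> ?H l" by (rule subcomplexD(2)[OF subcomplex_horn a w])
    have "c l (u l (act (simplex n) l m \<alpha> w)) = act ?T l m \<alpha> (c m (u m w))"
      using lift_onD(2)[OF f a w] u[OF w] u[OF w'] by simp
    also have "\<dots> = c l (act X l m \<alpha> (u m w))" using act_T u[OF w] by blast
    finally show "u l (act (simplex n) l m \<alpha> w) = act X l m \<alpha> (u m w)"
      using inj_onD[OF c] u[OF w] u[OF w'] XD[OF a] by blast
  qed (use u q'(1) lift_onD(3)[OF f] in \<open>auto\<close>)
  from lift_extD[OF kan_lift_ext[OF K nk v] this] obtain F
    where F: "lift_on (simplex n) ?S X q v F" "\<And>m w. w \<in> ?H m \<Longrightarrow> F m w = u m w" by blast
  have "lift_on (simplex n) ?S ?T q' v (\<lambda>m w. c m (F m w))"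
    using lift_onD[OF F(1)] q'(1) act_T by (intro lift_onI) auto
  moreover have "c m (F m w) = f m w" if "w \<in> ?H m" for m w using F(2) u that by simp
  ultimately show "\<exists>f'. lift_on (simplex n) ?S ?T q' v f' \<and> (\<forall>m. \<forall>w\<in>?H m. f' m w = f m w)"
    by blast
qed

lemma small_map_transport:
  assumes "small_map \<kappa> X Y q" "\<And>n x. x \<in> cells X n \<Longrightarrow> q' n (c n x) = q n x"
  shows "small_map \<kappa> (transport X c) Y q'"
  unfolding small_map_def
proof (intro allI ballI)
  fix n b assume "b \<in> cells Y n"
  then have "|{x \<in> cells X n. q n x = b}| <o \<kappa>" using assms(1) by (simp add: small_map_def)
  moreover have "{y \<in> cells (transport X c) n. q' n y = b} = c n ` {x \<in> cells X n. q n x = b}"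
    using assms(2) by auto
  ultimately show "|{y \<in> cells (transport X c) n. q' n y = b}| <o \<kappa>"
    by (simp only: ordLeq_ordLess_trans[OF card_of_image])
qed

text \<open>A fibre below \<kappa> embeds into the field of \<kappa>, hence into \<open>'k\<close>.
  Injectivity on each fibre is enough because the base simplex is kept beside the label.\<close>

lemma fibre_code:
  fixes \<kappa> :: "'k rel"
  assumes \<kappa>: "Card_order \<kappa>" and small: "small_map \<kappa> D A q"
  obtains c :: "nat \<Rightarrow> 'd \<Rightarrow> 'k" where "\<And>n a. a \<in> cells A n \<Longrightarrow> inj_on (c n) {d \<in> cells D n. q n d = a}"
proof -
  have ex: "\<exists>g :: 'd \<Rightarrow> 'k. inj_on g {d \<in> cells D n. q n d = a}" if "a \<in> cells A n" for n a
  proof -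
    have "|{d \<in> cells D n. q n d = a}| \<le>o \<kappa>"
      using small that ordLess_imp_ordLeq by (auto simp: small_map_def)
    also have "\<kappa> =o |Field \<kappa>|" using card_of_Field_ordIso[OF \<kappa>] ordIso_symmetric by blast
    finally show ?thesis unfolding card_of_ordLeq[symmetric] by blast
  qed
  define G :: "nat \<Rightarrow> 'a \<Rightarrow> 'd \<Rightarrow> 'k" where "G n a = (SOME g. inj_on g {d \<in> cells D n. q n d = a})" for n a
  have G: "inj_on (G n a) {d \<in> cells D n. q n d = a}" if "a \<in> cells A n" for n a
    unfolding G_def by (rule someI_ex[OF ex[OF that]])
  show thesis
  proof (rule that[of "\<lambda>n d. G n (q n d) d"])
    show "inj_on (\<lambda>d. G n (q n d) d) {d \<in> cells D n. q n d = a}" if "a \<in> cells A n" for n a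
      using G[OF that] by (auto simp: inj_on_def)
  qed
qed

lemma fib_over_transport:
  assumes kan: "kan_fibration D A q" and small: "small_map \<kappa> D A q"
    and c: "\<And>n a. a \<in> cells A n \<Longrightarrow> inj_on (c n) {d \<in> cells D n. q n d = a}"
  shows "fib_over \<kappa> A (transport D (\<lambda>n d. (q n d, c n d)))"
    and "inj_on (\<lambda>d. (q n d, c n d)) (cells D n)"
proof -
  have q: "q \<in> smaps D A" using kan by (simp add: kan_fibration_def)
  show inj: "inj_on (\<lambda>d. (q n d, c n d)) (cells D n)" for n
    using c smaps_cell[OF q] by (auto simp: inj_on_def)
  let ?T = "transport D (\<lambda>n d. (q n d, c n d))"
  have "kan_fibration ?T A (pr1 ?T)"
    by (rule kan_fibration_transport[OF kan inj]) (auto simp: pr1_def)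
  moreover have "small_map \<kappa> ?T A (pr1 ?T)"
    by (rule small_map_transport[OF small]) (auto simp: pr1_def)
  ultimately show "fib_over \<kappa> A ?T" by (simp add: fib_over_def)
qed


section \<open>Horn fillers\<close>

text \<open>A filler is a single cell and not a map out of the simplex; in this form fillers can be
  chosen one by one and a subcomplex closed under the choices.\<close>

definition horn_fillable :: "'u sset \<Rightarrow> bool" where
  "horn_fillable U \<longleftrightarrow> (\<forall>n k f. 1 \<le> n \<longrightarrow> k \<le> n \<longrightarrow> smap_on (simplex n) (cells (horn n k)) U f \<longrightarrow>
     (\<exists>X \<in> cells U n. \<forall>m. \<forall>\<alpha> \<in> cells (horn n k) m. act U m n \<alpha> X = f m \<alpha>))"

lemma to_point_smaps: "simplicial_set X \<Longrightarrow> to_point X \<in> smaps X (simplex 0)"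
  unfolding smaps_def to_point_def
  using simplicial_setD(1) by (fastforce simp: simplex_hom_iff compose_def fun_eq_iff)

lemma horn_fillable_kan_complex:
  assumes U: "simplicial_set U" and fill: "horn_fillable U"
  shows "kan_complex U"
  unfolding kan_complex_def
proof (rule kan_fibrationI[OF U simplicial_set_simplex to_point_smaps[OF U]])
  fix n k v f
  assume nk: "1 \<le> n" "k \<le> n" and v: "smap_on (simplex n) (cells (simplex n)) (simplex 0) v"
    and f: "lift_on (simplex n) (cells (horn n k)) U (to_point U) v f"
  have "smap_on (simplex n) (cells (horn n k)) U f" using f by (simp add: lift_on_def)
  then obtain X where X: "X \<in> cells U n" "\<And>m \<alpha>. \<alpha> \<in> cells (horn n k) m \<Longrightarrow> act U m n \<alpha> X = f m \<alpha>"
    using fill nk unfolding horn_fillable_def by blast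
  have point: "x = y" if "x \<in> simplex_hom m 0" "y \<in> simplex_hom m 0" for x y m
    using simplex_hom_eqI[OF that] simplex_homD(1)[OF that(1)] simplex_homD(1)[OF that(2)] by force
  have "lift_on (simplex n) (cells (simplex n)) U (to_point U) v (\<lambda>m \<alpha>. act U m n \<alpha> X)"
  proof (rule lift_onI)
    fix m \<alpha> assume a: "\<alpha> \<in> cells (simplex n) m"
    then show c: "act U m n \<alpha> X \<in> cells U m" using simplicial_setD(1)[OF U] X(1) by simp
    show "to_point U m (act U m n \<alpha> X) = v m \<alpha>"
      using smaps_cell[OF to_point_smaps[OF U] c] smap_onD(1)[OF v a] by (intro point[of _ m]) simp_all
  next
    fix l m \<alpha> \<beta> assume "\<alpha> \<in> simplex_hom l m" "\<beta> \<in> cells (simplex n) m"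
    then show "act U l n (act (simplex n) l m \<alpha> \<beta>) X = act U l m \<alpha> (act U m n \<beta> X)"
      using simplicial_setD(3)[OF U _ _ X(1)] by simp
  qed
  then show "\<exists>f'. lift_on (simplex n) (cells (simplex n)) U (to_point U) v f' \<and>
      (\<forall>m. \<forall>w\<in>cells (horn n k) m. f' m w = f m w)" using X(2) by blast
qed

text \<open>A horn in the universe amounts to a fibration Y over the horn, which
  \<open>horn_fibration_extension\<close> extends to the simplex, but with simplices of another
  type. A relabelling that keeps the labels of Y makes the extension restrict to the given horn by
  equality.\<close>

theorem univ_horn_fillable:
  fixes \<kappa> :: "'k rel"
  assumes \<kappa>: "Card_order \<kappa>" "infinite (Field \<kappa>)"
  shows "horn_fillable (univ \<kappa>)"
  unfolding horn_fillable_def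
proof (intro allI impI)
  fix N k f assume N: "1 \<le> N" "k \<le> N" and f0: "smap_on (simplex N) (cells (horn N k)) (univ \<kappa>) f"
  let ?H = "horn N k"
  have f: "smap_on ?H (cells ?H) (univ \<kappa>) f" using f0 by (simp add: smap_on_def)
  define Y where "Y = total ?H f"
  have Y: "fib_over \<kappa> ?H Y" unfolding Y_def by (rule total_fib_over[OF simplicial_set_horn f])
  note YD = fib_overD[OF Y]
  obtain E :: "((nat \<Rightarrow> nat) \<times> ((nat \<Rightarrow> nat) \<times> 'k) \<times> (nat \<Rightarrow> (nat \<Rightarrow> nat) \<Rightarrow> ((nat \<Rightarrow> nat) \<times> 'k))) sset" and p r
    where E: "kan_fibration E (simplex N) p" "small_map \<kappa> E (simplex N) p" "r \<in> smaps Y E"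
      and r_bij: "\<And>n. bij_betw (r n) (cells Y n) {x \<in> cells E n. p n x \<in> cells ?H n}"
      and p_r: "\<And>n d. d \<in> cells Y n \<Longrightarrow> p n (r n d) = pr1 Y n d"
    by (rule horn_fibration_extension[OF N YD(3) \<kappa> YD(4)]) (rule that)
  have p_r': "p n (r n d) = fst d" if "d \<in> cells Y n" for n d using p_r[OF that] that by (simp add: pr1_def)
  obtain c0 :: "nat \<Rightarrow> _ \<Rightarrow> 'k" where c0: "\<And>n a. a \<in> cells (simplex N) n \<Longrightarrow> inj_on (c0 n) {d \<in> cells E n. p n d = a}"
    by (rule fibre_code[OF \<kappa>(1) E(2)]) (rule that)
  \<comment> \<open>Over the horn the label of Y is kept; elsewhere any fibrewise code in
    \<open>'k\<close> will do. The two kinds of label never meet in one fibre, so fibrewise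
    injectivity survives.\<close>
  define c where "c n x = (if p n x \<in> cells ?H n then snd (inv_into (cells Y n) (r n) x) else c0 n x)" for n x
  have inv_r: "inv_into (cells Y n) (r n) (r n d) = d" if "d \<in> cells Y n" for n d
    using r_bij[of n] that by (simp add: bij_betw_def)
  have fst_Y: "fst d \<in> cells ?H n" if "d \<in> cells Y n" for n d using YD(5)[OF that] .
  have c_r: "c n (r n d) = snd d" if "d \<in> cells Y n" for n d
    using p_r'[OF that] fst_Y[OF that] inv_r[OF that] by (simp add: c_def)
  have r_pre: "\<exists>d\<in>cells Y n. z = r n d" if z: "z \<in> cells E n" "p n z \<in> cells ?H n" for n z
  proof -
    have "z \<in> r n ` cells Y n" using bij_betw_imp_surj_on[OF r_bij[of n]] z by simp
    then show ?thesis by blast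
  qed
  have c_inj: "inj_on (c n) {d \<in> cells E n. p n d = a}" if a: "a \<in> cells (simplex N) n" for n a
  proof (cases "a \<in> cells ?H n")
    case True
    show ?thesis
    proof (rule inj_onI)
      fix x y assume x: "x \<in> {d \<in> cells E n. p n d = a}" and y: "y \<in> {d \<in> cells E n. p n d = a}" and eq: "c n x = c n y"
      obtain d d' where d: "d \<in> cells Y n" "x = r n d" "d' \<in> cells Y n" "y = r n d'"
        using x y True r_pre[of x n] r_pre[of y n] by auto
      have "fst d = fst d'" using x y d p_r' by simp
      moreover have "snd d = snd d'" using eq d c_r by simp
      ultimately have "d = d'" by (rule prod_eqI)
      then show "x = y" using d by simp
    qed
  next
    case False
    then have "inj_on (c n) {d \<in> cells E n. p n d = a} = inj_on (c0 n) {d \<in> cells E n. p n d = a}"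
      by (intro inj_on_cong) (auto simp: c_def)
    then show ?thesis using c0[OF a] by simp
  qed
  let ?c = "\<lambda>n x. (p n x, c n x)"
  define X where "X = transport E ?c"
  have X: "fib_over \<kappa> (simplex N) X" and inj: "\<And>n. inj_on (?c n) (cells E n)"
    unfolding X_def using fib_over_transport[OF E(1,2) c_inj] by blast+
  have cells_X: "(\<gamma>, x) \<in> cells X l \<longleftrightarrow> (\<gamma>, x) \<in> cells Y l" if g: "\<gamma> \<in> cells ?H l" for \<gamma> x l
  proof
    assume "(\<gamma>, x) \<in> cells X l"
    then obtain z where z: "z \<in> cells E l" "\<gamma> = p l z" "x = c l z" by (auto simp: X_def)
    then obtain d where d: "d \<in> cells Y l" "z = r l d" using g r_pre[of z l] by auto
    have "fst d = \<gamma>" "snd d = x" using z d p_r' c_r by simp_all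
    then show "(\<gamma>, x) \<in> cells Y l" using d(1) by force
  next
    assume y: "(\<gamma>, x) \<in> cells Y l"
    then have "(\<gamma>, x) = ?c l (r l (\<gamma>, x))" using p_r' c_r by simp
    then show "(\<gamma>, x) \<in> cells X l" unfolding X_def cells_transport using smaps_cell[OF E(3) y] by blast
  qed
  have act_X: "act X i l \<beta> (\<gamma>, x) = act Y i l \<beta> (\<gamma>, x)" if y: "(\<gamma>, x) \<in> cells Y l" and b: "\<beta> \<in> simplex_hom i l" for \<gamma> x l i \<beta>
  proof -
    have "act X i l \<beta> (\<gamma>, x) = act X i l \<beta> (?c l (r l (\<gamma>, x)))" using p_r'[OF y] c_r[OF y] by simp
    also have "\<dots> = ?c i (act E i l \<beta> (r l (\<gamma>, x)))"
      unfolding X_def using act_transport[of ?c l E "r l (\<gamma>, x)" i \<beta>] inj smaps_cell[OF E(3) y] by simp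
    also have "\<dots> = ?c i (r i (act Y i l \<beta> (\<gamma>, x)))" using smaps_actD[OF E(3) b y] by simp
    also have "\<dots> = act Y i l \<beta> (\<gamma>, x)"
      using simplicial_setD(1)[OF YD(1) b y] p_r' c_r by simp
    finally show ?thesis .
  qed
  have cls: "classify (simplex N) X m \<alpha> = f m \<alpha>" if a: "\<alpha> \<in> cells ?H m" for m \<alpha>
  proof -
    have "classify (simplex N) X m \<alpha> = classify ?H Y m \<alpha>"
    proof (rule classify_eqI)
      fix l \<gamma> x assume g: "\<gamma> \<in> simplex_hom l m"
      have ag: "act ?H l m \<gamma> \<alpha> \<in> cells ?H l" using horn_act[OF g a] by simp
      show 1: "(act (simplex N) l m \<gamma> \<alpha>, x) \<in> cells X l \<longleftrightarrow> (act ?H l m \<gamma> \<alpha>, x) \<in> cells Y l"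
        using cells_X[OF ag] by simp
      fix i \<beta> assume "\<beta> \<in> simplex_hom i l" "(act (simplex N) l m \<gamma> \<alpha>, x) \<in> cells X l"
      then show "snd (act X i l \<beta> (act (simplex N) l m \<gamma> \<alpha>, x)) = snd (act Y i l \<beta> (act ?H l m \<gamma> \<alpha>, x))"
        using 1 act_X by simp
    qed
    also have "\<dots> = f m \<alpha>" unfolding Y_def by (rule classify_total[OF simplicial_set_horn f a])
    finally show ?thesis .
  qed
  \<comment> \<open>X has the right restriction but its action need not be normalised; pulling it
    back along the identity makes it a cell of the universe.\<close>
  let ?X = "classify (simplex N) X N (ident N)"
  have "?X \<in> cells (univ \<kappa>) N"
    using smap_onD(1)[OF smap_on_classify[OF X], of "ident N" N] by simp
  moreover have "act (univ \<kappa>) m N \<alpha> ?X = f m \<alpha>" if a: "\<alpha> \<in> cells ?H m" for m \<alpha>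
  proof -
    have aS: "\<alpha> \<in> simplex_hom m N" using horn_cell[OF a] by simp
    have "act (univ \<kappa>) m N \<alpha> ?X = classify (simplex N) X m \<alpha>"
      using smap_onD(2)[OF smap_on_classify[OF X] aS, of "ident N"] compose_ident_left[OF aS] by simp
    then show ?thesis using cls[OF a] by simp
  qed
  ultimately show "\<exists>X\<in>cells (univ \<kappa>) N. \<forall>m. \<forall>\<alpha>\<in>cells ?H m. act (univ \<kappa>) m N \<alpha> X = f m \<alpha>" by blast
qed

text \<open>Being at most the cardinality of C is being below its successor cardinal, which reduces
  the bound to the strict one.\<close>

lemma finite_PiE_ordLeq:
  assumes C: "infinite C" and G: "finite G" and A: "\<And>g. g \<in> G \<Longrightarrow> |A g| \<le>o |C|"
  shows "|PiE G A| \<le>o |C|"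
proof -
  let ?\<kappa> = "cardSuc |C|"
  have \<kappa>: "Card_order ?\<kappa>" "infinite (Field ?\<kappa>)"
    using C cardSuc_finite[OF card_of_Card_order[of C]] cardSuc_Card_order[OF card_of_Card_order[of C]]
    by (simp_all only: Field_card_of not_False_eq_True)
  have iff: "|Z| \<le>o |C| \<longleftrightarrow> |Z| <o ?\<kappa>" for Z
    using cardSuc_ordLeq_ordLess[of "|C|" "|Z|"] by (simp add: card_of_Card_order)
  show ?thesis using finite_PiE_ordLess[OF \<kappa> G, of A] A unfolding iff by blast
qed

text \<open>
  The hull of the image of \<open>\<chi>\<close> under the simplicial action and under chosen horn fillers.  A horn
  is determined by its cells in dimensions \<open>\<le> n\<close>, finitely many, so each round adds no more
  cells than the cardinality of \<open>'c\<close>.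
\<close>

theorem small_kan_hull:
  fixes U :: "'u sset" and A :: "'a sset" and \<chi> :: "nat \<Rightarrow> 'a \<Rightarrow> 'u"
  assumes U: "simplicial_set U" and fill: "horn_fillable U" and \<chi>: "smap_on A (cells A) U \<chi>"
    and A: "simplicial_set A"
    and inf: "infinite (UNIV :: 'c set)" and le: "|UNIV :: 'a set| \<le>o |UNIV :: 'c set|"
  obtains K :: "'c sset" and i \<iota> where "kan_complex K" "i \<in> smaps A K" "smap_on K (cells K) U \<iota>"
    "\<And>n a. a \<in> cells A n \<Longrightarrow> \<iota> n (i n a) = \<chi> n a"
proof -
  let ?r = "|UNIV :: 'c set|"
  note UD = simplicial_setD[OF U]
  define G where "G n k = (SIGMA l:{..n}. cells (horn n k) l)" for n k
  have finG: "finite (G n k)" for n k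
    unfolding G_def by (intro finite_SigmaI finite_subset[OF _ finite_simplex_hom]) (auto dest: horn_cell)
  \<comment> \<open>The choice depends only on the values on the finite set \<open>G n k\<close>, so
    counting such assignments of values bounds the number of fillers added.\<close>
  define sol where "sol n k F = (SOME X. X \<in> cells U n \<and> (\<forall>(l, \<alpha>) \<in> G n k. act U l n \<alpha> X = F (l, \<alpha>)))" for n k F
  define acts where "acts S n = (\<Union>m. \<Union>\<alpha> \<in> simplex_hom n m. act U n m \<alpha> ` S m)"
    for S :: "nat \<Rightarrow> 'u set" and n
  define fills where "fills S n = cells U n \<inter> (\<Union>k\<in>{..n}. sol n k ` PiE (G n k) (\<lambda>(l, \<alpha>). S l))"
    for S :: "nat \<Rightarrow> 'u set" and n
  define R where "R = rec_nat (\<lambda>n. \<chi> n ` cells A n) (\<lambda>_ S n. S n \<union> acts S n \<union> fills S n)"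
  have R0: "R 0 n = \<chi> n ` cells A n" and RS: "R (Suc t) n = R t n \<union> acts (R t) n \<union> fills (R t) n" for t n
    by (simp_all add: R_def)
  define K where "K n = (\<Union>t. R t n)" for n
  have mono: "R s n \<subseteq> R t n" if "s \<le> t" for s t n
    using that by (induction t rule: dec_induct) (auto simp: RS)
  have RU: "R t n \<subseteq> cells U n" for t n
  proof (induction t arbitrary: n)
    case 0 then show ?case using smap_onD(1)[OF \<chi>] by (auto simp: R0)
  next
    case (Suc t) then show ?case using UD(1) by (fastforce simp: RS acts_def fills_def)
  qed
  have nat_le: "|UNIV :: nat set| \<le>o ?r" using inf infinite_iff_card_of_nat by blast
  have Rr: "|R t n| \<le>o ?r" for t n
  proof (induction t arbitrary: n)
    case 0
    have "|\<chi> n ` cells A n| \<le>o |cells A n|" by (rule card_of_image)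
    also have "|cells A n| \<le>o |UNIV :: 'a set|" by (rule card_of_mono1) simp
    also note le
    finally show ?case by (simp add: R0)
  next
    case (Suc t)
    have img: "|g ` Z| \<le>o ?r" if "|Z| \<le>o ?r" for g :: "'z \<Rightarrow> 'u" and Z
      using ordLeq_transitive[OF card_of_image that] .
    have fin: "|Z| \<le>o ?r" if "finite Z" for Z :: "'z set"
      using finite_ordLess_infinite_card[OF card_of_Card_order _ that] inf ordLess_imp_ordLeq
      by (metis Field_card_of)
    have "|acts (R t) n| \<le>o ?r"
      unfolding acts_def
      by (intro card_of_UNION_ordLeq_infinite[OF inf] ballI nat_le fin img Suc finite_simplex_hom)
    moreover have "|fills (R t) n| \<le>o ?r"
    proof -
      have "|PiE (G n k) (\<lambda>(l, \<alpha>). R t l)| \<le>o ?r" for k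
        by (rule finite_PiE_ordLeq[OF inf finG]) (auto intro: Suc)
      then have "|\<Union>k\<in>{..n}. sol n k ` PiE (G n k) (\<lambda>(l, \<alpha>). R t l)| \<le>o ?r"
        by (intro card_of_UNION_ordLeq_infinite[OF inf fin[OF finite_atMost]] ballI img) blast
      then show ?thesis unfolding fills_def by (rule ordLeq_transitive[OF card_of_mono1[OF Int_lower2]])
    qed
    ultimately show ?case
      unfolding RS using Suc inf
      by (intro card_of_Un_ordLeq_infinite_Field card_of_Card_order) (simp_all add: Field_card_of)
  qed
  have Kr: "|K n| \<le>o ?r" for n
    unfolding K_def by (rule card_of_UNION_ordLeq_infinite[OF inf nat_le]) (auto intro: Rr)
  have K: "subcomplex U K"
  proof (rule subcomplexI)
    show "w \<in> cells U n" if "w \<in> K n" for n w using that RU by (auto simp: K_def)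
    show "act U m n \<alpha> w \<in> K m" if a: "\<alpha> \<in> simplex_hom m n" and w: "w \<in> K n" for m n \<alpha> w
    proof -
      obtain t where "w \<in> R t n" using w by (auto simp: K_def)
      then have "act U m n \<alpha> w \<in> acts (R t) m" using a by (force simp: acts_def)
      then have "act U m n \<alpha> w \<in> R (Suc t) m" by (simp add: RS)
      then show ?thesis unfolding K_def by blast
    qed
  qed
  let ?K = "restr_cells U K"
  have Ks: "simplicial_set ?K" by (rule simplicial_set_restr_cells[OF U K])
  have "horn_fillable ?K"
    unfolding horn_fillable_def
  proof (intro allI impI)
    fix n k f assume n: "1 \<le> n" "k \<le> n" and f: "smap_on (simplex n) (cells (horn n k)) ?K f"
    have fU: "smap_on (simplex n) (cells (horn n k)) U f"
      using f subcomplexD(1)[OF K] by (simp add: smap_on_def)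
    then obtain X0 where X0: "X0 \<in> cells U n" "\<And>m \<alpha>. \<alpha> \<in> cells (horn n k) m \<Longrightarrow> act U m n \<alpha> X0 = f m \<alpha>"
      using fill n unfolding horn_fillable_def by blast
    have "\<forall>z\<in>G n k. \<exists>t. f (fst z) (snd z) \<in> R t (fst z)"
      using smap_onD(1)[OF f] by (auto simp: G_def K_def)
    then obtain T where T: "\<And>z. z \<in> G n k \<Longrightarrow> f (fst z) (snd z) \<in> R (T z) (fst z)" by metis
    \<comment> \<open>The finitely many values of the horn occur in finitely many rounds, so a
      single round t contains them all and the next one contains the chosen filler. The inserted 0
      gives \<open>Max\<close> a nonempty argument.\<close>
    define t where "t = Max (insert 0 (T ` G n k))"
    have Tt: "T z \<le> t" if "z \<in> G n k" for z using that finG by (simp add: t_def)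
    define F where "F = (\<lambda>z\<in>G n k. f (fst z) (snd z))"
    have F: "F \<in> PiE (G n k) (\<lambda>(l, \<alpha>). R t l)"
      using T mono[OF Tt] unfolding F_def by fastforce
    define X where "X = sol n k F"
    have "X0 \<in> cells U n \<and> (\<forall>(l, \<alpha>) \<in> G n k. act U l n \<alpha> X0 = F (l, \<alpha>))"
      using X0 by (auto simp: F_def G_def)
    then have X: "X \<in> cells U n \<and> (\<forall>(l, \<alpha>) \<in> G n k. act U l n \<alpha> X = F (l, \<alpha>))"
      unfolding X_def sol_def by (rule someI)
    have "X \<in> fills (R t) n" unfolding fills_def using X F n(2) by (auto simp: X_def)
    then have "X \<in> R (Suc t) n" by (simp add: RS)
    then have "X \<in> K n" unfolding K_def by blast
    moreover have "act U m n \<alpha> X = f m \<alpha>" if "\<alpha> \<in> cells (horn n k) m" for m \<alpha>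
    proof (rule smap_on_determined[OF subcomplex_horn _ fU _ that])
      have h: "\<alpha> \<in> simplex_hom m n" if "\<alpha> \<in> cells (horn n k) m" for m \<alpha> using horn_cell[OF that] by simp
      show "smap_on (simplex n) (cells (horn n k)) U (\<lambda>m \<alpha>. act U m n \<alpha> X)"
        using X UD(1,3) h by (intro smap_onI) auto
      show "act U l n \<alpha> X = f l \<alpha>" if "l \<le> n" "\<alpha> \<in> cells (horn n k) l" for l \<alpha>
        using X that by (auto simp: G_def F_def)
    qed
    ultimately show "\<exists>X\<in>cells ?K n. \<forall>m. \<forall>\<alpha>\<in>cells (horn n k) m. act ?K m n \<alpha> X = f m \<alpha>" by auto
  qed
  then have kanK: "kan_complex ?K" by (rule horn_fillable_kan_complex[OF Ks])
  \<comment> \<open>So far the hull consists of cells of U. Levelwise injections move it into the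
    type \<open>'c\<close>, and \<iota> will undo them.\<close>
  have "\<exists>c :: 'u \<Rightarrow> 'c. inj_on c (K n)" for n using Kr[of n] unfolding card_of_ordLeq[symmetric] by blast
  then obtain c :: "nat \<Rightarrow> 'u \<Rightarrow> 'c" where c: "\<And>n. inj_on (c n) (K n)" by metis
  let ?T = "transport ?K c"
  have c': "inj_on (c n) (cells ?K n)" for n using c by simp
  have T: "simplicial_set ?T" by (rule simplicial_set_transport[OF Ks c'])
  have "kan_fibration ?T (simplex 0) (to_point ?T)"
    by (rule kan_fibration_transport[OF kanK[unfolded kan_complex_def] c']) (auto simp: to_point_def)
  then have kanT: "kan_complex ?T" by (simp add: kan_complex_def)
  have \<chi>K: "\<chi> n a \<in> K n" if "a \<in> cells A n" for n a
    using that R0[of n] unfolding K_def by blast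
  define i where "i n = (\<lambda>a\<in>cells A n. c n (\<chi> n a))" for n
  define \<iota> where "\<iota> n = inv_into (K n) (c n)" for n
  have act_T: "act ?T m n \<alpha> (c n x) = c m (act U m n \<alpha> x)" if "x \<in> K n" for m n \<alpha> x
    using act_transport[of c n ?K x m \<alpha>] c'[of n] that by simp
  have \<iota>: "\<iota> n (c n x) = x" if "x \<in> K n" for n x using c that by (simp add: \<iota>_def)
  show thesis
  proof (rule that[OF kanT, of i \<iota>])
    show "i \<in> smaps A ?T"
      using \<chi>K smap_onD(2)[OF \<chi>] simplicial_setD(1)[OF A] act_T unfolding smaps_def i_def by auto
    show "smap_on ?T (cells ?T) U \<iota>"
      using \<iota> act_T subcomplexD[OF K] by (intro smap_onI) auto
    show "\<iota> n (i n a) = \<chi> n a" if "a \<in> cells A n" for n a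
      using \<iota> \<chi>K that by (simp add: i_def)
  qed
qed


section \<open>Extension along trivial cofibrations\<close>

text \<open>This is homotopy lifting for the projection of K to a point, with H moved from A to its
  image in B. Both ends are left open so that a homotopy can be traversed in either
  direction.\<close>

lemma homotopy_extension:
  assumes K: "kan_complex K" and A: "simplicial_set A" and B: "simplicial_set B" and j: "smono A B j"
    and f: "f \<in> smaps B K" and e: "e \<le> 1" "e' \<le> 1"
    and H: "smap_on (cyl A) (cells (cyl A)) K H"
    and He: "\<And>n a. a \<in> cells A n \<Longrightarrow> H n (a, endpt e n) = f n (j n a)"
  obtains f' where "f' \<in> smaps B K" "\<And>n a. a \<in> cells A n \<Longrightarrow> f' n (j n a) = H n (a, endpt e' n)"
proof -
  have jm: "j \<in> smaps A B" and inj: "inj_on (j n) (cells A n)" for n using j by (auto simp: smono_def)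
  let ?A = "\<lambda>n. j n ` cells A n"
  let ?v = "\<lambda>n w. endpt 0 n :: nat \<Rightarrow> nat"
  have sub: "subcomplex B ?A"
  proof (rule subcomplexI)
    show "act B m n \<alpha> w \<in> ?A m" if "\<alpha> \<in> simplex_hom m n" "w \<in> ?A n" for m n \<alpha> w
      using that smaps_actD[OF jm, symmetric] simplicial_setD(1)[OF A] by auto
  qed (use smaps_cell[OF jm] in auto)
  have point: "to_point K n x = endpt 0 n" if "x \<in> cells K n" for n x
    using that by (simp add: to_point_def endpt_def)
  have v: "smap_on (cyl B) (cells (cyl B)) (simplex 0) ?v"
    by (intro smap_onI) (auto simp: endpt_hom compose_endpt)
  have f0: "lift_on B (cells B) K (to_point K) (\<lambda>n b. ?v n (b, endpt e n)) f"
    using smaps_cell[OF f] smaps_actD[OF f] point by (intro lift_onI) auto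
  let ?i = "\<lambda>n. inv_into (cells A n) (j n)"
  have i: "?i n (j n a) = a" if "a \<in> cells A n" for n a using inj that by simp
  note HD = smap_onD[OF H]
  have f1: "lift_on (cyl B) (\<lambda>n. ?A n \<times> simplex_hom n 1) K (to_point K) ?v (\<lambda>n w. H n (?i n (fst w), snd w))"
  proof (rule lift_onI)
    fix n w assume w: "w \<in> ?A n \<times> simplex_hom n 1"
    then obtain a \<tau> where a: "w = (j n a, \<tau>)" "a \<in> cells A n" "\<tau> \<in> simplex_hom n 1" by auto
    then show c: "H n (?i n (fst w), snd w) \<in> cells K n" using HD(1) i by simp
    show "to_point K n (H n (?i n (fst w), snd w)) = ?v n w" by (rule point[OF c])
    fix m \<alpha> assume \<alpha>: "\<alpha> \<in> simplex_hom m n"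
    have "act B m n \<alpha> (j n a) = j m (act A m n \<alpha> a)" using smaps_actD[OF jm \<alpha> a(2)] by simp
    then show "H m (?i m (fst (act (cyl B) m n \<alpha> w)), snd (act (cyl B) m n \<alpha> w)) =
        act K m n \<alpha> (H n (?i n (fst w), snd w))"
      using HD(2)[OF \<alpha>, of "(a, \<tau>)"] a i simplicial_setD(1)[OF A \<alpha> a(2)] by simp
  qed
  have compat: "H n (?i n (fst (b, endpt e n)), snd (b, endpt e n)) = f n b" if "b \<in> ?A n" for n b
    using that He i by auto
  obtain F where F: "lift_on (cyl B) (cells (cyl B)) K (to_point K) ?v F"
    and FA: "\<And>n b \<tau>. b \<in> ?A n \<Longrightarrow> \<tau> \<in> simplex_hom n 1 \<Longrightarrow> F n (b, \<tau>) = H n (?i n b, \<tau>)"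
    by (rule homotopy_lifting[OF K[unfolded kan_complex_def] e(1) B sub v f0 f1 compat]) auto
  note FD = lift_onD(1,2)[OF F]
  let ?f' = "\<lambda>n. \<lambda>b\<in>cells B n. F n (b, endpt e' n)"
  show thesis
  proof (rule that[of ?f'])
    have "F m (act B m n \<alpha> b, endpt e' m) = act K m n \<alpha> (F n (b, endpt e' n))"
      if "\<alpha> \<in> simplex_hom m n" "b \<in> cells B n" for m n \<alpha> b
      using FD(2)[OF that(1), of "(b, endpt e' n)"] that endpt_hom[OF e(2)] by (simp add: compose_endpt)
    then show "?f' \<in> smaps B K"
      using FD(1) endpt_hom[OF e(2)] simplicial_setD(1)[OF B] unfolding smaps_def by auto
    show "?f' n (j n a) = H n (a, endpt e' n)" if "a \<in> cells A n" for n a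
      using FA[of "j n a" n] that i endpt_hom[OF e(2)] smaps_cell[OF jm that] by simp
  qed
qed

text \<open>Surjectivity on homotopy classes yields a map on B whose restriction is joined to i only
  by a zigzag of elementary homotopies. Each link is absorbed by \<open>homotopy_extension\<close>,
  starting from whichever end is already extended, until the restriction is i itself.\<close>

lemma trivial_cofibration_extend:
  fixes A :: "'a sset" and B :: "'b sset" and K :: "('a + 'b + nat) sset"
  assumes j: "trivial_cofibration A B j" and K: "kan_complex K" and i: "i \<in> smaps A K"
  obtains f where "f \<in> smaps B K" "smap_comp A f j = i"
proof -
  have A: "simplicial_set A" and B: "simplicial_set B" and jm: "smono A B j"
    and w: "bij_betw (precomp_class A K j) (homotopy_classes B K) (homotopy_classes A K)"
    using j K by (auto simp: trivial_cofibration_def weak_homotopy_equivalence_def)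
  have js: "j \<in> smaps A B" using jm by (simp add: smono_def)
  note eqA = equiv_homotopy_rel[of A K] and eqB = equiv_homotopy_rel[of B K]
  have "homotopy_rel A K `` {i} \<in> homotopy_classes A K"
    unfolding homotopy_classes_def using i by (rule quotientI)
  then have "homotopy_rel A K `` {i} \<in> precomp_class A K j ` homotopy_classes B K"
    using w by (simp add: bij_betw_def)
  then obtain C where C: "C \<in> homotopy_classes B K" "precomp_class A K j C = homotopy_rel A K `` {i}"
    by (elim imageE) simp
  obtain f where f: "f \<in> smaps B K" "C = homotopy_rel B K `` {f}"
    using C(1) unfolding homotopy_classes_def by (rule quotientE)
  have fC: "f \<in> C" unfolding f(2) by (rule equiv_class_self[OF eqB f(1)])
  have fj: "smap_comp A f j \<in> smaps A K" by (rule smap_comp_in_smaps[OF A js f(1)])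
  then have "smap_comp A f j \<in> precomp_class A K j C"
    unfolding precomp_class_def using fC equiv_class_self[OF eqA fj] by blast
  then have "(i, smap_comp A f j) \<in> homotopy_rel A K" unfolding C(2) by blast
  then have zz: "equivclp (elementary_homotopy A K) (smap_comp A f j) i"
    by (auto simp: homotopy_rel_def intro: equivclp_sym)
  have ext: "\<exists>f'\<in>smaps B K. smap_comp A f' j = g'"
    if f: "f \<in> smaps B K" and h: "elementary_homotopy A K (smap_comp A f j) g' \<or> elementary_homotopy A K g' (smap_comp A f j)"
    for f g'
  proof -
    have g': "g' \<in> smaps A K" using h by (auto simp: elementary_homotopy_def)
    obtain e e' H where ee: "e \<le> 1" "e' \<le> 1" and H: "H \<in> smaps (cyl A) K"
      and He: "\<And>n x. x \<in> cells A n \<Longrightarrow> H n (x, endpt e n) = smap_comp A f j n x"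
      and He': "\<And>n x. x \<in> cells A n \<Longrightarrow> H n (x, endpt e' n) = g' n x"
      using h
    proof
      assume "elementary_homotopy A K (smap_comp A f j) g'"
      then obtain H where "H \<in> smaps (cyl A) K" "\<forall>n. \<forall>x\<in>cells A n. H n (x, endpt 0 n) = smap_comp A f j n x \<and> H n (x, endpt 1 n) = g' n x"
        unfolding elementary_homotopy_def endpt_def by blast
      then show thesis using that[of 0 1 H] by simp
    next
      assume "elementary_homotopy A K g' (smap_comp A f j)"
      then obtain H where "H \<in> smaps (cyl A) K" "\<forall>n. \<forall>x\<in>cells A n. H n (x, endpt 0 n) = g' n x \<and> H n (x, endpt 1 n) = smap_comp A f j n x"
        unfolding elementary_homotopy_def endpt_def by blast
      then show thesis using that[of 1 0 H] by simp
    qed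
    have "H n (a, endpt e n) = f n (j n a)" if "a \<in> cells A n" for n a
      using He[OF that] that by (simp add: smap_comp_apply)
    from homotopy_extension[OF K A B jm f ee smap_on_smaps[OF H] this] obtain f'
      where f': "f' \<in> smaps B K" "\<And>n a. a \<in> cells A n \<Longrightarrow> f' n (j n a) = H n (a, endpt e' n)" by metis
    have "smap_comp A f' j = g'"
      by (rule smaps_eqI[OF smap_comp_in_smaps[OF A js f'(1)] g']) (simp add: smap_comp_apply f'(2) He')
    then show ?thesis using f'(1) by blast
  qed
  from zz have "\<exists>f'\<in>smaps B K. smap_comp A f' j = i"
  proof (induction rule: equivclp_induct)
    case base then show ?case using f(1) by blast
  next
    case (step y z)
    then obtain f' where "f' \<in> smaps B K" "smap_comp A f' j = y" by blast
    then show ?case using ext[of f' z] step.hyps(2) by simp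
  qed
  then show thesis using that by blast
qed

section \<open>Assembling the pullback square\<close>

lemma siso_bij:
  assumes X: "simplicial_set X" and f: "f \<in> smaps X Y"
    and bij: "\<And>n. bij_betw (f n) (cells X n) (cells Y n)" and Y: "simplicial_set Y"
  shows "siso X Y f"
  unfolding siso_def
proof (intro conjI f bexI)
  let ?g = "\<lambda>n. \<lambda>y\<in>cells Y n. inv_into (cells X n) (f n) y"
  have g: "?g n (f n x) = x" if "x \<in> cells X n" for n x
    using bij[of n] that by (auto simp: bij_betw_def)
  have ex: "\<exists>x\<in>cells X n. y = f n x" if "y \<in> cells Y n" for n y
    using bij[of n] that by (auto simp: bij_betw_def)
  show G: "?g \<in> smaps Y X"
    unfolding smaps_def
  proof (intro CollectI conjI allI ballI)
    have "?g n y \<in> cells X n" if "y \<in> cells Y n" for n y using ex[OF that] g by metis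
    then show "?g n \<in> cells Y n \<rightarrow>\<^sub>E cells X n" for n by auto
    fix m n \<alpha> y assume a: "\<alpha> \<in> simplex_hom m n" and "y \<in> cells Y n"
    then obtain x where x: "x \<in> cells X n" "y = f n x" using ex by blast
    have "act Y m n \<alpha> y = f m (act X m n \<alpha> x)" using smaps_actD[OF f a x(1)] x(2) by simp
    then show "?g m (act Y m n \<alpha> y) = act X m n \<alpha> (?g n y)"
      using g[OF x(1)] g[OF simplicial_setD(1)[OF X a x(1)]] x(2) by metis
  qed
  show "smap_comp X ?g f = sid X"
    by (rule smaps_eqI[OF smap_comp_in_smaps[OF X f G] sid_in_smaps[OF X]])
      (simp only: smap_comp_apply g, simp add: sid_def)
  show "smap_comp Y f ?g = sid Y"
  proof (rule smaps_eqI[OF smap_comp_in_smaps[OF Y G f] sid_in_smaps[OF Y]])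
    fix n y assume y: "y \<in> cells Y n"
    then obtain x where x: "x \<in> cells X n" "y = f n x" using ex by blast
    have "f n (?g n y) = y" unfolding x(2) g[OF x(1)] ..
    then show "smap_comp Y f ?g n y = sid Y n y" using y by (simp only: smap_comp_apply) (simp add: sid_def)
  qed
qed

theorem theorem5p2p3:
  fixes \<kappa> :: "'k rel"
    and D :: "'d sset" and A :: "'a sset" and B :: "'b sset"
    and q :: "nat \<Rightarrow> 'd \<Rightarrow> 'a" and j :: "nat \<Rightarrow> 'a \<Rightarrow> 'b"
  assumes "Card_order \<kappa>" and "regularCard \<kappa>"
    and "|simplex_morphisms| <o \<kappa>"
    and "kan_fibration D A q" and "small_map \<kappa> D A q"
    and "trivial_cofibration A B j"
  shows "\<exists>(E :: ('b \<times> 'k) sset) p r.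
           kan_fibration E B p \<and> small_map \<kappa> E B p \<and>
           r \<in> smaps D E \<and> pullback_square D E A B r q p j"
proof -
  note kan = assms(4) and small = assms(5) and tc = assms(6)
  have D: "simplicial_set D" and A: "simplicial_set A" and q: "q \<in> smaps D A"
    using kan by (auto simp: kan_fibration_def)
  have B: "simplicial_set B" and jm: "j \<in> smaps A B"
    using tc by (auto simp: trivial_cofibration_def smono_def)
  \<comment> \<open>The identities of the objects [n] are already infinitely many morphisms of the
    simplex category.\<close>
  have infinite_\<kappa>: "infinite (Field \<kappa>)"
  proof
    assume "finite (Field \<kappa>)"
    moreover have "|simplex_morphisms| \<le>o |Field \<kappa>|"
      using ordLess_imp_ordLeq[OF assms(3)] card_of_Field_ordIso[OF assms(1)] ordIso_symmetric ordLeq_ordIso_trans by blast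
    ultimately have "finite simplex_morphisms" using card_of_ordLeq_finite by blast
    moreover have "inj (\<lambda>n. (n, n, ident n))" by (auto simp: inj_def)
    moreover have "range (\<lambda>n. (n, n, ident n)) \<subseteq> simplex_morphisms" by (auto simp: simplex_morphisms_def)
    ultimately have "finite (UNIV :: nat set)" using inj_on_finite by blast
    then show False by simp
  qed
  note \<kappa> = assms(1) infinite_\<kappa>
  obtain c :: "nat \<Rightarrow> 'd \<Rightarrow> 'k" where c: "\<And>n a. a \<in> cells A n \<Longrightarrow> inj_on (c n) {d \<in> cells D n. q n d = a}"
    by (rule fibre_code[OF \<kappa>(1) small]) (rule that)
  let ?c = "\<lambda>n d. (q n d, c n d)"
  define D' where "D' = transport D ?c"
  have D': "fib_over \<kappa> A D'" and inj: "inj_on (?c n) (cells D n)" for n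
    unfolding D'_def using fib_over_transport[OF kan small c] by blast+
  have act_D': "act D' m n \<alpha> (?c n d) = ?c m (act D m n \<alpha> d)" if "d \<in> cells D n" for m n \<alpha> d
    unfolding D'_def using act_transport[of ?c n D d m \<alpha>] inj that by simp
  have inf: "infinite (UNIV :: ('a + 'b + nat) set)"
    using inj_on_finite[of "\<lambda>n. Inr (Inr n) :: 'a + 'b + nat" UNIV UNIV] by (auto simp: inj_def)
  have le: "|UNIV :: 'a set| \<le>o |UNIV :: ('a + 'b + nat) set|"
    by (rule card_of_ordLeqI[of Inl]) auto
  obtain K :: "('a + 'b + nat) sset" and i \<iota>
    where K: "kan_complex K" and i: "i \<in> smaps A K" and \<iota>: "smap_on K (cells K) (univ \<kappa>) \<iota>"
      and \<iota>i: "\<And>n a. a \<in> cells A n \<Longrightarrow> \<iota> n (i n a) = classify A D' n a"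
    using small_kan_hull[OF simplicial_set_univ univ_horn_fillable[OF \<kappa>] smap_on_classify[OF D'] A inf le] by metis
  obtain f where f: "f \<in> smaps B K" "smap_comp A f j = i"
    using trivial_cofibration_extend[OF tc K i] by metis
  define \<psi> where "\<psi> n b = \<iota> n (f n b)" for n b
  have \<psi>: "smap_on B (cells B) (univ \<kappa>) \<psi>"
    using smap_onD[OF \<iota>] smaps_cell[OF f(1)] smaps_actD[OF f(1)] by (intro smap_onI) (auto simp: \<psi>_def)
  have \<psi>j: "\<psi> n (j n a) = classify A D' n a" if "a \<in> cells A n" for n a
    using \<iota>i[OF that] fun_cong[OF fun_cong[OF f(2), of n], of a] that by (simp add: \<psi>_def smap_comp_apply)
  let ?E = "total B \<psi>"
  let ?p = "pr1 ?E"
  have E: "fib_over \<kappa> B ?E" by (rule total_fib_over[OF B \<psi>])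
  have p: "?p \<in> smaps ?E B" using fib_overD(3)[OF E] by (simp add: kan_fibration_def)
  \<comment> \<open>Because \<psi> extends the classifying map of D' by equality, the labels of the
    total space over j a are exactly those of D' over a. So r only replaces d by its label, and the
    comparison with the fibre product is bijective in each degree.\<close>
  have cells_E: "(j n a, x) \<in> cells ?E n \<longleftrightarrow> (a, x) \<in> cells D' n" if a: "a \<in> cells A n" for n a x
    using a smaps_cell[OF jm a] simplicial_setD(2)[OF A a] by (simp add: cells_total \<psi>j cells_classify)
  have act_E: "act ?E m n \<alpha> (j n a, x) = (j m (act A m n \<alpha> a), snd (act D' m n \<alpha> (a, x)))"
    if "\<alpha> \<in> simplex_hom m n" "(a, x) \<in> cells D' n" for m n \<alpha> a x
  proof -
    have a: "a \<in> cells A n" using fib_overD(5)[OF D' that(2)] by simp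
    show ?thesis
      using that simplicial_setD(2)[OF A a] smaps_actD[OF jm that(1) a] by (simp add: act_total \<psi>j[OF a] act_classify)
  qed
  define r where "r n = (\<lambda>d\<in>cells D n. (j n (q n d), c n d))" for n
  have r_cell: "r n d \<in> cells ?E n" if d: "d \<in> cells D n" for n d
    using cells_E[OF smaps_cell[OF q d]] d by (simp add: r_def D'_def)
  have r: "r \<in> smaps D ?E"
    unfolding smaps_def
  proof (intro CollectI conjI allI ballI)
    show "r n \<in> cells D n \<rightarrow>\<^sub>E cells ?E n" for n using r_cell by (auto simp: r_def)
    fix m n \<alpha> d assume a: "\<alpha> \<in> simplex_hom m n" and d: "d \<in> cells D n"
    have "?c n d \<in> cells D' n" using d by (simp add: D'_def)
    from act_E[OF a this] show "r m (act D m n \<alpha> d) = act ?E m n \<alpha> (r n d)"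
      using act_D'[OF d] d simplicial_setD(1)[OF D a d] smaps_actD[OF q a d] by (simp add: r_def)
  qed
  let ?P = "fibre_product A ?E j ?p"
  have cells_P: "(a, e) \<in> cells ?P n \<longleftrightarrow> a \<in> cells A n \<and> e \<in> cells ?E n \<and> j n a = fst e" for n a e
    by (auto simp: fibre_product_def pr1_def)
  have P: "simplicial_set ?P"
    by (rule simplicial_set_fibre_product[OF A fib_overD(1)[OF E] jm p])
  have pair: "spair D q r \<in> smaps D ?P"
    unfolding smaps_def
  proof (intro CollectI conjI allI ballI)
    have "(q n d, r n d) \<in> cells ?P n" if "d \<in> cells D n" for n d
      using that r_cell[OF that] smaps_cell[OF q that] unfolding cells_P by (simp add: r_def)
    then show "spair D q r n \<in> cells D n \<rightarrow>\<^sub>E cells ?P n" for n by (auto simp: spair_def)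
    fix m n \<alpha> d assume a: "\<alpha> \<in> simplex_hom m n" and d: "d \<in> cells D n"
    then show "spair D q r m (act D m n \<alpha> d) = act ?P m n \<alpha> (spair D q r n d)"
      using simplicial_setD(1)[OF D a d] smaps_actD[OF q a d] smaps_actD[OF r a d]
      by (simp add: spair_def fibre_product_def sprod_def)
  qed
  have bij: "bij_betw (spair D q r n) (cells D n) (cells ?P n)" for n
    unfolding bij_betw_def
  proof (intro conjI equalityI subsetI)
    show "inj_on (spair D q r n) (cells D n)"
      using inj[of n] by (auto simp: inj_on_def spair_def r_def)
    show "z \<in> cells ?P n" if "z \<in> spair D q r n ` cells D n" for z
      using that smaps_cell[OF pair] by blast
    fix z assume z: "z \<in> cells ?P n"
    obtain a b x where abx: "z = (a, (b, x))" by (metis surj_pair)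
    have a: "a \<in> cells A n" "b = j n a" "(b, x) \<in> cells ?E n" using z by (simp_all add: abx cells_P)
    then have "(a, x) \<in> cells D' n" using cells_E by simp
    then obtain d where d: "d \<in> cells D n" "a = q n d" "x = c n d" by (auto simp: D'_def)
    have "z = spair D q r n d" using d a(2) by (simp add: abx spair_def r_def)
    then show "z \<in> spair D q r n ` cells D n" using d(1) by blast
  qed
  have "smap_comp D ?p r = smap_comp D j q"
    using r_cell by (auto simp: smap_comp_def compose_def fun_eq_iff pr1_def) (simp add: r_def)
  then have "pullback_square D ?E A B r q ?p j"
    unfolding pullback_square_def using r q p jm siso_bij[OF D pair bij P] by blast
  then show ?thesis using fib_overD(3,4)[OF E] r by blast
qed

end
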